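(* Let $\omega:[a,b]\to\mathbb{R}^d$ be a path. Suppose that for some $r>1$, $1<p<\infty$, $1\le q\le\infty$ and $\alpha\in\mathbb{R}$, the occupation measure $\mu$ of $\omega$ satisfies $\mu_{a,\cdot}\in V^r(a,b;B^{\alpha}_{p,q})$. Let $f:[a,b]\to\mathbb{R}^d$ be a function with $f\in V^{r_1}(a,b;\mathbb{R}^d)$ for some $r_1\ge1$, let $\omega^f_s:=\omega_s+f_s$, and let $\mu^f$ be the occupation measure of $\omega^f$. Let $r'$ be the Hölder conjugate of $r$. Then for every $\gamma$ with $\frac{r_1}{r'}<\gamma\le1$, $$\mu^f_{a,\cdot}\in V^r(a,b;B^{\alpha-\gamma}_{p,q}).$$ Moreover, if $f,g\in V^{r_1}(a,b;\mathbb{R}^d)$, then for every $\frac{r_1}{r'}<\gamma\le1$, $$\|\mu^f_{a,\cdot}-\mu^g_{a,\cdot}\|_{V^r(B^{\alpha-\gamma-1}_{p,q})}\le C\,\|\mu_{a,\cdot}\|_{V^r(B^\alpha_{p,q})}\Big(\|f-g\|_{V^{r_1}}+(1+\|g\|_{V^{r_1}})\|f-g\|_{L^\infty}\Big),$$ with a constant $C$ independent of $\omega,f,g$.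
   Context: The occupation measure of a path $\omega:[a,b]\to\mathbb{R}^d$ is $\mu_{s,t}=\int_s^t\delta_{\omega_\tau}\,d\tau$, i.e. $\mu_{s,t}(A)=\mathrm{Leb}\{\tau\in[s,t]:\omega_\tau\in A\}$, and $\mu_{a,\cdot}$ denotes $t\mapsto\mu_{a,t}$. For a normed space $E$, $V^p(a,b;E)$ is the set of $f:[a,b]\to E$ of finite $p$-variation, with semi-norm $\|f\|_{V^p(a,b;E)}=\big(\sup\sum_{h=1}^n\|f(t_h)-f(t_{h-1})\|_E^p\big)^{1/p}$, the supremum being over all finite partitions $a=t_0<t_1<\dots<t_n=b$; $V^r(E)$ abbreviates $V^r(a,b;E)$. $B^s_{p,q}=B^s_{p,q}(\mathbb{R}^d)$ are the standard Besov spaces. *)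

theory Defs
  imports "HOL-Probability.Probability"
begin

text \<open>Only used with positive exponents (the value at \<open>\<top>\<close> is wrong otherwise).\<close>

definition ennreal_powr :: "ennreal \<Rightarrow> real \<Rightarrow> ennreal" where
  "ennreal_powr x s = (if x = \<top> then \<top> else ennreal (enn2real x powr s))"

text \<open>The argument \<open>g\<close> stands for the pointwise absolute value. On the counting measure
  this is the sequence norm of \<open>\<ell>\<^sup>p\<close>.\<close>

definition Lp_norm :: "'b measure \<Rightarrow> ennreal \<Rightarrow> ('b \<Rightarrow> ennreal) \<Rightarrow> ennreal" where
  "Lp_norm M p g =
     (if p = \<infinity> then esssup M g
      else ennreal_powr (\<integral>\<^sup>+ x. ennreal_powr (g x) (enn2real p) \<partial>M) (1 / enn2real p))"

text \<open>Iterated partial derivatives; the list \<open>vs\<close> of basis vectors plays the role of a multi-index.\<close>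

primrec partials :: "'a::euclidean_space list \<Rightarrow> ('a \<Rightarrow> complex) \<Rightarrow> 'a \<Rightarrow> complex" where
  "partials [] f = f"
| "partials (v # vs) f = (\<lambda>x. frechet_derivative (partials vs f) (at x) v)"

definition smooth :: "('a::euclidean_space \<Rightarrow> complex) \<Rightarrow> bool" where
  "smooth f \<longleftrightarrow> (\<forall>vs \<in> lists Basis. \<forall>x. partials vs f differentiable (at x))"

definition schwartz_norm :: "nat \<Rightarrow> ('a::euclidean_space \<Rightarrow> complex) \<Rightarrow> ennreal" where
  "schwartz_norm N f =
     (SUP vs \<in> {vs \<in> lists Basis. length vs \<le> N}. SUP x.
        ennreal ((1 + norm x) ^ N * norm (partials vs f x)))"

definition schwartz :: "('a::euclidean_space \<Rightarrow> complex) \<Rightarrow> bool" where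
  "schwartz f \<longleftrightarrow> smooth f \<and> (\<forall>N. schwartz_norm N f < \<infinity>)"

text \<open>A distribution is a function on all of \<open>'a \<Rightarrow> complex\<close>, but its values off the Schwartz
  functions are irrelevant and never used.\<close>

definition tempered :: "(('a::euclidean_space \<Rightarrow> complex) \<Rightarrow> complex) \<Rightarrow> bool" where
  "tempered u \<longleftrightarrow>
     (\<forall>\<phi> \<psi>. schwartz \<phi> \<longrightarrow> schwartz \<psi> \<longrightarrow> u (\<lambda>x. \<phi> x + \<psi> x) = u \<phi> + u \<psi>) \<and>
     (\<forall>c \<phi>. schwartz \<phi> \<longrightarrow> u (\<lambda>x. c * \<phi> x) = c * u \<phi>) \<and>
     (\<exists>C N. \<forall>\<phi>. schwartz \<phi> \<longrightarrow> ennreal (norm (u \<phi>)) \<le> ennreal C * schwartz_norm N \<phi>)"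

definition distribution_of :: "'a::euclidean_space measure \<Rightarrow> ('a \<Rightarrow> complex) \<Rightarrow> complex" where
  "distribution_of M \<phi> = (\<integral>x. \<phi> x \<partial>M)"

text \<open>Generator of a smooth dyadic partition of unity on the frequency side, with
  \<open>\<Sum>j. dyadic \<phi> j \<xi> = 1\<close> for every \<open>\<xi>\<close>. Different generators give the same Besov spaces with
  equivalent norms.\<close>

definition dyadic_generator :: "('a::euclidean_space \<Rightarrow> complex) \<Rightarrow> bool" where
  "dyadic_generator \<phi> \<longleftrightarrow>
     schwartz \<phi> \<and> (\<forall>\<xi>. norm \<xi> \<le> 1 \<longrightarrow> \<phi> \<xi> = 1) \<and> (\<forall>\<xi>. norm \<xi> \<ge> 3 / 2 \<longrightarrow> \<phi> \<xi> = 0)"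

primrec dyadic :: "('a::euclidean_space \<Rightarrow> complex) \<Rightarrow> nat \<Rightarrow> 'a \<Rightarrow> complex" where
  "dyadic \<phi> 0 = \<phi>"
| "dyadic \<phi> (Suc j) = (\<lambda>\<xi>. \<phi> (\<xi> /\<^sub>R 2 ^ Suc j) - \<phi> (\<xi> /\<^sub>R 2 ^ j))"

definition inverse_fourier :: "('a::euclidean_space \<Rightarrow> complex) \<Rightarrow> 'a \<Rightarrow> complex" where
  "inverse_fourier \<psi> x =
     complex_of_real (1 / (2 * pi) ^ DIM('a)) * (\<integral>\<xi>. cis (x \<bullet> \<xi>) * \<psi> \<xi> \<partial>lborel)"

text \<open>The Fourier multiplier with symbol \<open>dyadic \<phi> j\<close>, as the convolution of \<open>u\<close> with the
  inverse Fourier transform of the symbol.\<close>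

definition LP_block ::
  "('a::euclidean_space \<Rightarrow> complex) \<Rightarrow> nat \<Rightarrow> (('a \<Rightarrow> complex) \<Rightarrow> complex) \<Rightarrow> 'a \<Rightarrow> complex" where
  "LP_block \<phi> j u x = u (\<lambda>y. inverse_fourier (dyadic \<phi> j) (x - y))"

definition besov_norm ::
  "('a::euclidean_space \<Rightarrow> complex) \<Rightarrow> real \<Rightarrow> ennreal \<Rightarrow> ennreal
     \<Rightarrow> (('a \<Rightarrow> complex) \<Rightarrow> complex) \<Rightarrow> ennreal" where
  "besov_norm \<phi> s p q u =
     Lp_norm (count_space (UNIV :: nat set)) q
       (\<lambda>j. ennreal (2 powr (s * real j)) * Lp_norm lborel p (\<lambda>x. ennreal (norm (LP_block \<phi> j u x))))"

definition besov_space ::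
  "('a::euclidean_space \<Rightarrow> complex) \<Rightarrow> real \<Rightarrow> ennreal \<Rightarrow> ennreal
     \<Rightarrow> (('a \<Rightarrow> complex) \<Rightarrow> complex) set" where
  "besov_space \<phi> s p q = {u. tempered u \<and> besov_norm \<phi> s p q u < \<infinity>}"

text \<open>A normed space is given by its carrier \<open>E\<close> and a norm \<open>N\<close> (finite on \<open>E\<close>).\<close>

definition partitions :: "real \<Rightarrow> real \<Rightarrow> (nat \<times> (nat \<Rightarrow> real)) set" where
  "partitions a b = {(n, t). t 0 = a \<and> t n = b \<and> (\<forall>h<n. t h < t (Suc h))}"

definition variation_norm ::
  "('e::minus \<Rightarrow> ennreal) \<Rightarrow> real \<Rightarrow> real \<Rightarrow> real \<Rightarrow> (real \<Rightarrow> 'e) \<Rightarrow> ennreal" where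
  "variation_norm N p a b f =
     ennreal_powr
       (SUP (n, t) \<in> partitions a b. \<Sum>h = 1..n. ennreal_powr (N (f (t h) - f (t (h - 1)))) p)
       (1 / p)"

definition variation_space ::
  "'e::minus set \<Rightarrow> ('e \<Rightarrow> ennreal) \<Rightarrow> real \<Rightarrow> real \<Rightarrow> real \<Rightarrow> (real \<Rightarrow> 'e) set" where
  "variation_space E N p a b = {f. f ` {a..b} \<subseteq> E \<and> variation_norm N p a b f < \<infinity>}"

abbreviation vec_norm :: "'a::real_normed_vector \<Rightarrow> ennreal" where
  "vec_norm x \<equiv> ennreal (norm x)"

definition occupation_measure ::
  "(real \<Rightarrow> 'a::euclidean_space) \<Rightarrow> real \<Rightarrow> real \<Rightarrow> 'a measure" where
  "occupation_measure \<omega> s t = distr (lebesgue_on {s..t}) borel \<omega>"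

definition occupation_flow ::
  "(real \<Rightarrow> 'a::euclidean_space) \<Rightarrow> real \<Rightarrow> real \<Rightarrow> ('a \<Rightarrow> complex) \<Rightarrow> complex" where
  "occupation_flow \<omega> a t = distribution_of (occupation_measure \<omega> a t)"

end

theory Submission
  imports Defs "HOL-Library.Function_Algebras"
begin

text \<open>
  Let \<open>\<mu>\<^sub>s\<^sub>t\<close> be the occupation measure over \<open>[s, t]\<close> and \<open>T\<^sub>h\<close> the translation by \<open>h\<close>. The shifted occupation
  measure is the sewing of the germ \<open>T\<^bsub>f s\<^esub> \<mu>\<^sub>s\<^sub>t\<close>, whose defect at an intermediate time \<open>u\<close> is
  \<open>(T\<^bsub>f s\<^esub> - T\<^bsub>f u\<^esub>) \<mu>\<^sub>u\<^sub>t\<close>. A translation by \<open>h\<close> differs from the identity by at most \<open>C \<bar>h\<bar>\<^sup>\<gamma>\<close> as an operator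
  that loses \<open>\<gamma>\<close> derivatives on the Besov scale, so the defect is controlled by
  \<open>w\<^sub>f(s, u) powr (\<gamma> / r1) * w\<^sub>\<mu>(u, t) powr (1 / r)\<close>, and \<open>\<gamma> / r1 + 1 / r > 1\<close> by hypothesis. Since \<open>f\<close> need not be
  continuous, the Riemann sums are estimated by Young's removal of points, uniformly in the partition, and
  the bound passes to the limit by Fatou's lemma, \<open>f\<close> having only countably many discontinuities.
  With \<open>d = f - g\<close> the difference of two shifts is handled in the same way, using
  \<open>T\<^bsub>f s\<^esub> - T\<^bsub>g s\<^esub> - T\<^bsub>f u\<^esub> + T\<^bsub>g u\<^esub> = (T\<^bsub>g s + d s\<^esub> - T\<^bsub>g s + d u\<^esub>) + (T\<^bsub>d u\<^esub> - 1) (T\<^bsub>g s\<^esub> - T\<^bsub>g u\<^esub>)\<close>.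

  The translation estimate rests on the reproducing formula \<open>K\<^sub>j = K\<^sub>j * (K\<^bsub>j-1\<^esub> + K\<^sub>j + K\<^bsub>j+1\<^esub>)\<close> for the
  Littlewood-Paley kernels, which is Fourier inversion for the dyadic symbols.
\<close>

section \<open>Lebesgue norms\<close>

text \<open>No sewing limit has to be constructed: the limit is known in advance, since the blocks
  of the shifted occupation measure are integrals of smooth kernels. Only a bound on Riemann sums,
  uniform in the partition, is wanted. Working with sequences of Littlewood-Paley blocks makes the
  limit a pointwise one, and Fatou's lemma, in x and then in the frequency index, takes the place of
  completeness of the Besov space. Two obstacles shape the second estimate. It has to be linear in
  \<open>f - g\<close> with a constant free of the paths; therefore the controls of
  \<open>f - g\<close> and of \<open>g\<close> are divided by their totals before they enter the
  sewing bound, and the totals come out as factors. Moreover the uniform norm is an essential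
  supremum, so \<open>f - g\<close> can be larger at exceptional times; partition points are
  therefore taken in a dense set of good times, and a start outside this set is reached by a limit
  from the right. The additional derivative pays for linearity: a translation by d costs the first
  power of the length of d only against a full derivative.\<close>

lemma ennreal_powr_ennreal [simp]: "0 \<le> x \<Longrightarrow> ennreal_powr (ennreal x) s = ennreal (x powr s)"
  by (simp add: ennreal_powr_def)

lemma ennreal_powr_top [simp]: "ennreal_powr \<top> s = \<top>"
  by (simp add: ennreal_powr_def)

lemma ennreal_powr_0 [simp]: "ennreal_powr 0 s = 0"
  by (simp add: ennreal_powr_def)

lemma ennreal_powr_one [simp]: "ennreal_powr x 1 = x"
  by (cases x) auto

lemma ennreal_powr_powr: "ennreal_powr (ennreal_powr x s) t = ennreal_powr x (s * t)"
  by (cases x) (auto simp: powr_powr)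

lemma ennreal_powr_inverse [simp]:
  "s \<noteq> 0 \<Longrightarrow> ennreal_powr (ennreal_powr x s) (1 / s) = x"
  "s \<noteq> 0 \<Longrightarrow> ennreal_powr (ennreal_powr x (1 / s)) s = x"
  by (simp_all add: ennreal_powr_powr)

lemma ennreal_powr_mono: "0 < s \<Longrightarrow> x \<le> y \<Longrightarrow> ennreal_powr x s \<le> ennreal_powr y s"
  by (cases x; cases y) (auto simp: top_unique powr_mono2)

text \<open>For a positive exponent the power map is an order isomorphism of the extended half-line
  with inverse the power \<open>1 / s\<close>. This adjunction moves exponents across inequalities
  and makes powers commute with arbitrary suprema.\<close>

lemma ennreal_powr_le_iff: "0 < s \<Longrightarrow> ennreal_powr x s \<le> y \<longleftrightarrow> x \<le> ennreal_powr y (1 / s)"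
  using ennreal_powr_mono[of s x "ennreal_powr y (1 / s)"] ennreal_powr_mono[of "1 / s" "ennreal_powr x s" y]
  by auto

lemma ennreal_powr_mult: "ennreal_powr (x * y) s = ennreal_powr x s * ennreal_powr y s"
proof (cases "x = \<top> \<or> y = \<top>")
  case True
  then show ?thesis by (auto simp: ennreal_mult_top ennreal_top_mult ennreal_powr_def enn2real_eq_0_iff)
next
  case False
  then obtain a b where "x = ennreal a" "0 \<le> a" "y = ennreal b" "0 \<le> b" by (cases x; cases y) auto
  then show ?thesis by (simp add: ennreal_mult[symmetric] powr_mult)
qed

lemma ennreal_powr_less_top [simp]: "ennreal_powr x s < \<top> \<longleftrightarrow> x < \<top>"
  by (cases x) auto

lemma ennreal_powr_SUP:
  assumes "0 < s" shows "ennreal_powr (SUP i\<in>I. f i) s = (SUP i\<in>I. ennreal_powr (f i) s)"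
proof (rule antisym)
  show "ennreal_powr (SUP i\<in>I. f i) s \<le> (SUP i\<in>I. ennreal_powr (f i) s)"
    unfolding ennreal_powr_le_iff[OF assms]
    by (intro SUP_least) (auto simp: ennreal_powr_le_iff[OF assms, symmetric] intro: SUP_upper)
qed (auto intro!: SUP_least ennreal_powr_mono assms intro: SUP_upper)

lemma ennreal_powr_measurable [measurable]:
  assumes "f \<in> borel_measurable M" shows "(\<lambda>x. ennreal_powr (f x) s) \<in> borel_measurable M"
  using assms unfolding ennreal_powr_def by measurable

text \<open>Convexity of the p-th power at \<open>x / A\<close> and \<open>y / B\<close> with
  weights \<open>A / (A + B)\<close> and \<open>B / (A + B)\<close>. Integrated with A and B close
  to the norms of the two functions it becomes Minkowski's inequality, without duality.\<close>

lemma ennreal_powr_add_le: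
  assumes "1 \<le> p" "0 < A" "0 < B"
  shows "ennreal_powr (x + y) p \<le>
    ennreal ((A + B) powr (p - 1)) *
      (ennreal (A powr (1 - p)) * ennreal_powr x p + ennreal (B powr (1 - p)) * ennreal_powr y p)"
proof (cases "x = \<top> \<or> y = \<top>")
  case True
  then show ?thesis using assms
    by (auto simp: ennreal_mult_top ennreal_top_mult)
next
  case False
  then obtain u v where uv: "x = ennreal u" "0 \<le> u" "y = ennreal v" "0 \<le> v" by (cases x; cases y) auto
  have *: "(u + v) powr p \<le> (A + B) powr (p - 1) * (A powr (1 - p) * u powr p + B powr (1 - p) * v powr p)"
  proof -
    define t where "t = A / (A + B)"
    have t: "0 < t" "t < 1" "1 - t = B / (A + B)" using assms by (auto simp: t_def field_simps)
    have "((1 - t) * (v / B) + t * (u / A)) powr p \<le> (1 - t) * (v / B) powr p + t * (u / A) powr p"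
    proof (cases "u = 0 \<or> v = 0")
      case False
      then have "0 < u" "0 < v" using uv by auto
      then show ?thesis
        using convex_onD[OF powr_convex[OF \<open>1 \<le> p\<close>], of t "v / B" "u / A"] t assms by auto
    next
      \<comment> \<open>\<open>powr_convex\<close> is applied to positive arguments only. With a
        zero argument the claim reduces to \<open>c powr p \<le> c\<close> for a weight c between 0
        and 1.\<close>
      case True
      have c: "(c * z) powr p \<le> c * z powr p" if "0 < c" "c < 1" "0 \<le> z" for c z :: real
      proof -
        have "c powr p \<le> c powr 1" using that assms by (intro powr_mono') auto
        then show ?thesis using that by (simp add: powr_mult mult_right_mono)
      qed
      from True show ?thesis using c[of t "u / A"] c[of "1 - t" "v / B"] t uv assms by auto
    qed
    moreover have "(1 - t) * (v / B) + t * (u / A) = (u + v) / (A + B)"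
      unfolding t(3) unfolding t_def using assms by (simp add: add_divide_distrib add.commute)
    ultimately have "((u + v) / (A + B)) powr p \<le> B / (A + B) * (v / B) powr p + A / (A + B) * (u / A) powr p"
      using t by (simp add: t_def)
    then have "(A + B) powr p * ((u + v) / (A + B)) powr p \<le>
       (A + B) powr p * (B / (A + B) * (v / B) powr p + A / (A + B) * (u / A) powr p)"
      by (intro mult_left_mono) auto
    also have "(A + B) powr p * ((u + v) / (A + B)) powr p = (u + v) powr p"
      using assms uv by (simp add: powr_divide)
    also have "(A + B) powr p * (B / (A + B) * (v / B) powr p + A / (A + B) * (u / A) powr p) =
       (A + B) powr (p - 1) * (A powr (1 - p) * u powr p + B powr (1 - p) * v powr p)"
      using assms uv by (simp add: powr_divide powr_diff distrib_left mult.commute mult.left_commute add.commute)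
    finally show ?thesis .
  qed
  show ?thesis
    using * uv assms by (simp add: ennreal_mult[symmetric] ennreal_plus[symmetric] del: ennreal_plus)
qed

section \<open>Minkowski's inequality and Fatou's lemma for finite exponents\<close>

lemma Lp_norm_finite_exponent:
  "p < \<infinity> \<Longrightarrow> Lp_norm M p g = ennreal_powr (\<integral>\<^sup>+ x. ennreal_powr (g x) (enn2real p) \<partial>M) (1 / enn2real p)"
  by (auto simp: Lp_norm_def)

lemma enn2real_ge_1: "1 \<le> p \<Longrightarrow> p < \<infinity> \<Longrightarrow> 1 \<le> enn2real p"
  by (cases p) auto

text \<open>The counting measure has no null set except the empty one, so an almost everywhere bound
  is a bound everywhere.\<close>

lemma Lp_norm_infinity_count_space: "Lp_norm (count_space UNIV) \<top> g = (SUP j. g j)"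
proof -
  have "esssup (count_space UNIV) g = Inf {z. \<forall>j. g j \<le> z}"
    by (subst esssup_eq_AE) (auto simp: AE_count_space)
  also have "\<dots> = (SUP j. g j)"
    by (intro antisym Inf_lower Inf_greatest) (auto intro: SUP_upper SUP_least)
  finally show ?thesis by (simp add: Lp_norm_def)
qed

lemma Lp_norm_mono:
  assumes "1 \<le> p" "p < \<infinity>" "\<And>x. f x \<le> g x"
  shows "Lp_norm M p f \<le> Lp_norm M p g"
  using assms enn2real_ge_1[of p]
  by (auto simp: Lp_norm_finite_exponent intro!: ennreal_powr_mono nn_integral_mono)

lemma Lp_norm_cmult:
  assumes "1 \<le> p" "p < \<infinity>" "g \<in> borel_measurable M"
  shows "Lp_norm M p (\<lambda>x. c * g x) = c * Lp_norm M p g"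
  using assms enn2real_ge_1[of p]
  by (simp add: Lp_norm_finite_exponent ennreal_powr_mult nn_integral_cmult)

lemma Lp_norm_SUP:
  fixes f :: "nat \<Rightarrow> 'b \<Rightarrow> ennreal"
  assumes "1 \<le> p" "p < \<infinity>" "incseq f" "\<And>i. f i \<in> borel_measurable M"
  shows "Lp_norm M p (\<lambda>x. SUP i. f i x) = (SUP i. Lp_norm M p (f i))"
proof -
  note p = enn2real_ge_1[OF assms(1,2)]
  have "(\<integral>\<^sup>+ x. (SUP i. ennreal_powr (f i x) (enn2real p)) \<partial>M) = (SUP i. \<integral>\<^sup>+ x. ennreal_powr (f i x) (enn2real p) \<partial>M)"
    using assms p by (intro nn_integral_monotone_convergence_SUP)
      (auto simp: incseq_def le_fun_def intro!: ennreal_powr_mono)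
  then show ?thesis using assms p by (simp add: Lp_norm_finite_exponent ennreal_powr_SUP)
qed

lemma Lp_norm_le_iff:
  assumes "1 \<le> p" "p < \<infinity>"
  shows "Lp_norm M p g \<le> c \<longleftrightarrow> (\<integral>\<^sup>+ x. ennreal_powr (g x) (enn2real p) \<partial>M) \<le> ennreal_powr c (enn2real p)"
  using assms enn2real_ge_1[of p] by (simp add: Lp_norm_finite_exponent ennreal_powr_le_iff)

lemma Lp_norm_triangle:
  assumes p: "1 \<le> p" "p < \<infinity>" and [measurable]: "f \<in> borel_measurable M" "g \<in> borel_measurable M"
  shows "Lp_norm M p (\<lambda>x. f x + g x) \<le> Lp_norm M p f + Lp_norm M p g"
proof (cases "Lp_norm M p f = \<top> \<or> Lp_norm M p g = \<top>")
  case False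
  then obtain F G where FG: "Lp_norm M p f = ennreal F" "0 \<le> F" "Lp_norm M p g = ennreal G" "0 \<le> G"
    by (cases "Lp_norm M p f"; cases "Lp_norm M p g") auto
  let ?p = "enn2real p"
  note p1 = enn2real_ge_1[OF p]
  show ?thesis
  proof (rule ennreal_le_epsilon)
    fix e :: real assume "0 < e"
    \<comment> \<open>Enlarging both norms by \<open>e / 2\<close> keeps the weights positive even
      when a norm vanishes, and costs e in total.\<close>
    define A B where "A = F + e / 2" and "B = G + e / 2"
    have AB: "0 < A" "0 < B" using FG \<open>0 < e\<close> by (auto simp: A_def B_def)
    have iA: "(\<integral>\<^sup>+ x. ennreal_powr (f x) ?p \<partial>M) \<le> ennreal (A powr ?p)"
    proof -
      have "Lp_norm M p f \<le> ennreal A" using FG \<open>0 < e\<close> by (simp add: A_def)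
      then show ?thesis using AB by (simp add: Lp_norm_le_iff[OF p])
    qed
    have iB: "(\<integral>\<^sup>+ x. ennreal_powr (g x) ?p \<partial>M) \<le> ennreal (B powr ?p)"
    proof -
      have "Lp_norm M p g \<le> ennreal B" using FG \<open>0 < e\<close> by (simp add: B_def)
      then show ?thesis using AB by (simp add: Lp_norm_le_iff[OF p])
    qed
    have "(\<integral>\<^sup>+ x. ennreal_powr (f x + g x) ?p \<partial>M) \<le>
      (\<integral>\<^sup>+ x. ennreal ((A + B) powr (?p - 1)) *
      (ennreal (A powr (1 - ?p)) * ennreal_powr (f x) ?p + ennreal (B powr (1 - ?p)) * ennreal_powr (g x) ?p) \<partial>M)"
      by (intro nn_integral_mono ennreal_powr_add_le p1 AB)
    also have "\<dots> = ennreal ((A + B) powr (?p - 1)) *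
      (ennreal (A powr (1 - ?p)) * (\<integral>\<^sup>+ x. ennreal_powr (f x) ?p \<partial>M) +
       ennreal (B powr (1 - ?p)) * (\<integral>\<^sup>+ x. ennreal_powr (g x) ?p \<partial>M))"
      by (simp add: nn_integral_cmult nn_integral_add)
    also have "\<dots> \<le> ennreal ((A + B) powr (?p - 1)) *
      (ennreal (A powr (1 - ?p)) * ennreal (A powr ?p) + ennreal (B powr (1 - ?p)) * ennreal (B powr ?p))"
      by (intro mult_left_mono add_mono iA iB) auto
    also have "\<dots> = ennreal ((A + B) powr ?p)"
      using AB by (simp add: ennreal_mult[symmetric] ennreal_plus[symmetric] powr_add[symmetric] powr_diff del: ennreal_plus)
    finally have "Lp_norm M p (\<lambda>x. f x + g x) \<le> ennreal (A + B)"
      using AB by (simp add: Lp_norm_le_iff[OF p] ennreal_plus[symmetric] del: ennreal_plus)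
    then show "Lp_norm M p (\<lambda>x. f x + g x) \<le> Lp_norm M p f + Lp_norm M p g + ennreal e"
      using FG \<open>0 < e\<close> by (simp add: A_def B_def ennreal_plus[symmetric] algebra_simps del: ennreal_plus)
  qed
qed auto

text \<open>The lower limit is an increasing limit of tail infima: monotone convergence handles the
  limit, and monotonicity of the norm handles each infimum.\<close>

lemma Lp_norm_Fatou:
  fixes f :: "nat \<Rightarrow> 'b \<Rightarrow> ennreal"
  assumes p: "1 \<le> p" "p < \<infinity>" and [measurable]: "\<And>i. f i \<in> borel_measurable M"
  shows "Lp_norm M p (\<lambda>x. liminf (\<lambda>i. f i x)) \<le> liminf (\<lambda>i. Lp_norm M p (f i))"
proof -
  have "Lp_norm M p (\<lambda>x. liminf (\<lambda>i. f i x)) = (SUP n. Lp_norm M p (\<lambda>x. INF k\<in>{n..}. f k x))"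
    unfolding liminf_SUP_INF by (rule Lp_norm_SUP[OF p]) (auto simp: incseq_def le_fun_def intro!: INF_superset_mono)
  also have "\<dots> \<le> liminf (\<lambda>i. Lp_norm M p (f i))"
    unfolding liminf_SUP_INF
    by (intro SUP_mono') (auto intro!: INF_greatest Lp_norm_mono p INF_lower)
  finally show ?thesis .
qed

section \<open>Sequence norms, with infinite exponent allowed, and shifts of the index\<close>

lemma seq_norm_mono:
  fixes f g :: "nat \<Rightarrow> ennreal"
  assumes "1 \<le> q" "\<And>x. f x \<le> g x"
  shows "Lp_norm (count_space UNIV) q f \<le> Lp_norm (count_space UNIV) q g"
  using assms by (cases "q = \<top>")
    (auto simp: Lp_norm_infinity_count_space less_top[symmetric] intro!: Lp_norm_mono SUP_mono')

lemma seq_norm_cmult: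
  fixes g :: "nat \<Rightarrow> ennreal"
  assumes "1 \<le> q"
  shows "Lp_norm (count_space UNIV) q (\<lambda>x. c * g x) = c * Lp_norm (count_space UNIV) q g"
  using assms by (cases "q = \<top>")
    (auto simp: Lp_norm_infinity_count_space SUP_mult_left_ennreal less_top[symmetric] intro!: Lp_norm_cmult)

lemma seq_norm_triangle:
  fixes f g :: "nat \<Rightarrow> ennreal"
  assumes "1 \<le> q"
  shows "Lp_norm (count_space UNIV) q (\<lambda>x. f x + g x) \<le>
    Lp_norm (count_space UNIV) q f + Lp_norm (count_space UNIV) q g"
proof (cases "q = \<top>")
  case True
  then show ?thesis by (auto simp: Lp_norm_infinity_count_space intro!: SUP_least add_mono SUP_upper)
qed (use assms in \<open>auto simp: less_top[symmetric] intro!: Lp_norm_triangle\<close>)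

lemma seq_norm_Fatou:
  fixes f :: "nat \<Rightarrow> nat \<Rightarrow> ennreal"
  assumes q: "1 \<le> q"
  shows "Lp_norm (count_space UNIV) q (\<lambda>x. liminf (\<lambda>i. f i x)) \<le> liminf (\<lambda>i. Lp_norm (count_space UNIV) q (f i))"
proof (cases "q = \<top>")
  case True
  show ?thesis unfolding True Lp_norm_infinity_count_space
    by (intro SUP_least Liminf_mono always_eventually allI) (auto intro: SUP_upper)
qed (use assms in \<open>auto simp: less_top[symmetric] intro!: Lp_norm_Fatou\<close>)

text \<open>A block is compared with its two neighbours in frequency, so the norm must tolerate a
  shift of the index by one. Shifting down drops the first term; the next lemma shifts up and
  inserts a zero.\<close>

lemma seq_norm_Suc_le:
  fixes f :: "nat \<Rightarrow> ennreal"
  assumes q: "1 \<le> q"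
  shows "Lp_norm (count_space UNIV) q (\<lambda>j. f (Suc j)) \<le> Lp_norm (count_space UNIV) q f"
proof (cases "q = \<top>")
  case True
  show ?thesis unfolding True Lp_norm_infinity_count_space by (auto intro!: SUP_least SUP_upper)
next
  case False
  then have q': "q < \<infinity>" by (auto simp: less_top[symmetric])
  have "(\<integral>\<^sup>+ x. ennreal_powr (f (Suc x)) (enn2real q) \<partial>count_space UNIV) =
      (\<integral>\<^sup>+ x. ennreal_powr (f x) (enn2real q) \<partial>count_space (range Suc))"
    by (rule nn_integral_bij_count_space) (auto simp: bij_betw_def)
  also have "\<dots> = (\<integral>\<^sup>+ x\<in>range Suc. ennreal_powr (f x) (enn2real q) \<partial>count_space UNIV)"
    by (simp add: nn_integral_count_space_indicator)
  also have "\<dots> \<le> (\<integral>\<^sup>+ x. ennreal_powr (f x) (enn2real q) \<partial>count_space UNIV)"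
    by (intro nn_integral_mono) (auto simp: indicator_def)
  finally show ?thesis
    using enn2real_ge_1[OF q q'] by (simp add: Lp_norm_finite_exponent[OF q'] ennreal_powr_mono)
qed

lemma seq_norm_pred_le:
  fixes f :: "nat \<Rightarrow> ennreal"
  assumes q: "1 \<le> q"
  shows "Lp_norm (count_space UNIV) q (\<lambda>j. if j = 0 then 0 else f (j - 1)) \<le> Lp_norm (count_space UNIV) q f"
proof (cases "q = \<top>")
  case True
  show ?thesis unfolding True Lp_norm_infinity_count_space by (auto intro!: SUP_least SUP_upper)
next
  case False
  then have q': "q < \<infinity>" by (auto simp: less_top[symmetric])
  have "(\<integral>\<^sup>+ x. ennreal_powr (if x = 0 then 0 else f (x - 1)) (enn2real q) \<partial>count_space UNIV) =
     (\<integral>\<^sup>+ x. ennreal_powr (if x = 0 then 0 else f (x - 1)) (enn2real q) \<partial>count_space (range Suc))"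
    by (simp add: nn_integral_count_space_indicator) (auto simp: indicator_def image_iff gr0_conv_Suc intro!: nn_integral_cong)
  also have "\<dots> = (\<integral>\<^sup>+ x. ennreal_powr (f x) (enn2real q) \<partial>count_space UNIV)"
    by (subst nn_integral_bij_count_space[symmetric, where g = Suc and A = UNIV]) (auto simp: bij_betw_def)
  finally show ?thesis
    by (simp add: Lp_norm_finite_exponent[OF q'])
qed

text \<open>The power function lies above its tangent at c, with equality at \<open>t = c\<close>.
  The parameter is left free so that it can be fitted to the mean value in the integral version
  below.\<close>

lemma Young_ineq_powr:
  assumes "1 \<le> P" "0 < c"
  shows "t \<le> ennreal (c powr (1 - P) / P) * ennreal_powr t P + ennreal (c * (1 - 1 / P))"
proof (cases t)
  case (real u)
  have "u \<le> c powr (1 - P) / P * u powr P + c * (1 - 1 / P)"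
  proof (cases "u = 0")
    case False
    then have u: "0 < u / c" using real assms by auto
    have "1 + P * (u / c - 1) \<le> (u / c) powr P"
    proof -
      have "P * (u / c - 1) \<le> (u / c) powr P - 1 powr P"
      proof (rule convex_on_imp_above_tangent[OF powr_convex[OF assms(1)]])
        show "((\<lambda>x. x powr P) has_real_derivative P) (at 1 within {0<..})"
          by (auto intro!: derivative_eq_intros)
      qed (use u in \<open>auto simp: interior_open\<close>)
      then show ?thesis by simp
    qed
    then have "c * (1 + P * (u / c - 1)) \<le> c * (u / c) powr P"
      using assms by (intro mult_left_mono) auto
    also have "c * (u / c) powr P = c powr (1 - P) * u powr P"
      using u assms real by (simp add: powr_divide powr_diff)
    also have "c * (1 + P * (u / c - 1)) = c + P * u - P * c"
      using assms by (simp add: algebra_simps)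
    finally have "(c + P * u - P * c) / P \<le> c powr (1 - P) * u powr P / P"
      using assms by (intro divide_right_mono) auto
    then show ?thesis using assms by (simp add: diff_divide_distrib add_divide_distrib algebra_simps)
  qed (use assms in auto)
  then show ?thesis
    using real assms by (simp add: ennreal_mult[symmetric] ennreal_plus[symmetric] del: ennreal_plus)
qed (use assms in \<open>auto simp: ennreal_mult_top\<close>)

text \<open>Jensen's inequality for the measure with density k and mass K, in unnormalised form.
  Integrating the tangent inequality avoids passing to a probability measure and needs no
  integrability of g.\<close>

lemma nn_integral_Jensen_powr:
  assumes P: "1 \<le> P" and [measurable]: "k \<in> borel_measurable M" "g \<in> borel_measurable M"
    and K: "(\<integral>\<^sup>+ x. k x \<partial>M) = ennreal K" "0 < K"
  shows "ennreal_powr (\<integral>\<^sup>+ x. k x * g x \<partial>M) P \<le>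
    ennreal (K powr (P - 1)) * (\<integral>\<^sup>+ x. k x * ennreal_powr (g x) P \<partial>M)"
proof (cases "(\<integral>\<^sup>+ x. k x * ennreal_powr (g x) P \<partial>M)")
  case top
  then show ?thesis using K by (simp add: ennreal_mult_top)
next
  case (real X)
  show ?thesis
  \<comment> \<open>With \<open>X = 0\<close> the parameter c chosen below would vanish; in that
    case \<open>k * g\<close> is zero almost everywhere.\<close>
  proof (cases "X = 0")
    case True
    then have "AE x in M. k x * ennreal_powr (g x) P = 0"
      using real by (simp add: nn_integral_0_iff_AE)
    then have "AE x in M. k x * g x = 0"
      by eventually_elim (use P in \<open>auto simp: ennreal_powr_def enn2real_eq_0_iff split: if_splits\<close>)
    then have "(\<integral>\<^sup>+ x. k x * g x \<partial>M) = 0" by (simp add: nn_integral_0_iff_AE)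
    then show ?thesis by simp
  next
    case False
    then have X: "0 < X" using real by auto
    \<comment> \<open>The optimal choice: \<open>c powr P\<close> is the mean of
      \<open>g powr P\<close> with respect to k, which makes both terms of the tangent bound combine
      to \<open>c * K\<close>.\<close>
    define c where "c = (X / K) powr (1 / P)"
    have c: "0 < c" using X K by (simp add: c_def)
    have cP: "c powr P = X / K" using P X K by (simp add: c_def powr_powr)
    have "(\<integral>\<^sup>+ x. k x * g x \<partial>M) \<le>
      (\<integral>\<^sup>+ x. k x * (ennreal (c powr (1 - P) / P) * ennreal_powr (g x) P + ennreal (c * (1 - 1 / P))) \<partial>M)"
      by (intro nn_integral_mono mult_left_mono Young_ineq_powr P c) auto
    also have "\<dots> = (\<integral>\<^sup>+ x. ennreal (c powr (1 - P) / P) * (k x * ennreal_powr (g x) P) + ennreal (c * (1 - 1 / P)) * k x \<partial>M)"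
      by (intro nn_integral_cong) (simp add: algebra_simps)
    also have "\<dots> = ennreal (c powr (1 - P) / P) * ennreal X + ennreal (c * (1 - 1 / P)) * ennreal K"
      using real K by (simp add: nn_integral_add nn_integral_cmult)
    also have "\<dots> = ennreal (c powr (1 - P) / P * X + c * (1 - 1 / P) * K)"
      using c P X K by (simp add: ennreal_mult[symmetric] ennreal_plus[symmetric] del: ennreal_plus)
    also have "c powr (1 - P) / P * X + c * (1 - 1 / P) * K = c * K"
    proof -
      have "c powr (1 - P) * X = c * K" using cP K X c by (simp add: powr_diff field_simps)
      then show ?thesis using P by (simp add: field_simps)
    qed
    finally have "ennreal_powr (\<integral>\<^sup>+ x. k x * g x \<partial>M) P \<le> ennreal_powr (ennreal (c * K)) P"
      using P by (intro ennreal_powr_mono) auto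
    also have "\<dots> = ennreal (K powr (P - 1) * X)"
      using c K X cP by (simp add: powr_mult powr_diff)
    finally show ?thesis using real K by (simp add: ennreal_mult[symmetric])
  qed
qed

lemma nn_integral_lborel_translate:
  fixes g :: "'a::euclidean_space \<Rightarrow> ennreal"
  assumes [measurable]: "g \<in> borel_measurable borel"
  shows "(\<integral>\<^sup>+ x. g (x - h) \<partial>lborel) = (\<integral>\<^sup>+ x. g x \<partial>lborel)"
proof -
  have "(\<integral>\<^sup>+ x. g x \<partial>lborel) = (\<integral>\<^sup>+ x. g x \<partial>distr lborel borel ((+) (-h)))"
    by (simp add: lborel_distr_plus)
  also have "\<dots> = (\<integral>\<^sup>+ x. g (x - h) \<partial>lborel)"
    by (subst nn_integral_distr) auto
  finally show ?thesis ..
qed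

lemma Lp_norm_translate:
  fixes g :: "'a::euclidean_space \<Rightarrow> ennreal"
  assumes "p < \<infinity>" and [measurable]: "g \<in> borel_measurable borel"
  shows "Lp_norm lborel p (\<lambda>x. g (x - h)) = Lp_norm lborel p g"
  unfolding Lp_norm_finite_exponent[OF assms(1)]
  by (subst nn_integral_lborel_translate[where h = h, symmetric]) auto

text \<open>Jensen's inequality with weight k moves the power inside the inner integral; after
  exchanging the integrals, translation invariance makes the remaining factor independent of y. K =
  0 is split off because Jensen's inequality is stated for positive mass.\<close>

lemma Lp_norm_convolution_le:
  fixes k g :: "'a::euclidean_space \<Rightarrow> ennreal"
  assumes p: "1 \<le> p" "p < \<infinity>" and [measurable]: "k \<in> borel_measurable borel" "g \<in> borel_measurable borel"
    and K: "(\<integral>\<^sup>+ x. k x \<partial>lborel) < \<top>"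
  shows "Lp_norm lborel p (\<lambda>x. \<integral>\<^sup>+ y. k y * g (x - y) \<partial>lborel) \<le> (\<integral>\<^sup>+ x. k x \<partial>lborel) * Lp_norm lborel p g"
proof -
  let ?P = "enn2real p"
  note P = enn2real_ge_1[OF p]
  obtain K where K: "(\<integral>\<^sup>+ x. k x \<partial>lborel) = ennreal K" "0 \<le> K"
    using K by (cases "\<integral>\<^sup>+ x. k x \<partial>lborel") auto
  show ?thesis
  proof (cases "K = 0")
    case True
    then have "AE y in lborel. k y = 0" using K by (simp add: nn_integral_0_iff_AE)
    then have "(\<integral>\<^sup>+ y. k y * g (x - y) \<partial>lborel) = 0" for x
      by (subst nn_integral_0_iff_AE) auto
    then show ?thesis using P by (simp add: Lp_norm_finite_exponent[OF p(2)])
  next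
    case False
    then have K0: "0 < K" using K by auto
    have [measurable]: "(\<lambda>(y, x). k y * ennreal_powr (g (x - y)) ?P) \<in> borel_measurable (lborel \<Otimes>\<^sub>M lborel)"
      by measurable
    have "(\<integral>\<^sup>+ x. ennreal_powr (\<integral>\<^sup>+ y. k y * g (x - y) \<partial>lborel) ?P \<partial>lborel) \<le>
      (\<integral>\<^sup>+ x. ennreal (K powr (?P - 1)) * (\<integral>\<^sup>+ y. k y * ennreal_powr (g (x - y)) ?P \<partial>lborel) \<partial>lborel)"
      by (intro nn_integral_mono nn_integral_Jensen_powr P K K0) auto
    also have "\<dots> = ennreal (K powr (?P - 1)) * (\<integral>\<^sup>+ x. (\<integral>\<^sup>+ y. k y * ennreal_powr (g (x - y)) ?P \<partial>lborel) \<partial>lborel)"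
      by (rule nn_integral_cmult) measurable
    also have "(\<integral>\<^sup>+ x. (\<integral>\<^sup>+ y. k y * ennreal_powr (g (x - y)) ?P \<partial>lborel) \<partial>lborel) =
      (\<integral>\<^sup>+ y. (\<integral>\<^sup>+ x. k y * ennreal_powr (g (x - y)) ?P \<partial>lborel) \<partial>lborel)"
      by (rule lborel_pair.Fubini') measurable
    also have "\<dots> = (\<integral>\<^sup>+ y. k y * (\<integral>\<^sup>+ x. ennreal_powr (g x) ?P \<partial>lborel) \<partial>lborel)"
      by (intro nn_integral_cong)
        (simp add: nn_integral_cmult nn_integral_lborel_translate[of "\<lambda>x. ennreal_powr (g x) ?P"])
    also have "\<dots> = ennreal K * (\<integral>\<^sup>+ x. ennreal_powr (g x) ?P \<partial>lborel)"
      using K by (simp add: nn_integral_multc)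
    also have "ennreal (K powr (?P - 1)) * (ennreal K * (\<integral>\<^sup>+ x. ennreal_powr (g x) ?P \<partial>lborel)) =
       ennreal_powr (ennreal K) ?P * (\<integral>\<^sup>+ x. ennreal_powr (g x) ?P \<partial>lborel)"
      using K0 by (simp add: mult.assoc[symmetric] ennreal_mult[symmetric] powr_diff)
    also have "\<dots> = ennreal_powr (ennreal K * Lp_norm lborel p g) ?P"
      using P by (simp add: ennreal_powr_mult Lp_norm_finite_exponent[OF p(2)])
    finally show ?thesis by (simp add: Lp_norm_le_iff[OF p] K)
  qed
qed

section \<open>Variation and sewing\<close>

text \<open>An arbitrary two-parameter function is allowed in place of powers of path increments.
  The supremum is superadditive without any property of M, and a sum of two such functions can be
  controlled at once.\<close>

definition var_sup :: "(real \<Rightarrow> real \<Rightarrow> ennreal) \<Rightarrow> real \<Rightarrow> real \<Rightarrow> ennreal" where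
  "var_sup M s t = (SUP (n, \<tau>) \<in> partitions s t. \<Sum>i<n. M (\<tau> i) (\<tau> (Suc i)))"

lemma variation_norm_eq_var_sup:
  "variation_norm N p a b f =
    ennreal_powr (var_sup (\<lambda>s t. ennreal_powr (N (f t - f s)) p) a b) (1 / p)"
  by (simp add: variation_norm_def var_sup_def sum.atLeast1_atMost_eq)

section \<open>Partitions and superadditivity of variation sums\<close>

lemma partitions_mono:
  assumes "(n, \<tau>) \<in> partitions s t" "i \<le> j" "j \<le> n"
  shows "\<tau> i \<le> \<tau> j"
  using assms(2,3)
proof (induction j rule: dec_induct)
  case (step m)
  then have "\<tau> m < \<tau> (Suc m)" using assms(1) by (auto simp: partitions_def)
  with step show ?case by simp
qed simp

lemma partitions_bounds:
  assumes "(n, \<tau>) \<in> partitions s t" "i \<le> n" shows "s \<le> \<tau> i" "\<tau> i \<le> t"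
  using partitions_mono[OF assms(1), of 0 i] partitions_mono[OF assms(1), of i n] assms
  by (auto simp: partitions_def)

lemma partitions_step: "(n, \<tau>) \<in> partitions s t \<Longrightarrow> i < n \<Longrightarrow> \<tau> i < \<tau> (Suc i)"
  by (auto simp: partitions_def)

lemma partitions_trivial: "s < t \<Longrightarrow> (1, \<lambda>i. if i = 0 then s else t) \<in> partitions s t"
  by (auto simp: partitions_def)

lemma partitions_nonempty: "s \<le> t \<Longrightarrow> partitions s t \<noteq> {}"
proof (cases "s = t")
  case True
  then have "(0, \<lambda>_. s) \<in> partitions s t" by (simp add: partitions_def)
  then show ?thesis by blast
qed (use partitions_trivial[of s t] in auto)

lemma var_sup_upper: "(n, \<tau>) \<in> partitions s t \<Longrightarrow> (\<Sum>i<n. M (\<tau> i) (\<tau> (Suc i))) \<le> var_sup M s t"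
  unfolding var_sup_def by (rule SUP_upper2[where i = "(n, \<tau>)"]) auto

lemma var_sup_least:
  "(\<And>n \<tau>. (n, \<tau>) \<in> partitions s t \<Longrightarrow> (\<Sum>i<n. M (\<tau> i) (\<tau> (Suc i))) \<le> c) \<Longrightarrow> var_sup M s t \<le> c"
  unfolding var_sup_def by (auto intro!: SUP_least)

lemma var_sup_ge: "s < t \<Longrightarrow> M s t \<le> var_sup M s t"
  using var_sup_upper[OF partitions_trivial, of s t M] by simp

text \<open>Two partitions that share the point u concatenate to one of the whole interval. The
  suprema are then taken one after the other, which requires that partitions exist.\<close>

lemma var_sup_superadditive:
  assumes "s \<le> u" "u \<le> t"
  shows "var_sup M s u + var_sup M u t \<le> var_sup M s t"
proof -
  have *: "(\<Sum>i<n. M (\<sigma> i) (\<sigma> (Suc i))) + (\<Sum>i<m. M (\<tau> i) (\<tau> (Suc i))) \<le> var_sup M s t"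
    if \<sigma>: "(n, \<sigma>) \<in> partitions s u" and \<tau>: "(m, \<tau>) \<in> partitions u t" for n m \<sigma> \<tau>
  proof -
    \<comment> \<open>The junction index n is read from \<open>\<sigma>\<close>; this agrees with
      \<open>\<tau>\<close>, because \<open>\<sigma> n\<close> and \<open>\<tau> 0\<close> are both
      u.\<close>
    define \<rho> where "\<rho> i = (if i \<le> n then \<sigma> i else \<tau> (i - n))" for i
    have "\<rho> h < \<rho> (Suc h)" if "h < n + m" for h
    proof (cases "h < n")
      case False
      then have "\<rho> h = \<tau> (h - n)" "\<rho> (Suc h) = \<tau> (Suc (h - n))"
        using \<sigma> \<tau> by (auto simp: \<rho>_def partitions_def Suc_diff_le)
      then show ?thesis using partitions_step[OF \<tau>, of "h - n"] that False by auto
    qed (use partitions_step[OF \<sigma>] in \<open>auto simp: \<rho>_def\<close>)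
    then have "(n + m, \<rho>) \<in> partitions s t"
      using \<sigma> \<tau> by (auto simp: partitions_def \<rho>_def)
    then have "(\<Sum>i<n + m. M (\<rho> i) (\<rho> (Suc i))) \<le> var_sup M s t" by (rule var_sup_upper)
    also have "(\<Sum>i<n + m. M (\<rho> i) (\<rho> (Suc i))) =
      (\<Sum>i<n. M (\<rho> i) (\<rho> (Suc i))) + (\<Sum>i<m. M (\<rho> (n + i)) (\<rho> (Suc (n + i))))"
      by (induction m) (auto simp: algebra_simps)
    also have "(\<Sum>i<n. M (\<rho> i) (\<rho> (Suc i))) = (\<Sum>i<n. M (\<sigma> i) (\<sigma> (Suc i)))"
      by (intro sum.cong) (auto simp: \<rho>_def)
    also have "(\<Sum>i<m. M (\<rho> (n + i)) (\<rho> (Suc (n + i)))) = (\<Sum>i<m. M (\<tau> i) (\<tau> (Suc i)))"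
      using \<sigma> \<tau> by (intro sum.cong) (auto simp: \<rho>_def partitions_def)
    finally show ?thesis .
  qed
  have "var_sup M s u + (\<Sum>i<m. M (\<tau> i) (\<tau> (Suc i))) \<le> var_sup M s t"
    if \<tau>: "(m, \<tau>) \<in> partitions u t" for m \<tau>
    unfolding var_sup_def[of M s u]
    by (subst ennreal_SUP_add_left[symmetric]) (use partitions_nonempty assms * \<tau> in \<open>auto intro!: SUP_least\<close>)
  then show ?thesis
    unfolding var_sup_def[of M u t]
    by (subst ennreal_SUP_add_right) (use partitions_nonempty assms in \<open>auto intro!: SUP_least\<close>)
qed

lemma var_sup_mono:
  assumes "s' \<le> s" "s \<le> t" "t \<le> t'"
  shows "var_sup M s t \<le> var_sup M s' t'"
proof -
  have "var_sup M s t \<le> var_sup M s' s + var_sup M s t" by simp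
  also have "\<dots> \<le> var_sup M s' t" using assms by (intro var_sup_superadditive) auto
  also have "\<dots> \<le> var_sup M s' t + var_sup M t t'" by simp
  also have "\<dots> \<le> var_sup M s' t'" using assms by (intro var_sup_superadditive) auto
  finally show ?thesis .
qed

text \<open>The values lie in an ordered monoid so that the bound serves extended-valued variation
  sums as well as real controls. Requiring \<open>0 < m\<close> avoids any assumption on the
  diagonal values \<open>w s s\<close>.\<close>

lemma sum_superadditive_le:
  fixes w :: "real \<Rightarrow> real \<Rightarrow> 'b::ordered_comm_monoid_add"
  assumes "\<And>s u t. a \<le> s \<Longrightarrow> s \<le> u \<Longrightarrow> u \<le> t \<Longrightarrow> t \<le> b \<Longrightarrow> w s u + w u t \<le> w s t"
    and "(n, \<tau>) \<in> partitions s t" "a \<le> s" "t \<le> b" "0 < m" "m \<le> n"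
  shows "(\<Sum>i<m. w (\<tau> i) (\<tau> (Suc i))) \<le> w s (\<tau> m)"
  using assms(5,6)
proof (induction m)
  case (Suc m)
  show ?case
  proof (cases "m = 0")
    case True
    then show ?thesis using assms(2) by (auto simp: partitions_def)
  next
    case False
    have "(\<Sum>i<Suc m. w (\<tau> i) (\<tau> (Suc i))) \<le> w s (\<tau> m) + w (\<tau> m) (\<tau> (Suc m))"
      using Suc False by (auto intro!: add_mono)
    also have "\<dots> \<le> w s (\<tau> (Suc m))"
      using Suc.prems partitions_bounds[OF assms(2), of m] partitions_bounds[OF assms(2), of "Suc m"]
        partitions_step[OF assms(2), of m] assms(3,4)
      by (intro assms(1)) auto
    finally show ?thesis .
  qed
qed simp

text \<open>Raising an increment bound to the power r makes its right side superadditive, so it sums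
  over every partition with the same constant. This turns sewing estimates on single intervals into
  variation norms.\<close>

lemma variation_norm_le_of_control:
  assumes r: "0 < r" and
    le: "\<And>s t. a \<le> s \<Longrightarrow> s < t \<Longrightarrow> t \<le> b \<Longrightarrow> N (f t - f s) \<le> c * ennreal_powr (var_sup M s t) (1 / r)"
  shows "variation_norm N r a b f \<le> c * ennreal_powr (var_sup M a b) (1 / r)"
proof -
  have "var_sup (\<lambda>s t. ennreal_powr (N (f t - f s)) r) a b \<le> ennreal_powr c r * var_sup M a b"
  proof (rule var_sup_least)
    fix n \<tau> assume \<tau>: "(n, \<tau>) \<in> partitions a b"
    have "(\<Sum>i<n. ennreal_powr (N (f (\<tau> (Suc i)) - f (\<tau> i))) r) \<le>
      (\<Sum>i<n. ennreal_powr (c * ennreal_powr (var_sup M (\<tau> i) (\<tau> (Suc i))) (1 / r)) r)"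
      using partitions_bounds[OF \<tau>] partitions_step[OF \<tau>] r
      by (intro sum_mono ennreal_powr_mono le) auto
    also have "\<dots> = ennreal_powr c r * (\<Sum>i<n. var_sup M (\<tau> i) (\<tau> (Suc i)))"
      using r by (simp add: ennreal_powr_mult sum_distrib_left)
    also have "\<dots> \<le> ennreal_powr c r * var_sup M a b"
    proof (cases "n = 0")
      case False
      then have "(\<Sum>i<n. var_sup M (\<tau> i) (\<tau> (Suc i))) \<le> var_sup M a (\<tau> n)"
        by (intro sum_superadditive_le[OF _ \<tau>, of a b]) (auto intro: var_sup_superadditive)
      then show ?thesis using \<tau> by (auto simp: partitions_def intro!: mult_left_mono)
    qed simp
    finally show "(\<Sum>i<n. ennreal_powr (N (f (\<tau> (Suc i)) - f (\<tau> i))) r) \<le> ennreal_powr c r * var_sup M a b" .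
  qed
  then show ?thesis
    unfolding variation_norm_eq_var_sup using r by (simp add: ennreal_powr_le_iff ennreal_powr_mult)
qed

text \<open>The norm may be infinite, and its laws are asked for only on a subgroup S: the intended
  norm on sequences of functions is subadditive where the functions are measurable.\<close>

locale extended_seminorm =
  fixes S :: "'e::ab_group_add set" and N :: "'e \<Rightarrow> ennreal"
  assumes add_mem: "x \<in> S \<Longrightarrow> y \<in> S \<Longrightarrow> x + y \<in> S"
    and uminus_mem: "x \<in> S \<Longrightarrow> - x \<in> S"
    and triangle: "x \<in> S \<Longrightarrow> y \<in> S \<Longrightarrow> N (x + y) \<le> N x + N y"
    and norm_uminus: "x \<in> S \<Longrightarrow> N (- x) = N x"
    and zero_mem: "0 \<in> S" and norm_zero: "N 0 = 0"
begin

lemma diff_mem: "x \<in> S \<Longrightarrow> y \<in> S \<Longrightarrow> x - y \<in> S"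
  using add_mem[of x "- y"] uminus_mem[of y] by simp

lemma sum_mem: "(\<And>i. i \<in> I \<Longrightarrow> f i \<in> S) \<Longrightarrow> (\<Sum>i\<in>I. f i) \<in> S"
  by (induction I rule: infinite_finite_induct) (auto intro: zero_mem add_mem)

end

text \<open>\<open>\<sigma>\<close> skips the point \<open>\<tau> (Suc k)\<close>, so only the two
  intervals meeting there change and the correction is the defect of A at this point. Counting the l
  intervals further right separately allows an induction on l.\<close>

lemma sum_remove_point:
  fixes A :: "real \<Rightarrow> real \<Rightarrow> 'e::ab_group_add"
  defines "\<sigma> \<equiv> \<lambda>\<tau> k i. if i \<le> k then \<tau> i else (\<tau> (Suc i) :: real)"
  shows "(\<Sum>i<k + Suc l. A (\<sigma> \<tau> k i) (\<sigma> \<tau> k (Suc i))) =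
    (\<Sum>i<k + Suc (Suc l). A (\<tau> i) (\<tau> (Suc i))) +
    (A (\<tau> k) (\<tau> (Suc (Suc k))) - A (\<tau> k) (\<tau> (Suc k)) - A (\<tau> (Suc k)) (\<tau> (Suc (Suc k))))"
proof (induction l)
  case 0
  have "(\<Sum>i<k. A (\<sigma> \<tau> k i) (\<sigma> \<tau> k (Suc i))) = (\<Sum>i<k. A (\<tau> i) (\<tau> (Suc i)))"
    by (intro sum.cong) (auto simp: \<sigma>_def)
  then show ?case by (simp add: \<sigma>_def algebra_simps)
next
  case (Suc l)
  then show ?case by (simp add: \<sigma>_def algebra_simps)
qed

text \<open>A control in the sense of rough paths, without continuity near the diagonal: the shift f
  may jump.\<close>

definition control_on :: "real \<Rightarrow> real \<Rightarrow> (real \<Rightarrow> real \<Rightarrow> real) \<Rightarrow> bool" where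
  "control_on a b w \<longleftrightarrow>
    (\<forall>s t. a \<le> s \<longrightarrow> s \<le> t \<longrightarrow> t \<le> b \<longrightarrow> 0 \<le> w s t) \<and>
    (\<forall>s u t. a \<le> s \<longrightarrow> s \<le> u \<longrightarrow> u \<le> t \<longrightarrow> t \<le> b \<longrightarrow> w s u + w u t \<le> w s t)"

lemma control_onD:
  assumes "control_on a b w"
  shows "a \<le> s \<Longrightarrow> s \<le> t \<Longrightarrow> t \<le> b \<Longrightarrow> 0 \<le> w s t"
    and "a \<le> s \<Longrightarrow> s \<le> u \<Longrightarrow> u \<le> t \<Longrightarrow> t \<le> b \<Longrightarrow> w s u + w u t \<le> w s t"
  using assms by (auto simp: control_on_def)

lemma control_on_mono:
  assumes "control_on a b w" "a \<le> s'" "s' \<le> s" "s \<le> t" "t \<le> t'" "t' \<le> b"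
  shows "w s t \<le> w s' t'"
proof -
  have "w s t \<le> w s' t"
    using control_onD(2)[OF assms(1), of s' s t] control_onD(1)[OF assms(1), of s' s] assms by auto
  also have "\<dots> \<le> w s' t'"
    using control_onD(2)[OF assms(1), of s' t t'] control_onD(1)[OF assms(1), of t t'] assms by auto
  finally show ?thesis .
qed

lemma control_on_add: "control_on a b v \<Longrightarrow> control_on a b w \<Longrightarrow> control_on a b (\<lambda>s t. v s t + w s t)"
  by (auto simp: control_on_def intro!: add_nonneg_nonneg) (smt (verit, best))

lemma control_on_cmult:
  assumes "control_on a b w" "0 \<le> c" shows "control_on a b (\<lambda>s t. c * w s t)"
  unfolding control_on_def
proof (intro conjI allI impI)
  fix s u t assume "a \<le> s" "s \<le> u" "u \<le> t" "t \<le> b"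
  then show "c * w s u + c * w u t \<le> c * w s t"
    using mult_left_mono[OF control_onD(2)[OF assms(1), of s u t] assms(2)] by (simp add: algebra_simps)
qed (use assms control_onD(1)[OF assms(1)] in auto)

lemma control_on_var_sup:
  assumes "var_sup M a b < \<top>"
  shows "control_on a b (\<lambda>s t. enn2real (var_sup M s t))"
  unfolding control_on_def
proof (intro conjI allI impI)
  fix s u t assume *: "a \<le> s" "s \<le> u" "u \<le> t" "t \<le> b"
  have fin: "var_sup M s t < \<top>" using var_sup_mono[of a s t b M] * assms by (auto simp: order.strict_trans1)
  moreover have "var_sup M s u \<le> var_sup M s t" "var_sup M u t \<le> var_sup M s t"
    using * by (auto intro!: var_sup_mono)
  ultimately have "enn2real (var_sup M s u) + enn2real (var_sup M u t) = enn2real (var_sup M s u + var_sup M u t)"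
    by (subst enn2real_plus) (auto simp: order.strict_trans1)
  also have "\<dots> \<le> enn2real (var_sup M s t)"
    using fin * by (intro enn2real_mono var_sup_superadditive) auto
  finally show "enn2real (var_sup M s u) + enn2real (var_sup M u t) \<le> enn2real (var_sup M s t)" .
qed simp

text \<open>Young's pigeonhole: over the \<open>m\<close> interior points the normalised increments of each control sum to at
  most 1, so at some point they add up to at most \<open>2 / m\<close>.\<close>

lemma exists_cheap_point:
  assumes w: "control_on a b w1" "control_on a b w2" and \<beta>: "0 < \<beta>1" "0 < \<beta>2"
    and \<tau>: "(Suc m, \<tau>) \<in> partitions s t" "a \<le> s" "t \<le> b" and m: "0 < m"
  obtains k where "k < m"
    "w1 (\<tau> k) (\<tau> (Suc k)) powr \<beta>1 * w2 (\<tau> (Suc k)) (\<tau> (Suc (Suc k))) powr \<beta>2 \<le>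
      (2 / real m) powr (\<beta>1 + \<beta>2) * (w1 s t powr \<beta>1 * w2 s t powr \<beta>2)"
proof -
  \<comment> \<open>x refers to the interval before the point \<open>\<tau> (Suc k)\<close> and y to
    the one after it, matching the two controls in the defect.\<close>
  define x y where "x k = w1 (\<tau> k) (\<tau> (Suc k)) / w1 s t"
    and "y k = w2 (\<tau> (Suc k)) (\<tau> (Suc (Suc k))) / w2 s t" for k
  note bd = partitions_bounds[OF \<tau>(1)] and st = partitions_step[OF \<tau>(1)]
  have st0: "s \<le> t" using bd(1)[of 0] bd(2)[of 0] by linarith
  have W: "0 \<le> w1 s t" "0 \<le> w2 s t" using control_onD(1)[OF w(1)] control_onD(1)[OF w(2)] \<tau> st0 by auto
  have in_ab: "a \<le> \<tau> i" "\<tau> i \<le> b" if "i \<le> Suc m" for i using bd[OF that] \<tau> by auto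
  have c1: "0 \<le> w1 (\<tau> k) (\<tau> (Suc k))" "w1 (\<tau> k) (\<tau> (Suc k)) \<le> w1 s t" if "k < m" for k
    using that bd[of k] bd[of "Suc k"] st[of k] \<tau>
    by (auto intro!: control_onD(1)[OF w(1)] control_on_mono[OF w(1)])
  have c2: "0 \<le> w2 (\<tau> (Suc k)) (\<tau> (Suc (Suc k)))" "w2 (\<tau> (Suc k)) (\<tau> (Suc (Suc k))) \<le> w2 s t" if "k < m" for k
    using that bd[of "Suc k"] bd[of "Suc (Suc k)"] st[of "Suc k"] \<tau>
    by (auto intro!: control_onD(1)[OF w(2)] control_on_mono[OF w(2)])
  have "(\<Sum>i<m. w1 (\<tau> i) (\<tau> (Suc i))) \<le> w1 s (\<tau> m)"
    using m \<tau> by (intro sum_superadditive_le[OF _ \<tau>(1), of a b]) (auto intro: control_onD(2)[OF w(1)])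
  also have "\<dots> \<le> w1 s t" using \<tau> bd[of m] by (intro control_on_mono[OF w(1)]) auto
  finally have sx: "(\<Sum>i<m. x i) \<le> 1"
    using W by (auto simp: x_def sum_divide_distrib[symmetric] divide_le_eq_1)
  \<comment> \<open>The intervals after the interior points are all intervals but the first, whose
    nonnegative contribution is added back.\<close>
  have "(\<Sum>i<m. w2 (\<tau> (Suc i)) (\<tau> (Suc (Suc i)))) \<le> (\<Sum>i<Suc m. w2 (\<tau> i) (\<tau> (Suc i)))"
    unfolding sum.lessThan_Suc_shift using control_onD(1)[OF w(2), of "\<tau> 0" "\<tau> 1"] st[of 0] in_ab[of 0] in_ab[of 1] m by auto
  also have "\<dots> \<le> w2 s (\<tau> (Suc m))"
    using m \<tau> by (intro sum_superadditive_le[OF _ \<tau>(1), of a b]) (auto intro: control_onD(2)[OF w(2)])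
  also have "\<dots> = w2 s t" using \<tau> by (auto simp: partitions_def)
  finally have sy: "(\<Sum>i<m. y i) \<le> 1"
    using W by (auto simp: y_def sum_divide_distrib[symmetric] divide_le_eq_1)
  have "\<exists>k<m. x k + y k \<le> 2 / real m"
  proof (rule ccontr)
    assume "\<not> ?thesis"
    then have "(\<Sum>k<m. 2 / real m) < (\<Sum>k<m. x k + y k)"
      using m by (intro sum_strict_mono) (auto simp: not_le)
    then show False using sx sy m by (simp add: sum.distrib)
  qed
  then obtain k where k: "k < m" "x k + y k \<le> 2 / real m" by auto
  have xy: "0 \<le> x k" "0 \<le> y k" using c1 c2 W k by (auto simp: x_def y_def)
  \<comment> \<open>This also holds when \<open>w1 s t = 0\<close>: monotonicity then forces the
    left side to vanish, in agreement with division by zero. The same applies to w2.\<close>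
  have e1: "w1 (\<tau> k) (\<tau> (Suc k)) = x k * w1 s t" using c1[OF k(1)] by (auto simp: x_def)
  have e2: "w2 (\<tau> (Suc k)) (\<tau> (Suc (Suc k))) = y k * w2 s t" using c2[OF k(1)] by (auto simp: y_def)
  have "w1 (\<tau> k) (\<tau> (Suc k)) powr \<beta>1 * w2 (\<tau> (Suc k)) (\<tau> (Suc (Suc k))) powr \<beta>2 =
    (x k powr \<beta>1 * y k powr \<beta>2) * (w1 s t powr \<beta>1 * w2 s t powr \<beta>2)"
    unfolding e1 e2 using xy W by (simp add: powr_mult)
  \<comment> \<open>Both summands are nonnegative, so each of them is at most \<open>2 / m\<close>,
    and the two exponents can be treated separately.\<close>
  also have "\<dots> \<le> ((2 / real m) powr \<beta>1 * (2 / real m) powr \<beta>2) * (w1 s t powr \<beta>1 * w2 s t powr \<beta>2)"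
    using xy k \<beta> by (intro mult_right_mono mult_mono powr_mono2) auto
  finally show ?thesis using k(1) that by (simp add: powr_add)
qed

text \<open>Interior points are deleted one at a time, each time the cheapest one; the costs add up
  to a partial sum of a series that converges once \<open>\<beta>1 + \<beta>2 > 1\<close>, whence
  uniformity in the partition. Germs and defects are governed by left endpoints, which is why only
  the points before the last have to lie in D.\<close>

lemma (in extended_seminorm) sewing_discrete:
  assumes w: "control_on a b w1" "control_on a b w2" and \<beta>: "0 < \<beta>1" "0 < \<beta>2"
    and A: "\<And>s t. a \<le> s \<Longrightarrow> s < t \<Longrightarrow> t \<le> b \<Longrightarrow> A s t \<in> S"
    and \<delta>: "\<And>s u t. a \<le> s \<Longrightarrow> s < u \<Longrightarrow> u < t \<Longrightarrow> t \<le> b \<Longrightarrow> s \<in> D \<Longrightarrow> u \<in> D \<Longrightarrow>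
      N (A s t - A s u - A u t) \<le> c * ennreal (w1 s u powr \<beta>1 * w2 u t powr \<beta>2)"
    and "(Suc n, \<tau>) \<in> partitions s t" "a \<le> s" "t \<le> b" "\<And>i. i \<le> n \<Longrightarrow> \<tau> i \<in> D"
  shows "N ((\<Sum>i<Suc n. A (\<tau> i) (\<tau> (Suc i))) - A s t) \<le>
    c * ennreal ((\<Sum>k<n. (2 / real (Suc k)) powr (\<beta>1 + \<beta>2)) * (w1 s t powr \<beta>1 * w2 s t powr \<beta>2))"
  using assms(7-)
proof (induction n arbitrary: \<tau>)
  case 0
  then have "\<tau> 0 = s" "\<tau> (Suc 0) = t" by (auto simp: partitions_def)
  then show ?case by (simp add: norm_zero)
next
  case (Suc n)
  note \<tau> = Suc.prems(1) and D = Suc.prems(4)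
  let ?W = "w1 s t powr \<beta>1 * w2 s t powr \<beta>2"
  obtain k where k: "k < Suc n"
    "w1 (\<tau> k) (\<tau> (Suc k)) powr \<beta>1 * w2 (\<tau> (Suc k)) (\<tau> (Suc (Suc k))) powr \<beta>2 \<le>
      (2 / real (Suc n)) powr (\<beta>1 + \<beta>2) * ?W"
    by (rule exists_cheap_point[OF w \<beta> \<tau> Suc.prems(2,3) zero_less_Suc])
  \<comment> \<open>Since \<open>k < Suc n\<close>, the deleted index \<open>Suc k\<close> is
    interior: both endpoints survive, and all remaining left endpoints are still in D.\<close>
  define \<sigma> where "\<sigma> i = (if i \<le> k then \<tau> i else \<tau> (Suc i))" for i
  have \<tau>3: "a \<le> \<tau> k" "\<tau> k < \<tau> (Suc k)" "\<tau> (Suc k) < \<tau> (Suc (Suc k))" "\<tau> (Suc (Suc k)) \<le> b"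
    using k partitions_bounds[OF \<tau>, of k] partitions_bounds[OF \<tau>, of "Suc (Suc k)"] Suc.prems
      partitions_step[OF \<tau>, of k] partitions_step[OF \<tau>, of "Suc k"] by auto
  have \<sigma>: "(Suc n, \<sigma>) \<in> partitions s t"
  proof -
    have "\<sigma> h < \<sigma> (Suc h)" if "h < Suc n" for h
    proof (cases "h = k")
      case True
      then show ?thesis using \<tau>3 by (auto simp: \<sigma>_def)
    next
      case False
      then show ?thesis using partitions_step[OF \<tau>, of h] partitions_step[OF \<tau>, of "Suc h"] that
        by (auto simp: \<sigma>_def)
    qed
    then show ?thesis using \<tau> k by (auto simp: partitions_def \<sigma>_def)
  qed
  obtain l where l: "Suc n = k + Suc l" using less_imp_Suc_add[OF k(1)] by auto
  define X where "X = (\<Sum>i<Suc n. A (\<sigma> i) (\<sigma> (Suc i))) - A s t"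
  define Y where "Y = A (\<tau> k) (\<tau> (Suc (Suc k))) - A (\<tau> k) (\<tau> (Suc k)) - A (\<tau> (Suc k)) (\<tau> (Suc (Suc k)))"
  have l': "Suc (Suc n) = k + Suc (Suc l)" using l by simp
  have "(\<Sum>i<k + Suc l. A (\<sigma> i) (\<sigma> (Suc i))) = (\<Sum>i<k + Suc (Suc l). A (\<tau> i) (\<tau> (Suc i))) + Y"
    unfolding \<sigma>_def Y_def by (rule sum_remove_point)
  note rem = this[folded l' l]
  have "u = v + Y \<Longrightarrow> v - A s t = u - A s t + - Y" for u v by simp
  from this[OF rem] have eq: "(\<Sum>i<Suc (Suc n). A (\<tau> i) (\<tau> (Suc i))) - A s t = X + (- Y)"
    unfolding X_def .
  have XS: "X \<in> S"
    unfolding X_def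
  proof (intro diff_mem sum_mem A)
    fix i assume i: "i \<in> {..<Suc n}"
    then show "a \<le> \<sigma> i" "\<sigma> (Suc i) \<le> b" "\<sigma> i < \<sigma> (Suc i)"
      using partitions_bounds(1)[OF \<sigma>, of i] partitions_bounds(2)[OF \<sigma>, of "Suc i"]
        partitions_step[OF \<sigma>, of i] Suc.prems(2,3) by auto
  next
    show "s < t"
      using partitions_bounds(1)[OF \<sigma>, of 0] partitions_bounds(2)[OF \<sigma>, of 1] partitions_step[OF \<sigma>, of 0]
      by auto
  qed (use Suc.prems in auto)
  have YS: "Y \<in> S" unfolding Y_def using \<tau>3 by (intro diff_mem A) auto
  have "N ((\<Sum>i<Suc (Suc n). A (\<tau> i) (\<tau> (Suc i))) - A s t) \<le> N X + N Y"
    unfolding eq using triangle[OF XS uminus_mem[OF YS]] norm_uminus[OF YS] by simp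
  also have "\<dots> \<le> c * ennreal ((\<Sum>k<n. (2 / real (Suc k)) powr (\<beta>1 + \<beta>2)) * ?W) +
      c * ennreal ((2 / real (Suc n)) powr (\<beta>1 + \<beta>2) * ?W)"
  proof (intro add_mono)
    show "N X \<le> c * ennreal ((\<Sum>k<n. (2 / real (Suc k)) powr (\<beta>1 + \<beta>2)) * ?W)"
      unfolding X_def using Suc.prems by (intro Suc.IH \<sigma>) (auto simp: \<sigma>_def)
    have "N Y \<le> c * ennreal (w1 (\<tau> k) (\<tau> (Suc k)) powr \<beta>1 * w2 (\<tau> (Suc k)) (\<tau> (Suc (Suc k))) powr \<beta>2)"
      unfolding Y_def using \<tau>3 D k by (intro \<delta>) auto
    also have "\<dots> \<le> c * ennreal ((2 / real (Suc n)) powr (\<beta>1 + \<beta>2) * ?W)"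
      using k by (intro mult_left_mono ennreal_leI) auto
    finally show "N Y \<le> \<dots>" .
  qed
  also have "\<dots> = c * ennreal ((\<Sum>k<Suc n. (2 / real (Suc k)) powr (\<beta>1 + \<beta>2)) * ?W)"
    unfolding distrib_left[symmetric]
    by (subst ennreal_plus[symmetric]) (simp_all add: sum_nonneg distrib_right)
  finally show ?case .
qed

lemma summable_sewing_constant: "1 < \<theta> \<Longrightarrow> summable (\<lambda>k. (2 / real (Suc k)) powr \<theta>)"
proof -
  assume "1 < \<theta>"
  then have "summable (\<lambda>k. real k powr (- \<theta>))" by (simp add: summable_real_powr_iff)
  then have "summable (\<lambda>k. real (Suc k) powr (- \<theta>))" by (subst summable_Suc_iff)
  then have "summable (\<lambda>k. 2 powr \<theta> * real (Suc k) powr (- \<theta>))" by (rule summable_mult)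
  moreover have "2 powr \<theta> * real (Suc k) powr (- \<theta>) = (2 / real (Suc k)) powr \<theta>" for k
    by (simp add: powr_divide powr_minus_divide)
  ultimately show ?thesis by (simp only:)
qed

text \<open>The p-th power of an increment of f is dominated by the increment of the monotone
  function V, the variation from a onwards. So f is continuous wherever V is, and a monotone
  function has countably many discontinuities.\<close>

lemma finite_variation_countable_discontinuities:
  fixes f :: "real \<Rightarrow> 'a::real_normed_vector"
  assumes "f \<in> variation_space UNIV vec_norm p a b" "0 < p"
  shows "countable {x \<in> {a..b}. \<not> continuous (at x within {a..b}) f}"
proof -
  define M where "M s t = ennreal_powr (vec_norm (f t - f s)) p" for s t
  have fin: "var_sup M a b < \<top>"
    using assms by (simp add: variation_space_def variation_norm_eq_var_sup M_def[abs_def])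
  define V where "V t = enn2real (var_sup M a t)" for t
  note ctrl = control_on_var_sup[OF fin]
  have inc: "norm (f t - f s) powr p \<le> V t - V s" if "a \<le> s" "s \<le> t" "t \<le> b" for s t
  proof (cases "s = t")
    case False
    have "ennreal (norm (f t - f s) powr p) \<le> var_sup M s t"
      using var_sup_ge[of s t M] that False by (simp add: M_def)
    moreover have "var_sup M s t < \<top>"
      using var_sup_mono[of a s t b M] that fin by (auto simp: order.strict_trans1)
    ultimately have "norm (f t - f s) powr p \<le> enn2real (var_sup M s t)"
      by (cases "var_sup M s t") auto
    also have "\<dots> \<le> V t - V s"
      using control_onD(2)[OF ctrl, of a s t] that by (simp add: V_def)
    finally show ?thesis .
  qed simp
  have "mono_on {a..b} V"
    using inc powr_ge_zero by (intro mono_onI) (smt (verit) atLeastAtMost_iff)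
  then have "countable {x \<in> {a..b}. \<not> continuous (at x within {a..b}) V}"
    by (rule mono_on_ctble_discont)
  moreover have "continuous (at x within {a..b}) f"
    if x: "x \<in> {a..b}" and V: "continuous (at x within {a..b}) V" for x
  proof -
    have "((\<lambda>y. \<bar>V y - V x\<bar>) \<longlongrightarrow> 0) (at x within {a..b})"
      using V by (intro tendsto_rabs_zero) (auto simp: continuous_within LIM_zero_iff)
    then have "((\<lambda>y. \<bar>V y - V x\<bar> powr (1 / p)) \<longlongrightarrow> 0) (at x within {a..b})"
      using assms(2) by (intro tendsto_zero_powrI[where b = "1 / p"]) auto
    then have "((\<lambda>y. norm (f y - f x)) \<longlongrightarrow> 0) (at x within {a..b})"
    proof (rule tendsto_sandwich[OF _ _ tendsto_const, rotated 2])
      have "norm (f y - f x) \<le> \<bar>V y - V x\<bar> powr (1 / p)" if "y \<in> {a..b}" for y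
      proof -
        have "norm (f y - f x) powr p \<le> \<bar>V y - V x\<bar>"
          using inc[of x y] inc[of y x] x that by (cases "x \<le> y") (auto simp: norm_minus_commute)
        then have "(norm (f y - f x) powr p) powr (1 / p) \<le> \<bar>V y - V x\<bar> powr (1 / p)"
          using assms(2) by (intro powr_mono2) auto
        then show ?thesis using assms(2) by (simp add: powr_powr)
      qed
      then show "\<forall>\<^sub>F y in at x within {a..b}. norm (f y - f x) \<le> \<bar>V y - V x\<bar> powr (1 / p)"
        by (auto simp: eventually_at_filter)
    qed auto
    then show ?thesis
      by (simp add: continuous_within tendsto_norm_zero_iff LIM_zero_iff)
  qed
  ultimately show ?thesis by (elim countable_subset[rotated]) auto
qed

lemma finite_variation_measurable:
  fixes f :: "real \<Rightarrow> 'a::euclidean_space"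
  assumes "f \<in> variation_space UNIV vec_norm p a b" "0 < p"
  shows "f \<in> borel_measurable (lebesgue_on {a..b})"
proof -
  \<comment> \<open>The endpoints count as exceptional because the extension of f by zero can jump
    there.\<close>
  define X where "X = {x \<in> {a..b}. \<not> continuous (at x within {a..b}) f} \<union> {a, b}"
  define g where "g x = (if x \<in> {a..b} then f x else 0)" for x
  have "continuous_on (- X) g"
  proof (rule continuous_at_imp_continuous_on, intro ballI)
    fix x assume x: "x \<in> - X"
    show "isCont g x"
    proof (cases "x \<in> {a<..<b}")
      case True
      then have "isCont f x"
        using x by (auto simp: X_def at_within_interior[of x "{a..b}"])
      moreover have "\<forall>\<^sub>F y in nhds x. g y = f y"
        using True by (intro eventually_nhds_in_open[THEN eventually_mono, of "{a<..<b}"]) (auto simp: g_def)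
      ultimately show ?thesis using isCont_cong by blast
    next
      case False
      then have "x \<in> - {a..b}" using x by (auto simp: X_def)
      then have "\<forall>\<^sub>F y in nhds x. g y = 0"
        by (intro eventually_nhds_in_open[THEN eventually_mono, of "- {a..b}"]) (auto simp: g_def)
      then show ?thesis using isCont_cong[of g "\<lambda>_. 0" x] by simp
    qed
  qed
  then have "g \<in> borel_measurable borel"
    using finite_variation_countable_discontinuities[OF assms]
    by (intro borel_measurable_continuous_countable_exceptions[of X]) (auto simp: X_def)
  then have "g \<in> borel_measurable (lebesgue_on {a..b})"
    by (intro measurable_restrict_space1 measurable_completion) simp
  then show ?thesis
    by (rule measurable_cong[THEN iffD1, rotated]) (auto simp: g_def)
qed

section \<open>Inverse Fourier transforms of test functions\<close>

lemma partials_snoc: "partials (vs @ [k]) f = partials vs (partials [k] f)"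
  by (induction vs) auto

lemma smooth_partial: "smooth f \<Longrightarrow> k \<in> Basis \<Longrightarrow> smooth (\<lambda>x. frechet_derivative f (at x) k)"
proof -
  assume "smooth f" "k \<in> Basis"
  moreover have "partials vs (\<lambda>x. frechet_derivative f (at x) k) = partials (vs @ [k]) f" for vs
    by (simp add: partials_snoc)
  ultimately show ?thesis by (simp add: smooth_def)
qed

lemma smooth_differentiable: "smooth f \<Longrightarrow> f differentiable (at x)"
  unfolding smooth_def by (metis lists.Nil partials.simps(1))

text \<open>Smoothness is the largest class of differentiable functions closed under partial
  derivatives. Exhibiting such a class replaces a Leibniz formula for iterated derivatives.\<close>

lemma smooth_coinduct:
  assumes "P f"
    and "\<And>f x. P f \<Longrightarrow> f differentiable (at x)"
    and "\<And>f k. P f \<Longrightarrow> k \<in> Basis \<Longrightarrow> P (\<lambda>x. frechet_derivative f (at x) k)"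
  shows "smooth f"
proof -
  have "P (partials vs f)" if "vs \<in> lists Basis" for vs
    using that by (induction vs) (auto intro: assms)
  then show ?thesis using assms(2) unfolding smooth_def by blast
qed

lemma smooth_has_derivative: "smooth f \<Longrightarrow> (f has_derivative frechet_derivative f (at x)) (at x)"
  using smooth_differentiable frechet_derivative_works by blast

lemma smooth_add_cmult:
  fixes f g :: "'a::euclidean_space \<Rightarrow> complex"
  assumes "smooth f" "smooth g" shows "smooth (\<lambda>x. f x + c * g x)"
proof (rule smooth_coinduct[where P = "\<lambda>h. \<exists>f g. smooth f \<and> smooth g \<and> h = (\<lambda>x. f x + c * g x)"])
  fix h :: "'a \<Rightarrow> complex" and x k :: 'a
  assume "\<exists>f g. smooth f \<and> smooth g \<and> h = (\<lambda>x. f x + c * g x)"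
  then obtain f g where fg: "smooth f" "smooth g" "h = (\<lambda>x. f x + c * g x)" by blast
  have D: "(h has_derivative (\<lambda>v. frechet_derivative f (at x) v + c * frechet_derivative g (at x) v)) (at x)" for x
    unfolding fg(3) using fg(1,2) by (auto intro!: derivative_intros smooth_has_derivative)
  show "h differentiable (at x)" using D by (auto simp: differentiable_def)
  assume "k \<in> Basis"
  then show "\<exists>f g. smooth f \<and> smooth g \<and> (\<lambda>x. frechet_derivative h (at x) k) = (\<lambda>x. f x + c * g x)"
    using fg smooth_partial[of f k] smooth_partial[of g k] frechet_derivative_at[OF D, symmetric] by auto
qed (use assms in blast)

lemma smooth_zero: "smooth (\<lambda>x. 0)"
  by (rule smooth_coinduct[where P = "\<lambda>h. h = (\<lambda>x. 0)"]) auto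

lemma smooth_mult_coordinate:
  fixes f :: "'a::euclidean_space \<Rightarrow> complex"
  assumes "smooth f" shows "smooth (\<lambda>x. complex_of_real (x \<bullet> k) * f x)"
proof -
  \<comment> \<open>Products with a coordinate alone are not closed under differentiation; the
    summand g absorbs the lower-order term of the product rule.\<close>
  let ?P = "\<lambda>h. \<exists>f g. smooth f \<and> smooth g \<and> h = (\<lambda>x. complex_of_real (x \<bullet> k) * f x + g x)"
  have "?P (\<lambda>x. complex_of_real (x \<bullet> k) * f x)" using assms smooth_zero by force
  then show ?thesis
  proof (rule smooth_coinduct[where P = ?P])
    fix h :: "'a \<Rightarrow> complex" and x l :: 'a
    assume "?P h"
    then obtain f g where fg: "smooth f" "smooth g" "h = (\<lambda>x. complex_of_real (x \<bullet> k) * f x + g x)" by blast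
    have D: "(h has_derivative (\<lambda>v. complex_of_real (x \<bullet> k) * frechet_derivative f (at x) v +
        (complex_of_real (v \<bullet> k) * f x + frechet_derivative g (at x) v))) (at x)" for x
      unfolding fg(3) using fg(1,2)
      by (auto intro!: derivative_eq_intros smooth_has_derivative simp: algebra_simps)
    show "h differentiable (at x)" using D by (auto simp: differentiable_def)
    assume l: "l \<in> Basis"
    have "smooth (\<lambda>x. frechet_derivative g (at x) l + complex_of_real (l \<bullet> k) * f x)"
      using fg l by (intro smooth_add_cmult smooth_partial)
    then show "?P (\<lambda>x. frechet_derivative h (at x) l)"
      using fg smooth_partial[OF fg(1) l] frechet_derivative_at[OF D, symmetric]
      by (intro exI[of _ "\<lambda>x. frechet_derivative f (at x) l"]
        exI[of _ "\<lambda>x. frechet_derivative g (at x) l + complex_of_real (l \<bullet> k) * f x"]) (auto simp: algebra_simps)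
  qed
qed

text \<open>The generator vanishes from radius \<open>3 / 2\<close> on, so it belongs to this class.
  Vanishing is demanded on an open set, hence it passes to derivatives and the radius never has to
  grow.\<close>

definition test_fun :: "('a::euclidean_space \<Rightarrow> complex) \<Rightarrow> bool" where
  "test_fun m \<longleftrightarrow> smooth m \<and> (\<forall>x. 2 < norm x \<longrightarrow> m x = 0)"

lemma test_fun_partial:
  assumes "test_fun m" "k \<in> Basis" shows "test_fun (\<lambda>x. frechet_derivative m (at x) k)"
proof -
  have "frechet_derivative m (at x) k = 0" if "2 < norm x" for x
  proof -
    have "(m has_derivative (\<lambda>_. 0)) (at x)"
    proof (rule has_derivative_transform_within_open[of "\<lambda>_. 0"])
      show "open {y::'a. 2 < norm y}" by (intro open_Collect_less continuous_intros)
    qed (use assms that in \<open>auto simp: test_fun_def\<close>)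
    then show ?thesis using frechet_derivative_at by metis
  qed
  then show ?thesis using assms by (auto simp: test_fun_def intro: smooth_partial)
qed

lemma test_fun_add_cmult: "test_fun f \<Longrightarrow> test_fun g \<Longrightarrow> test_fun (\<lambda>x. f x + c * g x)"
  by (auto simp: test_fun_def intro: smooth_add_cmult)

lemma test_fun_mult_coordinate: "test_fun f \<Longrightarrow> test_fun (\<lambda>x. complex_of_real (x \<bullet> k) * f x)"
  by (auto simp: test_fun_def intro: smooth_mult_coordinate)

lemma test_fun_has_derivative:
  "test_fun f \<Longrightarrow> (f has_derivative frechet_derivative f (at x)) (at x)"
  by (simp add: test_fun_def smooth_has_derivative)

lemma test_fun_continuous: "test_fun f \<Longrightarrow> continuous_on UNIV f"
  using test_fun_has_derivative by (meson continuous_at_imp_continuous_on has_derivative_continuous)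

lemma test_fun_measurable [measurable_dest]: "test_fun f \<Longrightarrow> f \<in> borel_measurable borel"
  by (intro borel_measurable_continuous_onI test_fun_continuous)

lemma test_fun_bound:
  assumes "test_fun f"
  obtains B where "0 \<le> B" "\<And>x. norm (f x) \<le> B * indicator (cball 0 2) x"
proof -
  have "compact (f ` cball 0 2)"
    using test_fun_continuous[OF assms] continuous_on_subset by (intro compact_continuous_image) auto
  then obtain B where B: "0 < B" "\<forall>y\<in>f ` cball 0 2. norm y \<le> B" using compact_imp_bounded bounded_pos by blast
  then have "norm (f x) \<le> B * indicator (cball 0 2) x" for x
    using assms by (auto simp: test_fun_def indicator_def)
  then show ?thesis using that B by (meson less_imp_le)
qed

lemma integrable_indicator_cball:
  "integrable lborel (\<lambda>x::'a::euclidean_space. B * indicator (cball 0 r) x :: real)"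
  by (intro integrable_mult_right integrable_real_indicator emeasure_bounded_finite bounded_cball) simp

lemma test_fun_integrable:
  fixes f :: "'a::euclidean_space \<Rightarrow> complex"
  assumes "test_fun f" shows "integrable lborel f"
proof -
  obtain B where B: "0 \<le> B" "\<And>x. norm (f x) \<le> B * indicator (cball 0 2) x"
    by (rule test_fun_bound[OF assms]) blast
  have "integrable lborel (\<lambda>x::'a. B * indicator (cball 0 2) x)"
    by (rule integrable_indicator_cball)
  then show ?thesis
    by (rule Bochner_Integration.integrable_bound) (use B assms in \<open>auto intro: test_fun_measurable\<close>)
qed

section \<open>Elementary properties of the inverse Fourier integral\<close>

lemma inverse_fourier_bound:
  assumes "integrable lborel m"
  shows "norm (inverse_fourier m x) \<le> (1 / (2 * pi) ^ DIM('a)) * (\<integral>\<xi>. norm (m \<xi>) \<partial>(lborel :: 'a::euclidean_space measure))"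
proof -
  have "norm (\<integral>\<xi>. cis (x \<bullet> \<xi>) * m \<xi> \<partial>lborel) \<le> (\<integral>\<xi>. norm (cis (x \<bullet> \<xi>) * m \<xi>) \<partial>lborel)" by simp
  then show ?thesis
    unfolding inverse_fourier_def by (simp add: norm_mult norm_divide norm_power divide_right_mono)
qed

lemma cis_measurable [measurable]: "cis \<in> borel_measurable borel"
  by (intro borel_measurable_continuous_onI continuous_intros)

lemma integrable_cis_mult:
  assumes "integrable lborel m"
  shows "integrable lborel (\<lambda>\<xi>. cis (x \<bullet> \<xi>) * m (\<xi> :: 'a::euclidean_space))"
  by (rule Bochner_Integration.integrable_bound[OF integrable_norm[OF assms]])
    (use assms in \<open>auto simp: norm_mult\<close>)

lemma inverse_fourier_add_cmult:
  assumes "integrable lborel f" "integrable lborel g"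
  shows "inverse_fourier (\<lambda>\<xi>. f \<xi> + c * g \<xi>) x = inverse_fourier f x + c * inverse_fourier g x"
proof -
  have "(\<integral>\<xi>. cis (x \<bullet> \<xi>) * (f \<xi> + c * g \<xi>) \<partial>lborel) =
    (\<integral>\<xi>. cis (x \<bullet> \<xi>) * f \<xi> + c * (cis (x \<bullet> \<xi>) * g \<xi>) \<partial>lborel)"
    by (simp add: algebra_simps)
  also have "\<dots> = (\<integral>\<xi>. cis (x \<bullet> \<xi>) * f \<xi> \<partial>lborel) + c * (\<integral>\<xi>. cis (x \<bullet> \<xi>) * g \<xi> \<partial>lborel)"
    using integrable_cis_mult[OF assms(1)] integrable_cis_mult[OF assms(2)]
    by (subst Bochner_Integration.integral_add) auto
  finally show ?thesis by (simp add: inverse_fourier_def algebra_simps)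
qed

lemma continuous_inverse_fourier:
  fixes m :: "'a::euclidean_space \<Rightarrow> complex"
  assumes "integrable lborel m" shows "continuous_on UNIV (inverse_fourier m)"
proof -
  have "isCont (\<lambda>x. \<integral>\<xi>. cis (x \<bullet> \<xi>) * m \<xi> \<partial>lborel) x" for x
    unfolding continuous_at_sequentially comp_def
  proof (intro allI impI integral_dominated_convergence[where w = "\<lambda>\<xi>. norm (m \<xi>)"])
    fix u assume "u \<longlonglongrightarrow> x"
    then show "AE \<xi> in lborel. (\<lambda>n. cis (u n \<bullet> \<xi>) * m \<xi>) \<longlonglongrightarrow> cis (x \<bullet> \<xi>) * m \<xi>"
      by (intro always_eventually allI tendsto_intros)
  qed (use assms in \<open>auto simp: norm_mult\<close>)
  then have "continuous_on UNIV (\<lambda>x. \<integral>\<xi>. cis (x \<bullet> \<xi>) * m \<xi> \<partial>lborel)"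
    by (intro continuous_at_imp_continuous_on) auto
  then show ?thesis
    unfolding inverse_fourier_def[abs_def] by (intro continuous_intros)
qed

lemma lborel_integral_translate:
  fixes f :: "'a::euclidean_space \<Rightarrow> 'b::{banach, second_countable_topology}"
  assumes [measurable]: "f \<in> borel_measurable borel"
  shows "(\<integral>x. f (x + h) \<partial>lborel) = (\<integral>x. f x \<partial>lborel)"
proof -
  have "(\<integral>x. f x \<partial>lborel) = (\<integral>x. f x \<partial>distr lborel borel ((+) h))"
    by (simp add: lborel_distr_plus)
  also have "\<dots> = (\<integral>x. f (x + h) \<partial>lborel)"
    by (subst integral_distr) (auto simp: add.commute)
  finally show ?thesis ..
qed

lemma integrable_lborel_translate:
  fixes f :: "'a::euclidean_space \<Rightarrow> 'b::{banach, second_countable_topology}"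
  assumes "integrable lborel f" shows "integrable lborel (\<lambda>x. f (x + h))"
proof -
  have "integrable (distr lborel borel ((+) h)) f" using assms by (simp add: lborel_distr_plus)
  then show ?thesis by (subst (asm) integrable_distr_eq) (use assms in \<open>auto simp: add.commute\<close>)
qed

text \<open>Derivatives are used along a sequence of step sizes, because dominated convergence is
  applied to sequences of functions.\<close>

lemma difference_quotient_seq:
  fixes g :: "real \<Rightarrow> complex"
  assumes g: "(g has_vector_derivative D) (at 0)" and e: "e \<longlonglongrightarrow> 0" "\<And>n. e n \<noteq> 0"
  shows "(\<lambda>n. (g (e n) - g 0) / complex_of_real (e n)) \<longlonglongrightarrow> D"
proof -
  have "((\<lambda>h. norm (g (0 + h) - g 0 - h *\<^sub>R D) / norm h) \<longlongrightarrow> 0) (at 0)"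
    using g by (simp add: has_vector_derivative_def has_derivative_at)
  then have "(\<lambda>n. norm (g (e n) - g 0 - e n *\<^sub>R D) / norm (e n)) \<longlonglongrightarrow> 0"
    using filterlim_compose[of _ _ "at 0" e sequentially] e by (force simp: filterlim_at)
  also have "(\<lambda>n. norm (g (e n) - g 0 - e n *\<^sub>R D) / norm (e n)) = (\<lambda>n. norm ((g (e n) - g 0) / complex_of_real (e n) - D))"
  proof
    fix n
    have "(g (e n) - g 0) / complex_of_real (e n) - D = (g (e n) - g 0 - e n *\<^sub>R D) / complex_of_real (e n)"
      using e(2)[of n] by (simp add: scaleR_conv_of_real field_simps)
    then show "norm (g (e n) - g 0 - e n *\<^sub>R D) / norm (e n) = norm ((g (e n) - g 0) / complex_of_real (e n) - D)"
      by (simp add: norm_divide)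
  qed
  finally show ?thesis using LIM_zero_cancel tendsto_norm_zero_iff by blast
qed

text \<open>Integration by parts, obtained by differentiating the translation invariance of the integral.\<close>

lemma inverse_fourier_partial:
  fixes m :: "'a::euclidean_space \<Rightarrow> complex"
  assumes m: "test_fun m" and k: "k \<in> Basis"
  shows "inverse_fourier (\<lambda>\<xi>. frechet_derivative m (at \<xi>) k) x = - \<i> * complex_of_real (x \<bullet> k) * inverse_fourier m x"
proof -
  let ?m' = "\<lambda>\<xi>. frechet_derivative m (at \<xi>) k"
  let ?I = "\<integral>\<xi>. cis (x \<bullet> \<xi>) * m \<xi> \<partial>lborel"
  define e where "e n = 1 / real (Suc n)" for n
  have e: "0 < e n" "e n \<le> 1" for n by (auto simp: e_def)
  have e0: "e \<longlonglongrightarrow> 0"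
    using LIMSEQ_inverse_real_of_nat by (simp add: e_def[abs_def] inverse_eq_divide)
  note [measurable] = test_fun_measurable[OF m] test_fun_measurable[OF test_fun_partial[OF m k]]
  obtain B where B: "0 \<le> B" "\<And>x. norm (?m' x) \<le> B * indicator (cball 0 2) x"
    by (rule test_fun_bound[OF test_fun_partial[OF m k]]) blast
  have deriv: "((\<lambda>t. m (\<xi> + t *\<^sub>R k)) has_vector_derivative ?m' (\<xi> + t *\<^sub>R k)) (at t within A)" for \<xi> t A
  proof -
    have "((\<lambda>t. m (\<xi> + t *\<^sub>R k)) has_derivative (\<lambda>s. frechet_derivative m (at (\<xi> + t *\<^sub>R k)) (s *\<^sub>R k))) (at t within A)"
      by (rule has_derivative_compose[OF _ test_fun_has_derivative[OF m]]) (auto intro!: derivative_eq_intros)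
    moreover have "linear (frechet_derivative m (at (\<xi> + t *\<^sub>R k)))"
      using test_fun_has_derivative[OF m] has_derivative_linear by blast
    ultimately show ?thesis
      by (simp add: has_vector_derivative_def linear_cmul)
  qed
  \<comment> \<open>The mean value inequality dominates all difference quotients by one integrable
    function; steps of length at most 1 enlarge the supporting ball from radius 2 to radius
    3.\<close>
  have quot: "norm ((m (\<xi> + e n *\<^sub>R k) - m \<xi>) / e n) \<le> B * indicator (cball 0 3) \<xi>" for \<xi> n
  proof -
    have "norm (m (\<xi> + e n *\<^sub>R k) - m (\<xi> + 0 *\<^sub>R k)) \<le> (B * indicator (cball 0 3) \<xi>) * norm (e n - 0)"
    proof (rule differentiable_bound[where S = "{0..e n}" and f = "\<lambda>t. m (\<xi> + t *\<^sub>R k)" and f' = "\<lambda>t s. s *\<^sub>R ?m' (\<xi> + t *\<^sub>R k)"])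
      fix t assume t: "t \<in> {0..e n}"
      show "((\<lambda>t. m (\<xi> + t *\<^sub>R k)) has_derivative (\<lambda>s. s *\<^sub>R ?m' (\<xi> + t *\<^sub>R k))) (at t within {0..e n})"
        using deriv by (simp add: has_vector_derivative_def)
      have "norm \<xi> \<le> norm (\<xi> + t *\<^sub>R k) + norm (t *\<^sub>R k)"
        using norm_triangle_ineq4[of "\<xi> + t *\<^sub>R k" "t *\<^sub>R k"] by simp
      then have "norm \<xi> \<le> norm (\<xi> + t *\<^sub>R k) + 1" using t e(2)[of n] k by auto
      then have ind: "B * indicator (cball 0 2) (\<xi> + t *\<^sub>R k) \<le> B * indicator (cball 0 3) \<xi>"
        using B(1) by (auto simp: indicator_def)
      show "onorm (\<lambda>s. s *\<^sub>R ?m' (\<xi> + t *\<^sub>R k)) \<le> B * indicator (cball 0 3) \<xi>"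
        using order.trans[OF B(2) ind] by (intro onorm_le) (metis mult.commute mult_right_mono norm_ge_zero norm_scaleR real_norm_def)
    qed (use e in \<open>auto simp: less_imp_le\<close>)
    then show ?thesis using e(1)[of n] by (simp add: norm_divide divide_le_eq)
  qed
  have "(\<lambda>n. \<integral>\<xi>. cis (x \<bullet> \<xi>) * ((m (\<xi> + e n *\<^sub>R k) - m \<xi>) / e n) \<partial>lborel) \<longlonglongrightarrow> (\<integral>\<xi>. cis (x \<bullet> \<xi>) * ?m' \<xi> \<partial>lborel)"
  proof (rule integral_dominated_convergence[where w = "\<lambda>\<xi>. B * indicator (cball 0 3) \<xi>"])
    show "AE \<xi> in lborel. (\<lambda>n. cis (x \<bullet> \<xi>) * ((m (\<xi> + e n *\<^sub>R k) - m \<xi>) / e n)) \<longlonglongrightarrow> cis (x \<bullet> \<xi>) * ?m' \<xi>"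
    proof (intro always_eventually allI tendsto_mult tendsto_const)
      fix \<xi>
      show "(\<lambda>n. (m (\<xi> + e n *\<^sub>R k) - m \<xi>) / e n) \<longlonglongrightarrow> ?m' \<xi>"
        using difference_quotient_seq[OF deriv[of \<xi> 0 UNIV] e0] e(1) by (simp add: less_imp_neq[symmetric])
    qed
    show "AE \<xi> in lborel. norm (cis (x \<bullet> \<xi>) * ((m (\<xi> + e n *\<^sub>R k) - m \<xi>) / e n)) \<le> B * indicator (cball 0 3) \<xi>" for n
      using quot by (simp only: norm_mult norm_cis mult_1_left) simp
    show "integrable lborel (\<lambda>\<xi>::'a. B * indicator (cball 0 3) \<xi>)"
      by (rule integrable_indicator_cball)
  qed measurable
  moreover have "(\<integral>\<xi>. cis (x \<bullet> \<xi>) * ((m (\<xi> + e n *\<^sub>R k) - m \<xi>) / e n) \<partial>lborel) = (cis (- (e n * (x \<bullet> k))) - 1) / e n * ?I" for n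
  proof -
    have i: "integrable lborel (\<lambda>\<xi>. cis (x \<bullet> \<xi>) * m \<xi>)"
      by (intro integrable_cis_mult test_fun_integrable m)
    \<comment> \<open>The translation of m is paid for by a phase factor that leaves the integral.
      Differentiating this factor at 0 produces \<open>- \<i> * (x \<bullet> k)\<close>.\<close>
    have shift: "cis (x \<bullet> \<xi>) * m (\<xi> + e n *\<^sub>R k) =
      cis (- (e n * (x \<bullet> k))) * (cis (x \<bullet> (\<xi> + e n *\<^sub>R k)) * m (\<xi> + e n *\<^sub>R k))" for \<xi>
      by (simp add: mult.assoc[symmetric] cis_mult inner_add_right)
    have i': "integrable lborel (\<lambda>\<xi>. cis (x \<bullet> \<xi>) * m (\<xi> + e n *\<^sub>R k))"
      by (intro integrable_cis_mult integrable_lborel_translate test_fun_integrable m)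
    have "(\<integral>\<xi>. cis (x \<bullet> \<xi>) * ((m (\<xi> + e n *\<^sub>R k) - m \<xi>) / e n) \<partial>lborel) =
      (\<integral>\<xi>. (cis (x \<bullet> \<xi>) * m (\<xi> + e n *\<^sub>R k) - cis (x \<bullet> \<xi>) * m \<xi>) / e n \<partial>lborel)"
      by (simp add: algebra_simps)
    also have "\<dots> = ((\<integral>\<xi>. cis (x \<bullet> \<xi>) * m (\<xi> + e n *\<^sub>R k) \<partial>lborel) - ?I) / e n"
      using i i' by simp
    also have "(\<integral>\<xi>. cis (x \<bullet> \<xi>) * m (\<xi> + e n *\<^sub>R k) \<partial>lborel) = cis (- (e n * (x \<bullet> k))) * ?I"
      unfolding shift by (subst integral_mult_right_zero, subst lborel_integral_translate) auto
    finally show ?thesis by (simp add: algebra_simps diff_divide_distrib)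
  qed
  moreover have "(\<lambda>n. (cis (- (e n * (x \<bullet> k))) - 1) / e n * ?I) \<longlonglongrightarrow> (- \<i> * complex_of_real (x \<bullet> k)) * ?I"
  proof (intro tendsto_mult tendsto_const)
    have "((\<lambda>t. cis (- (t * (x \<bullet> k)))) has_vector_derivative (- \<i> * complex_of_real (x \<bullet> k))) (at 0)"
      using exp_scaleR_has_vector_derivative_right[of "- \<i> * complex_of_real (x \<bullet> k)" 0 UNIV]
      by (simp add: cis_conv_exp scaleR_conv_of_real mult_ac)
    from difference_quotient_seq[OF this e0]
    show "(\<lambda>n. (cis (- (e n * (x \<bullet> k))) - 1) / e n) \<longlonglongrightarrow> - \<i> * complex_of_real (x \<bullet> k)"
      using e(1) by (simp add: less_imp_neq[symmetric])
  qed
  ultimately have "(\<integral>\<xi>. cis (x \<bullet> \<xi>) * ?m' \<xi> \<partial>lborel) = (- \<i> * complex_of_real (x \<bullet> k)) * ?I"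
    by (metis (no_types, lifting) LIMSEQ_unique ext)
  then show ?thesis by (simp add: inverse_fourier_def)
qed

text \<open>Multiplication by \<open>1 + (x \<bullet> k)\<^sup>2\<close> corresponds to applying the
  identity minus the second derivative in direction k to the symbol, which preserves the class of
  test functions. One coordinate is treated at a time.\<close>

lemma inverse_fourier_decay_finite:
  fixes m :: "'a::euclidean_space \<Rightarrow> complex"
  assumes "finite F" "F \<subseteq> Basis" "test_fun m"
  shows "\<exists>m'. test_fun m' \<and>
    (\<forall>x. complex_of_real (\<Prod>k\<in>F. 1 + (x \<bullet> k)\<^sup>2) * inverse_fourier m x = inverse_fourier m' x)"
  using assms
proof (induction F arbitrary: m rule: finite_induct)
  case (insert k F)
  let ?m1 = "\<lambda>\<xi>. frechet_derivative m (at \<xi>) k"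
  let ?m2 = "\<lambda>\<xi>. frechet_derivative ?m1 (at \<xi>) k"
  have k: "k \<in> Basis" using insert by auto
  have t1: "test_fun ?m1" and t2: "test_fun ?m2"
    using insert.prems k by (auto intro!: test_fun_partial)
  \<comment> \<open>Two derivatives contribute the square of
    \<open>- \<i> * (x \<bullet> k)\<close>, which is negative; hence the minus sign in front of the
    second derivative.\<close>
  define m' where "m' \<xi> = m \<xi> + (-1) * ?m2 \<xi>" for \<xi>
  have m': "test_fun m'" unfolding m'_def[abs_def] using insert.prems t2 by (intro test_fun_add_cmult)
  have eq: "complex_of_real (1 + (x \<bullet> k)\<^sup>2) * inverse_fourier m x = inverse_fourier m' x" for x
  proof -
    have "inverse_fourier m' x = inverse_fourier m x + (-1) * inverse_fourier ?m2 x"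
      unfolding m'_def[abs_def] using insert.prems t2 by (intro inverse_fourier_add_cmult test_fun_integrable)
    also have "\<dots> = complex_of_real (1 + (x \<bullet> k)\<^sup>2) * inverse_fourier m x"
      unfolding inverse_fourier_partial[OF t1 k] inverse_fourier_partial[OF insert.prems(2) k]
      by (simp add: algebra_simps power2_eq_square)
    finally show ?thesis ..
  qed
  obtain m'' where m'': "test_fun m''"
    "\<And>x. complex_of_real (\<Prod>k\<in>F. 1 + (x \<bullet> k)\<^sup>2) * inverse_fourier m' x = inverse_fourier m'' x"
    using insert.IH[OF _ m'] insert.prems by auto
  have "complex_of_real (\<Prod>k\<in>insert k F. 1 + (x \<bullet> k)\<^sup>2) * inverse_fourier m x = inverse_fourier m'' x" for x
    using insert.hyps by (simp add: m''(2)[symmetric] eq[symmetric] mult_ac)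
  then show ?case using m''(1) by blast
qed auto

text \<open>A product of one-dimensional Cauchy profiles: integrable by Fubini, and exactly the
  decay that one second-order operator per coordinate delivers.\<close>

definition decay_weight :: "'a::euclidean_space \<Rightarrow> real" where
  "decay_weight x = (\<Prod>k\<in>Basis. 1 / (1 + (x \<bullet> k)\<^sup>2))"

lemma decay_weight_pos: "0 < decay_weight x"
  unfolding decay_weight_def by (intro prod_pos) (auto simp: add_pos_nonneg)

lemma inverse_fourier_decay:
  fixes m :: "'a::euclidean_space \<Rightarrow> complex"
  assumes "test_fun m"
  obtains C where "0 \<le> C" "\<And>x. norm (inverse_fourier m x) \<le> C * decay_weight x"
proof -
  obtain m' where m': "test_fun m'"
    "\<And>x. complex_of_real (\<Prod>k\<in>Basis. 1 + (x \<bullet> k)\<^sup>2) * inverse_fourier m x = inverse_fourier m' x"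
    using inverse_fourier_decay_finite[OF finite_Basis order_refl assms] by blast
  define C where "C = (1 / (2 * pi) ^ DIM('a)) * (\<integral>\<xi>. norm (m' \<xi>) \<partial>lborel)"
  have C: "0 \<le> C" by (simp add: C_def)
  have "norm (inverse_fourier m x) \<le> C * decay_weight x" for x
  proof -
    define P where "P = (\<Prod>k\<in>Basis. 1 + (x \<bullet> k)\<^sup>2)"
    have P: "0 < P" unfolding P_def by (intro prod_pos) (auto simp: add_pos_nonneg)
    have "P * norm (inverse_fourier m x) = norm (complex_of_real P * inverse_fourier m x)"
      using P by (simp add: norm_mult)
    also have "\<dots> = norm (inverse_fourier m' x)" using m'(2)[of x] by (simp only: P_def)
    also have "\<dots> \<le> C" unfolding C_def by (intro inverse_fourier_bound test_fun_integrable m')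
    finally have "norm (inverse_fourier m x) \<le> C * (1 / P)" using P by (simp add: field_simps)
    moreover have "decay_weight x = 1 / P" by (simp add: P_def decay_weight_def prod_dividef)
    ultimately show ?thesis by simp
  qed
  then show ?thesis using C that by blast
qed

text \<open>Lebesgue measure is the image of the product measure on coordinates. This serves both
  the decay weight and the Gaussian.\<close>

lemma lborel_prod:
  fixes f :: "'a::euclidean_space \<Rightarrow> real \<Rightarrow> 'b::{real_normed_field, banach, second_countable_topology}"
  assumes f: "\<And>b. b \<in> Basis \<Longrightarrow> integrable lborel (f b)"
  shows integrable_lborel_prod: "integrable lborel (\<lambda>x. \<Prod>b\<in>Basis. f b (x \<bullet> b))"
    and integral_lborel_prod: "(\<integral>x. (\<Prod>b\<in>Basis. f b (x \<bullet> b)) \<partial>lborel) = (\<Prod>b\<in>Basis. integral\<^sup>L lborel (f b))"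
proof -
  interpret product_sigma_finite "\<lambda>_::'a. lborel :: real measure" ..
  let ?T = "\<lambda>g. \<Sum>b\<in>Basis. g b *\<^sub>R b :: 'a"
  have [measurable]: "?T \<in> measurable (\<Pi>\<^sub>M b\<in>Basis. lborel) borel" by measurable
  have [measurable]: "(\<lambda>x. \<Prod>b\<in>Basis. f b (x \<bullet> b)) \<in> borel_measurable borel"
    using f by (intro borel_measurable_prod) (auto intro!: measurable_compose[of _ _ borel "f _"])
  have eq: "(\<Prod>b\<in>Basis. f b (?T g \<bullet> b)) = (\<Prod>b\<in>Basis. f b (g b))" for g
    by (intro prod.cong) (auto simp: inner_sum_left inner_Basis if_distrib cong: if_cong)
  show "integrable lborel (\<lambda>x. \<Prod>b\<in>Basis. f b (x \<bullet> b))"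
    unfolding lborel_eq[where 'a = 'a]
    by (subst integrable_distr_eq) (simp_all only: eq, auto intro!: product_integrable_prod f)
  have "(\<integral>x. (\<Prod>b\<in>Basis. f b (x \<bullet> b)) \<partial>(lborel::'a measure)) = (\<integral>g. (\<Prod>b\<in>Basis. f b (g b)) \<partial>(\<Pi>\<^sub>M b\<in>Basis. lborel))"
    unfolding lborel_eq[where 'a = 'a] by (subst integral_distr) (simp_all only: eq, measurable)
  also have "\<dots> = (\<Prod>b\<in>Basis. integral\<^sup>L lborel (f b))"
    by (intro product_integral_prod f) auto
  finally show "(\<integral>x. (\<Prod>b\<in>Basis. f b (x \<bullet> b)) \<partial>(lborel::'a measure)) = (\<Prod>b\<in>Basis. integral\<^sup>L lborel (f b))" .
qed

lemma integrable_decay_weight: "integrable lborel (decay_weight :: 'a::euclidean_space \<Rightarrow> real)"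
proof -
  have "integrable lborel (\<lambda>x::real. 1 / (1 + x\<^sup>2))"
    using integrable_inverse_1_plus_square by (simp add: set_integrable_def einterval_def inverse_eq_divide)
  then show ?thesis
    unfolding decay_weight_def[abs_def] by (intro integrable_lborel_prod[of "\<lambda>_ x. 1 / (1 + x\<^sup>2)"])
qed

text \<open>In each coordinate \<open>1 + (y + z)\<^sup>2 \<le> 3 * (1 + y\<^sup>2)\<close> as soon
  as z has modulus at most 1, by \<open>2 * (y * z) \<le> y\<^sup>2 + z\<^sup>2\<close>; this is
  where the 3 comes from.\<close>

lemma decay_weight_shift:
  fixes x h :: "'a::euclidean_space"
  assumes "norm h \<le> 1" shows "decay_weight (x - h) \<le> 3 ^ DIM('a) * decay_weight x"
proof -
  have "decay_weight (x - h) \<le> (\<Prod>k\<in>(Basis::'a set). 3 * (1 / (1 + (x \<bullet> k)\<^sup>2)))"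
    unfolding decay_weight_def
  proof (intro prod_mono conjI)
    fix k :: 'a assume k: "k \<in> Basis"
    have h: "\<bar>h \<bullet> k\<bar> \<le> 1" using Basis_le_norm[OF k, of h] assms by simp
    define y z where "y = (x - h) \<bullet> k" and "z = h \<bullet> k"
    have xk: "x \<bullet> k = y + z" by (simp add: y_def z_def inner_diff_left)
    have "z\<^sup>2 \<le> 1" using h by (simp add: z_def abs_square_le_1)
    moreover have "0 \<le> (y - z)\<^sup>2" by simp
    then have "2 * (y * z) \<le> y\<^sup>2 + z\<^sup>2" by (simp add: power2_diff)
    moreover have "(y + z)\<^sup>2 = y\<^sup>2 + z\<^sup>2 + 2 * (y * z)" by (simp add: power2_sum)
    \<comment> \<open>What remains is linear in the quantities u = \<open>z\<^sup>2\<close>, v =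
      \<open>y\<^sup>2\<close>, w = \<open>y * z\<close> and d =
      \<open>(y + z)\<^sup>2\<close>.\<close>
    moreover have "u \<le> 1 \<Longrightarrow> 2 * w \<le> v + u \<Longrightarrow> d = v + u + 2 * w \<Longrightarrow> 0 \<le> v \<Longrightarrow> 1 + d \<le> 3 * (1 + v)"
      for u v w d :: real by (simp add: distrib_left)
    ultimately have "1 + (y + z)\<^sup>2 \<le> 3 * (1 + y\<^sup>2)" using zero_le_power2[of y] by blast
    then show "1 / (1 + ((x - h) \<bullet> k)\<^sup>2) \<le> 3 * (1 / (1 + (x \<bullet> k)\<^sup>2))"
      unfolding xk y_def[symmetric] by (simp add: divide_simps add_pos_nonneg add_nonneg_eq_0_iff)
    show "0 \<le> 1 / (1 + ((x - h) \<bullet> k)\<^sup>2)" by (simp add: add_nonneg_nonneg)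
  qed
  also have "\<dots> = 3 ^ DIM('a) * decay_weight x" unfolding decay_weight_def by (subst prod.distrib) simp
  finally show ?thesis .
qed

lemma inverse_fourier_integrable:
  fixes m :: "'a::euclidean_space \<Rightarrow> complex"
  assumes "test_fun m" shows "integrable lborel (inverse_fourier m)"
proof -
  obtain C where C: "0 \<le> C" "\<And>x. norm (inverse_fourier m x) \<le> C * decay_weight x"
    by (rule inverse_fourier_decay[OF assms]) blast
  have "integrable lborel (\<lambda>x::'a. C * decay_weight x)"
    by (intro integrable_mult_right integrable_decay_weight)
  then show ?thesis
  proof (rule Bochner_Integration.integrable_bound)
    show "inverse_fourier m \<in> borel_measurable lborel"
      using continuous_inverse_fourier[OF test_fun_integrable[OF assms]] by (simp add: borel_measurable_continuous_onI)
    show "AE x in lborel. norm (inverse_fourier m x) \<le> norm (C * decay_weight x)"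
      using C by (intro AE_I2) (simp add: abs_mult abs_of_pos decay_weight_pos)
  qed
qed

text \<open>The mean value inequality on the segment from x to \<open>x - h\<close>. The derivative
  along it is, up to a factor \<open>- \<i>\<close>, the inverse transform of the symbol multiplied
  by \<open>\<xi> \<bullet> h\<close>, and differentiability is obtained from an explicit quadratic
  remainder.\<close>

lemma inverse_fourier_integral_by_segment:
  fixes m :: "'a::euclidean_space \<Rightarrow> complex"
  assumes m: "test_fun m"
    and B: "\<And>t. t \<in> {0..1} \<Longrightarrow> norm (inverse_fourier (\<lambda>\<xi>. complex_of_real (\<xi> \<bullet> h) * m \<xi>) (x - t *\<^sub>R h)) \<le> B"
  shows "norm (inverse_fourier m (x - h) - inverse_fourier m x) \<le> B"
proof -
  let ?n = "\<lambda>\<xi>. complex_of_real (\<xi> \<bullet> h) * m \<xi>"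
  have n: "test_fun ?n" using m by (rule test_fun_mult_coordinate)
  let ?c = "complex_of_real (1 / (2 * pi) ^ DIM('a))"
  \<comment> \<open>The remainder of the exponential is at most half the squared phase, and on the
    support of m the phase is at most \<open>\<bar>s - t\<bar> * (2 * norm h)\<close>.\<close>
  define K where "K = norm ?c * ((2 * norm h)\<^sup>2 / 2 * (\<integral>\<xi>. norm (m \<xi>) \<partial>lborel))"
  have quad: "norm (inverse_fourier m (x - s *\<^sub>R h) - inverse_fourier m (x - t *\<^sub>R h) -
      (s - t) *\<^sub>R (- \<i> * inverse_fourier ?n (x - t *\<^sub>R h))) \<le> K * (s - t)\<^sup>2" for s t
  proof -
    let ?z = "x - t *\<^sub>R h"
    \<comment> \<open>The phase difference between the points \<open>x - s *\<^sub>R h\<close> and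
      \<open>x - t *\<^sub>R h\<close> at frequency \<open>\<xi>\<close>.\<close>
    define y where "y \<xi> = - (s - t) * (\<xi> \<bullet> h)" for \<xi>
    note i1 = integrable_cis_mult[OF test_fun_integrable[OF m]]
    note i2 = integrable_cis_mult[OF test_fun_integrable[OF n]]
    have "inverse_fourier m (x - s *\<^sub>R h) - inverse_fourier m ?z - (s - t) *\<^sub>R (- \<i> * inverse_fourier ?n ?z) =
      ?c * ((\<integral>\<xi>. cis ((x - s *\<^sub>R h) \<bullet> \<xi>) * m \<xi> \<partial>lborel) - (\<integral>\<xi>. cis (?z \<bullet> \<xi>) * m \<xi> \<partial>lborel) +
        (complex_of_real (s - t) * \<i>) * (\<integral>\<xi>. cis (?z \<bullet> \<xi>) * ?n \<xi> \<partial>lborel))"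
    proof -
      have "c * A - c * B - w * (- \<i> * (c * D)) = c * (A - B + (w * \<i>) * D)" for A B c w D :: complex
        by (simp add: algebra_simps)
      then show ?thesis unfolding inverse_fourier_def scaleR_conv_of_real .
    qed
    also have "\<dots> = ?c * (\<integral>\<xi>. cis ((x - s *\<^sub>R h) \<bullet> \<xi>) * m \<xi> - cis (?z \<bullet> \<xi>) * m \<xi> +
        (complex_of_real (s - t) * \<i>) * (cis (?z \<bullet> \<xi>) * ?n \<xi>) \<partial>lborel)"
      using i1 i2 by simp
    also have "(\<lambda>\<xi>. cis ((x - s *\<^sub>R h) \<bullet> \<xi>) * m \<xi> - cis (?z \<bullet> \<xi>) * m \<xi> +
        (complex_of_real (s - t) * \<i>) * (cis (?z \<bullet> \<xi>) * ?n \<xi>)) =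
        (\<lambda>\<xi>. cis (?z \<bullet> \<xi>) * (cis (y \<xi>) - 1 - \<i> * y \<xi>) * m \<xi>)"
    proof
      fix \<xi>
      have "(x - s *\<^sub>R h) \<bullet> \<xi> = ?z \<bullet> \<xi> + y \<xi>"
        by (simp add: y_def inner_diff_left inner_commute algebra_simps)
      then have "cis ((x - s *\<^sub>R h) \<bullet> \<xi>) = cis (?z \<bullet> \<xi>) * cis (y \<xi>)" by (simp add: cis_mult)
      then show "cis ((x - s *\<^sub>R h) \<bullet> \<xi>) * m \<xi> - cis (?z \<bullet> \<xi>) * m \<xi> +
        (complex_of_real (s - t) * \<i>) * (cis (?z \<bullet> \<xi>) * ?n \<xi>) =
        cis (?z \<bullet> \<xi>) * (cis (y \<xi>) - 1 - \<i> * y \<xi>) * m \<xi>"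
        by (simp add: y_def algebra_simps)
    qed
    also have "norm (?c * (\<integral>\<xi>. cis (?z \<bullet> \<xi>) * (cis (y \<xi>) - 1 - \<i> * y \<xi>) * m \<xi> \<partial>lborel)) \<le>
      norm ?c * (\<integral>\<xi>. (s - t)\<^sup>2 * ((2 * norm h)\<^sup>2 / 2) * norm (m \<xi>) \<partial>lborel)"
    proof -
      have int: "integrable lborel (\<lambda>\<xi>. (s - t)\<^sup>2 * ((2 * norm h)\<^sup>2 / 2) * norm (m \<xi>))"
        by (intro integrable_mult_right integrable_norm test_fun_integrable m)
      have bd: "norm (cis (?z \<bullet> \<xi>) * (cis (y \<xi>) - 1 - \<i> * y \<xi>) * m \<xi>) \<le> (s - t)\<^sup>2 * ((2 * norm h)\<^sup>2 / 2) * norm (m \<xi>)" for \<xi>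
      proof (cases "norm \<xi> \<le> 2")
        case True
        have "norm (cis (y \<xi>) - 1 - \<i> * y \<xi>) \<le> (y \<xi>)\<^sup>2 / 2"
          using iexp_approx1[of "y \<xi>" 1] by (simp add: cis_conv_exp algebra_simps numeral_2_eq_2 power2_eq_square)
        also have "\<bar>\<xi> \<bullet> h\<bar> \<le> 2 * norm h"
          using Cauchy_Schwarz_ineq2[of \<xi> h] mult_right_mono[OF True norm_ge_zero[of h]] by linarith
        then have "(\<xi> \<bullet> h)\<^sup>2 \<le> (2 * norm h)\<^sup>2" by (intro abs_le_square_iff[THEN iffD1]) simp
        then have "(y \<xi>)\<^sup>2 / 2 \<le> (s - t)\<^sup>2 * ((2 * norm h)\<^sup>2 / 2)"
          using mult_left_mono[of "(\<xi> \<bullet> h)\<^sup>2" "(2 * norm h)\<^sup>2" "(s - t)\<^sup>2"]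
          by (simp add: y_def power_mult_distrib power2_commute mult_ac)
        finally show ?thesis by (simp add: norm_mult mult_right_mono)
      next
        case False
        then show ?thesis using m by (simp add: test_fun_def)
      qed
      have [measurable]: "m \<in> borel_measurable borel" using m by (rule test_fun_measurable)
      have "integrable lborel (\<lambda>\<xi>. cis (?z \<bullet> \<xi>) * (cis (y \<xi>) - 1 - \<i> * y \<xi>) * m \<xi>)"
        by (rule Bochner_Integration.integrable_bound[OF int])
          (simp add: y_def[abs_def], use order.trans[OF bd abs_ge_self] in \<open>simp only: real_norm_def AE_I2\<close>)
      from Bochner_Integration.integral_norm_bound_integral[OF this int bd]
      show ?thesis unfolding norm_mult by (intro mult_left_mono) auto
    qed
    also have "\<dots> = K * (s - t)\<^sup>2" by (simp add: K_def)
    finally show ?thesis .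
  qed
  have "norm (inverse_fourier m (x - 1 *\<^sub>R h) - inverse_fourier m (x - 0 *\<^sub>R h)) \<le> B * norm (1 - 0 :: real)"
  proof (rule differentiable_bound[where S = "{0..1}" and f = "\<lambda>t. inverse_fourier m (x - t *\<^sub>R h)"
        and f' = "\<lambda>t u. u *\<^sub>R (- \<i> * inverse_fourier ?n (x - t *\<^sub>R h))"])
    fix t :: real assume t: "t \<in> {0..1}"
    show "((\<lambda>t. inverse_fourier m (x - t *\<^sub>R h)) has_derivative (\<lambda>u. u *\<^sub>R (- \<i> * inverse_fourier ?n (x - t *\<^sub>R h)))) (at t within {0..1})"
    proof (rule has_derivativeI_sandwich[of 1 _ _ _ _ "\<lambda>s. K * \<bar>s - t\<bar>"])
      show "bounded_linear (\<lambda>u. u *\<^sub>R (- \<i> * inverse_fourier ?n (x - t *\<^sub>R h)))"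
        by (rule bounded_linear_scaleR_left)
      have "((\<lambda>s. K * \<bar>s - t\<bar>) \<longlongrightarrow> K * \<bar>t - t\<bar>) (at t within {0..1})"
        by (intro tendsto_intros)
      then show "((\<lambda>s. K * \<bar>s - t\<bar>) \<longlongrightarrow> 0) (at t within {0..1})" by simp
    next
      fix s :: real assume "s \<noteq> t"
      then show "norm (inverse_fourier m (x - s *\<^sub>R h) - inverse_fourier m (x - t *\<^sub>R h) -
        (s - t) *\<^sub>R (- \<i> * inverse_fourier ?n (x - t *\<^sub>R h))) / norm (s - t) \<le> K * \<bar>s - t\<bar>"
        using quad[of s t] by (simp add: divide_le_eq power2_eq_square abs_mult_self_eq mult.assoc)
    qed simp
    show "onorm (\<lambda>u. u *\<^sub>R (- \<i> * inverse_fourier ?n (x - t *\<^sub>R h))) \<le> B"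
    proof (rule onorm_le)
      fix u :: real
      have "norm (u *\<^sub>R (- \<i> * inverse_fourier ?n (x - t *\<^sub>R h))) = norm (inverse_fourier ?n (x - t *\<^sub>R h)) * norm u"
        by (simp only: norm_scaleR norm_mult norm_minus_cancel norm_ii mult_1_left real_norm_def mult.commute)
      also have "\<dots> \<le> B * norm u" using B[OF t] by (rule mult_right_mono) simp
      finally show "norm (u *\<^sub>R (- \<i> * inverse_fourier ?n (x - t *\<^sub>R h))) \<le> B * norm u" .
    qed
  qed auto
  then show ?thesis by simp
qed

text \<open>The gradient of the transform decays like the weight, and along a segment of length at
  most 1 the weight is comparable to its value at the endpoint x.\<close>

lemma inverse_fourier_increment:
  fixes m :: "'a::euclidean_space \<Rightarrow> complex"
  assumes m: "test_fun m"
  obtains C where "0 \<le> C"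
    "\<And>h x. norm h \<le> 1 \<Longrightarrow> norm (inverse_fourier m (x - h) - inverse_fourier m x) \<le> C * norm h * decay_weight x"
proof -
  let ?n = "\<lambda>k \<xi>. complex_of_real (\<xi> \<bullet> k) * m \<xi>"
  have "\<forall>k::'a. \<exists>C\<ge>0. \<forall>x. norm (inverse_fourier (?n k) x) \<le> C * decay_weight x"
  proof
    fix k
    show "\<exists>C\<ge>0. \<forall>x. norm (inverse_fourier (?n k) x) \<le> C * decay_weight x"
      by (rule inverse_fourier_decay[OF test_fun_mult_coordinate[OF m, of k]]) blast
  qed
  then obtain c where c: "\<And>k. 0 \<le> c k" "\<And>k x. norm (inverse_fourier (?n k) x) \<le> c k * decay_weight x"
    by metis
  define C where "C = (\<Sum>k\<in>Basis. c k) * 3 ^ DIM('a)"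
  have "norm (inverse_fourier m (x - h) - inverse_fourier m x) \<le> C * norm h * decay_weight x" if "norm h \<le> 1" for h x
  proof (rule inverse_fourier_integral_by_segment[OF m])
    fix t :: real assume t: "t \<in> {0..1}"
    let ?z = "x - t *\<^sub>R h"
    \<comment> \<open>Expanding h in the basis reduces the decay bounds to finitely many symbols, so
      the constant does not depend on h.\<close>
    have expand: "cis (?z \<bullet> \<xi>) * ?n h \<xi> = (\<Sum>k\<in>Basis. complex_of_real (h \<bullet> k) * (cis (?z \<bullet> \<xi>) * ?n k \<xi>))" for \<xi>
      by (subst euclidean_inner[of \<xi> h]) (simp add: sum_distrib_left sum_distrib_right mult_ac)
    have "inverse_fourier (?n h) ?z = (\<Sum>k\<in>Basis. complex_of_real (h \<bullet> k) * inverse_fourier (?n k) ?z)"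
    proof -
      have "(\<integral>\<xi>. cis (?z \<bullet> \<xi>) * ?n h \<xi> \<partial>lborel) =
        (\<Sum>k\<in>Basis. \<integral>\<xi>. complex_of_real (h \<bullet> k) * (cis (?z \<bullet> \<xi>) * ?n k \<xi>) \<partial>lborel)"
        unfolding expand
        by (intro Bochner_Integration.integral_sum integrable_mult_right integrable_cis_mult test_fun_integrable
            test_fun_mult_coordinate m)
      also have "\<dots> = (\<Sum>k\<in>Basis. complex_of_real (h \<bullet> k) * (\<integral>\<xi>. cis (?z \<bullet> \<xi>) * ?n k \<xi> \<partial>lborel))"
        by simp
      finally show ?thesis
        unfolding inverse_fourier_def by (simp only: sum_distrib_left mult.left_commute)
    qed
    then have "norm (inverse_fourier (?n h) ?z) \<le> (\<Sum>k\<in>Basis. norm (complex_of_real (h \<bullet> k) * inverse_fourier (?n k) ?z))"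
      by (simp add: norm_sum)
    also have "\<dots> \<le> (\<Sum>k\<in>Basis. norm h * (c k * decay_weight ?z))"
      unfolding norm_mult by (intro sum_mono mult_mono c) (auto simp: Basis_le_norm)
    also have "\<dots> = (\<Sum>k\<in>Basis. c k) * norm h * decay_weight ?z"
      by (simp add: sum_distrib_left sum_distrib_right mult_ac)
    also have "\<dots> \<le> (\<Sum>k\<in>Basis. c k) * norm h * (3 ^ DIM('a) * decay_weight x)"
    proof (intro mult_left_mono decay_weight_shift)
      show "norm (t *\<^sub>R h) \<le> 1" using t that by (simp add: mult_le_one)
    qed (auto intro!: mult_nonneg_nonneg sum_nonneg c)
    finally show "norm (inverse_fourier (?n h) ?z) \<le> C * norm h * decay_weight x" by (simp add: C_def mult_ac)
  qed
  moreover have "0 \<le> C" unfolding C_def by (intro mult_nonneg_nonneg sum_nonneg c) auto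
  ultimately show ?thesis using that by blast
qed

text \<open>Short shifts use the gradient bound and integrability of the weight; for long shifts the
  minimum is 1, and twice the total mass A is enough. This gives the constant
  \<open>C * W + 2 * A\<close>.\<close>

lemma inverse_fourier_L1_increment:
  fixes m :: "'a::euclidean_space \<Rightarrow> complex"
  assumes m: "test_fun m"
  obtains C where "0 \<le> C"
    "\<And>h. (\<integral>\<^sup>+ x. ennreal (norm (inverse_fourier m (x - h) - inverse_fourier m x)) \<partial>lborel) \<le> ennreal (C * min 1 (norm h))"
proof -
  obtain C where C: "0 \<le> C"
    "\<And>h x. norm h \<le> 1 \<Longrightarrow> norm (inverse_fourier m (x - h) - inverse_fourier m x) \<le> C * norm h * decay_weight x"
    by (rule inverse_fourier_increment[OF m]) blast
  define W where "W = integral\<^sup>L lborel (decay_weight :: 'a \<Rightarrow> real)"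
  define A where "A = (\<integral>x. norm (inverse_fourier m x) \<partial>lborel)"
  have W: "(\<integral>\<^sup>+ x. ennreal (decay_weight (x :: 'a)) \<partial>lborel) = ennreal W" "0 \<le> W"
  proof -
    have "AE x in lborel. 0 \<le> decay_weight (x :: 'a)"
      using decay_weight_pos by (intro AE_I2 less_imp_le)
    then show "(\<integral>\<^sup>+ x. ennreal (decay_weight (x :: 'a)) \<partial>lborel) = ennreal W" "0 \<le> W"
      unfolding W_def by (auto intro!: nn_integral_eq_integral integrable_decay_weight integral_nonneg_AE)
  qed
  have A: "(\<integral>\<^sup>+ x. ennreal (norm (inverse_fourier m x)) \<partial>lborel) = ennreal A" "0 \<le> A"
    unfolding A_def by (auto intro!: nn_integral_eq_integral integrable_norm inverse_fourier_integrable m)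
  have [measurable]: "inverse_fourier m \<in> borel_measurable borel"
    by (intro borel_measurable_continuous_onI continuous_inverse_fourier test_fun_integrable m)
  have "(\<integral>\<^sup>+ x. ennreal (norm (inverse_fourier m (x - h) - inverse_fourier m x)) \<partial>lborel) \<le>
    ennreal ((C * W + 2 * A) * min 1 (norm h))" for h
  proof (cases "norm h \<le> 1")
    case True
    have "(\<integral>\<^sup>+ x. ennreal (norm (inverse_fourier m (x - h) - inverse_fourier m x)) \<partial>lborel) \<le>
       (\<integral>\<^sup>+ x. ennreal (C * norm h) * ennreal (decay_weight (x :: 'a)) \<partial>lborel)"
    proof (rule nn_integral_mono)
      fix x
      have "norm (inverse_fourier m (x - h) - inverse_fourier m x) \<le> C * norm h * decay_weight x"
        using C(2) True by blast
      then show "ennreal (norm (inverse_fourier m (x - h) - inverse_fourier m x)) \<le> ennreal (C * norm h) * ennreal (decay_weight x)"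
        using C(1) by (subst ennreal_mult[symmetric]) (auto simp: less_imp_le decay_weight_pos intro!: ennreal_leI)
    qed
    also have "\<dots> = ennreal (C * norm h * W)"
      using C W(2) integrable_decay_weight[where 'a = 'a]
      by (subst nn_integral_cmult) (auto simp: W(1) ennreal_mult[symmetric])
    also have "\<dots> \<le> ennreal ((C * W + 2 * A) * min 1 (norm h))"
      using True A(2) by (intro ennreal_leI) (simp add: min_def algebra_simps)
    finally show ?thesis .
  next
    case False
    have "(\<integral>\<^sup>+ x. ennreal (norm (inverse_fourier m (x - h) - inverse_fourier m x)) \<partial>lborel) \<le>
       (\<integral>\<^sup>+ x. ennreal (norm (inverse_fourier m (x - h))) + ennreal (norm (inverse_fourier m x)) \<partial>lborel)"
      by (intro nn_integral_mono) (auto simp: ennreal_plus[symmetric] norm_triangle_ineq4 simp del: ennreal_plus intro!: ennreal_leI)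
    also have "\<dots> = ennreal (2 * A)"
    proof (subst nn_integral_add)
      show "(\<integral>\<^sup>+ x. ennreal (norm (inverse_fourier m (x - h))) \<partial>lborel) +
        (\<integral>\<^sup>+ x. ennreal (norm (inverse_fourier m x)) \<partial>lborel) = ennreal (2 * A)"
        using A by (simp add: nn_integral_lborel_translate[of "\<lambda>x. ennreal (norm (inverse_fourier m x))"]
          ennreal_plus[symmetric] del: ennreal_plus)
    qed auto
    also have "\<dots> \<le> ennreal ((C * W + 2 * A) * min 1 (norm h))"
      using False C W by (intro ennreal_leI) (simp add: min_def)
    finally show ?thesis .
  qed
  then show ?thesis using C W A by (intro that[of "C * W + 2 * A"]) auto
qed

section \<open>Fourier inversion\<close>

definition gauss :: "'a::euclidean_space \<Rightarrow> real" where
  "gauss x = exp (- (norm x)\<^sup>2 / 2)"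

section \<open>The Gaussian and its Fourier transform\<close>

lemma gauss_prod: "gauss x = (\<Prod>b\<in>Basis. exp (- (x \<bullet> b)\<^sup>2 / 2))"
proof -
  have "(norm x)\<^sup>2 = (\<Sum>b\<in>Basis. (x \<bullet> b)\<^sup>2)"
    unfolding power2_norm_eq_inner by (subst euclidean_inner) (simp add: power2_eq_square)
  then show ?thesis
    unfolding gauss_def by (simp add: exp_sum[symmetric] sum_negf sum_divide_distrib)
qed

lemma integrable_exp_square: "integrable lborel (\<lambda>x::real. exp (- x\<^sup>2 / 2))"
proof -
  have "integrable lborel (\<lambda>x. sqrt (2 * pi) * std_normal_density x)"
    by (intro integrable_mult_right) (rule integrable_normal_density, simp)
  then show ?thesis by (simp add: std_normal_density_def)
qed

text \<open>Read off from the characteristic function of the standard normal distribution, which has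
  the same shape as its density.\<close>

lemma integral_exp_square_cis:
  "(\<integral>x. complex_of_real (exp (- x\<^sup>2 / 2)) * cis (x * t) \<partial>lborel) = complex_of_real (sqrt (2 * pi) * exp (- t\<^sup>2 / 2))"
proof -
  have "complex_of_real (exp (- t\<^sup>2 / 2)) = char std_normal_distribution t"
    by (simp add: char_std_normal_distribution)
  also have "\<dots> = (\<integral>x. std_normal_density x *\<^sub>R iexp (t * x) \<partial>lborel)"
    unfolding char_def by (subst integral_density) (auto simp: normal_density_nonneg)
  also have "\<dots> = (\<integral>x. complex_of_real (1 / sqrt (2 * pi)) * (complex_of_real (exp (- x\<^sup>2 / 2)) * cis (x * t)) \<partial>lborel)"
    by (intro Bochner_Integration.integral_cong)
      (auto simp: std_normal_density_def cis_conv_exp scaleR_conv_of_real mult_ac)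
  also have "\<dots> = complex_of_real (1 / sqrt (2 * pi)) * (\<integral>x. complex_of_real (exp (- x\<^sup>2 / 2)) * cis (x * t) \<partial>lborel)"
    by simp
  finally show ?thesis by (simp add: field_simps)
qed

lemma integrable_gauss: "integrable lborel (gauss :: 'a::euclidean_space \<Rightarrow> real)"
  unfolding gauss_prod[abs_def] by (intro integrable_lborel_prod[of "\<lambda>_ x. exp (- x\<^sup>2 / 2)"] integrable_exp_square)

lemma gauss_measurable [measurable]: "gauss \<in> borel_measurable borel"
  using integrable_gauss by auto

lemma gauss_bounds: "0 \<le> gauss x" "gauss x \<le> 1"
  by (auto simp: gauss_def)

lemma continuous_gauss: "isCont gauss x"
  unfolding gauss_def[abs_def] by (intro continuous_intros) auto

lemma fourier_gauss:
  fixes y :: "'a::euclidean_space"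
  shows "(\<integral>z. complex_of_real (gauss z) * cis (z \<bullet> y) \<partial>lborel) = complex_of_real (sqrt (2 * pi) ^ DIM('a) * gauss y)"
proof -
  let ?f = "\<lambda>b x. complex_of_real (exp (- x\<^sup>2 / 2)) * cis (x * (y \<bullet> b))"
  have int: "integrable lborel (?f b)" for b
    by (rule Bochner_Integration.integrable_bound[OF integrable_exp_square]) (auto simp: norm_mult)
  have "complex_of_real (gauss z) * cis (z \<bullet> y) = (\<Prod>b\<in>Basis. ?f b (z \<bullet> b))" for z
  proof -
    have "cis (z \<bullet> y) = (\<Prod>b\<in>Basis. cis ((z \<bullet> b) * (y \<bullet> b)))"
      by (subst euclidean_inner) (simp add: cis_conv_exp exp_sum[symmetric] sum_distrib_left)
    then show ?thesis by (simp add: gauss_prod prod.distrib)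
  qed
  then have "(\<integral>z. complex_of_real (gauss z) * cis (z \<bullet> y) \<partial>lborel) = (\<Prod>b\<in>Basis. integral\<^sup>L lborel (?f b))"
    using integral_lborel_prod[of ?f, OF int] by simp
  also have "\<dots> = (\<Prod>b\<in>(Basis :: 'a set). complex_of_real (sqrt (2 * pi) * exp (- (y \<bullet> b)\<^sup>2 / 2)))"
    by (simp only: integral_exp_square_cis)
  finally show ?thesis by (simp add: gauss_prod prod.distrib)
qed

section \<open>Affine substitutions and exchange of integrals\<close>

lemma lborel_integral_affine:
  fixes f :: "'a::euclidean_space \<Rightarrow> 'b::{banach, second_countable_topology}"
  assumes [measurable]: "f \<in> borel_measurable borel" and c: "0 < c"
  shows "(\<integral>x. f x \<partial>lborel) = c ^ DIM('a) *\<^sub>R (\<integral>x. f (t + c *\<^sub>R x) \<partial>lborel)"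
proof -
  have "(\<integral>x. f x \<partial>lborel) = (\<integral>x. f x \<partial>density (distr lborel borel (\<lambda>x. t + c *\<^sub>R x)) (\<lambda>_. ennreal (\<bar>c\<bar> ^ DIM('a))))"
    using c by (subst lborel_affine[of c t]) auto
  also have "\<dots> = (\<integral>x. c ^ DIM('a) *\<^sub>R f x \<partial>distr lborel borel (\<lambda>x. t + c *\<^sub>R x))"
    using c by (subst integral_density) auto
  also have "\<dots> = c ^ DIM('a) *\<^sub>R (\<integral>x. f (t + c *\<^sub>R x) \<partial>lborel)"
    by (subst integral_distr) auto
  finally show ?thesis .
qed

lemma integrable_lborel_scale:
  fixes f :: "'a::euclidean_space \<Rightarrow> 'b::{banach, second_countable_topology}"
  assumes f: "integrable lborel f" and c: "0 < c"
  shows "integrable lborel (\<lambda>x. f (c *\<^sub>R x))"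
proof -
  have [measurable]: "f \<in> borel_measurable borel" using f by auto
  have "integrable (distr lborel borel (\<lambda>x. 0 + (1 / c) *\<^sub>R x)) (\<lambda>x. f (c *\<^sub>R x))"
    using c f by (subst integrable_distr_eq) auto
  then have "integrable (density (distr lborel borel (\<lambda>x. 0 + (1 / c) *\<^sub>R x)) (\<lambda>_. ennreal (\<bar>1 / c\<bar> ^ DIM('a)))) (\<lambda>x. f (c *\<^sub>R x))"
    by (subst integrable_density) auto
  then show ?thesis using c lborel_affine[of "1 / c" "0::'a"] by auto
qed

text \<open>The common hypothesis for every exchange of integrals below: the integrand is dominated
  by a product of integrable functions of one variable each.\<close>

lemma (in pair_sigma_finite) integrable_product_bound:
  fixes f g h :: "_ \<Rightarrow> complex"
  assumes f: "integrable M1 f" and g: "integrable M2 g" and h: "h \<in> borel_measurable (M1 \<Otimes>\<^sub>M M2)"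
    and bound: "\<And>x y. norm (h (x, y)) \<le> norm (f x) * norm (g y)"
  shows "integrable (M1 \<Otimes>\<^sub>M M2) h"
proof -
  have "integrable (M1 \<Otimes>\<^sub>M M2) (\<lambda>(x, y). f x * g y)"
  proof (rule Fubini_integrable)
    show "(\<lambda>(x, y). f x * g y) \<in> borel_measurable (M1 \<Otimes>\<^sub>M M2)"
      using f g by measurable
    have "(\<lambda>x. norm (f x) * (\<integral>y. norm (g y) \<partial>M2)) = (\<lambda>x. \<integral>y. norm (case (x, y) of (x, y) \<Rightarrow> f x * g y) \<partial>M2)"
      by (simp add: norm_mult)
    moreover have "integrable M1 (\<lambda>x. norm (f x) * (\<integral>y. norm (g y) \<partial>M2))"
      using f by (intro integrable_mult_left integrable_norm)
    ultimately show "integrable M1 (\<lambda>x. \<integral>y. norm (case (x, y) of (x, y) \<Rightarrow> f x * g y) \<partial>M2)" by simp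
    show "AE x in M1. integrable M2 (\<lambda>y. case (x, y) of (x, y) \<Rightarrow> f x * g y)"
      using g by auto
  qed
  then show ?thesis
    by (rule Bochner_Integration.integrable_bound) (use h bound in \<open>auto simp: norm_mult\<close>)
qed

text \<open>Fourier inversion by Gaussian summation: the cut-off \<open>gauss (\<epsilon> z)\<close> turns the double integral into
  an average of \<open>m\<close> around \<open>\<xi>\<close> at scale \<open>\<epsilon>\<close>.\<close>

lemma fourier_inversion:
  fixes m :: "'a::euclidean_space \<Rightarrow> complex"
  assumes int: "integrable lborel m" and cont: "continuous_on UNIV m" and bdd: "\<And>x. norm (m x) \<le> B"
    and intK: "integrable lborel (inverse_fourier m)"
  shows "(\<integral>z. cis (- (z \<bullet> \<xi>)) * inverse_fourier m z \<partial>lborel) = m \<xi>"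
proof -
  define e where "e n = 1 / real (Suc n)" for n
  have e: "0 < e n" for n by (auto simp: e_def)
  have e0: "e \<longlonglongrightarrow> 0"
    using LIMSEQ_inverse_real_of_nat by (simp add: e_def[abs_def] inverse_eq_divide)
  have [measurable]: "m \<in> borel_measurable borel" "inverse_fourier m \<in> borel_measurable borel"
    using int intK by auto
  let ?c = "complex_of_real (1 / (2 * pi) ^ DIM('a))"
  let ?s = "complex_of_real (sqrt (2 * pi) ^ DIM('a))"
  let ?I = "\<lambda>n. \<integral>z. complex_of_real (gauss (e n *\<^sub>R z)) * (cis (- (z \<bullet> \<xi>)) * inverse_fourier m z) \<partial>lborel"
  have gauss_lim: "(\<lambda>n. gauss (e n *\<^sub>R z)) \<longlonglongrightarrow> 1" for z :: 'a
  proof -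
    have "(\<lambda>n. e n *\<^sub>R z) \<longlonglongrightarrow> 0" using tendsto_scaleR[OF e0 tendsto_const[of z]] by simp
    from isCont_tendsto_compose[OF continuous_gauss this] show ?thesis by (simp add: gauss_def)
  qed
  have "?I \<longlonglongrightarrow> (\<integral>z. cis (- (z \<bullet> \<xi>)) * inverse_fourier m z \<partial>lborel)"
  proof (rule integral_dominated_convergence[where w = "\<lambda>z. norm (inverse_fourier m z)"])
    show "AE z in lborel. (\<lambda>n. complex_of_real (gauss (e n *\<^sub>R z)) * (cis (- (z \<bullet> \<xi>)) * inverse_fourier m z)) \<longlonglongrightarrow> cis (- (z \<bullet> \<xi>)) * inverse_fourier m z"
    proof (intro AE_I2)
      fix z :: 'a
      have "(\<lambda>n. complex_of_real (gauss (e n *\<^sub>R z)) * (cis (- (z \<bullet> \<xi>)) * inverse_fourier m z)) \<longlonglongrightarrow>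
        complex_of_real 1 * (cis (- (z \<bullet> \<xi>)) * inverse_fourier m z)"
        by (intro tendsto_intros gauss_lim)
      then show "(\<lambda>n. complex_of_real (gauss (e n *\<^sub>R z)) * (cis (- (z \<bullet> \<xi>)) * inverse_fourier m z)) \<longlonglongrightarrow> cis (- (z \<bullet> \<xi>)) * inverse_fourier m z"
        by simp
    qed
    show "AE z in lborel. norm (complex_of_real (gauss (e n *\<^sub>R z)) * (cis (- (z \<bullet> \<xi>)) * inverse_fourier m z)) \<le> norm (inverse_fourier m z)" for n
      by (intro AE_I2) (simp add: norm_mult abs_of_nonneg mult_left_le_one_le gauss_bounds)
  qed (use intK in auto)
  moreover have "?I \<longlonglongrightarrow> ?c * ?s * (\<integral>y. complex_of_real (gauss (y :: 'a)) * m \<xi> \<partial>lborel)"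
  proof -
    have gauss_scaled: "integrable lborel (\<lambda>z::'a. complex_of_real (gauss (e n *\<^sub>R z)))" for n
      by (intro integrable_of_real integrable_lborel_scale integrable_gauss e)
    \<comment> \<open>Inserting the definition of the transform and exchanging the integrals leaves
      the Fourier transform of a dilated Gaussian, which is a Gaussian of width \<open>e n\<close>
      around \<open>\<xi>\<close>.\<close>
    have I: "?I n = ?c * ?s * (\<integral>y. complex_of_real (gauss y) * m (\<xi> + e n *\<^sub>R y) \<partial>lborel)" for n
    proof -
      let ?h = "\<lambda>(z, \<eta>). complex_of_real (gauss (e n *\<^sub>R z)) * (cis (z \<bullet> (\<eta> - \<xi>)) * m \<eta>)"
      have int2: "integrable (lborel \<Otimes>\<^sub>M lborel) ?h"
        by (rule lborel_pair.integrable_product_bound[OF gauss_scaled[of n] int]) (auto simp: norm_mult)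
      have "?I n = (\<integral>z. ?c * (\<integral>\<eta>. complex_of_real (gauss (e n *\<^sub>R z)) * (cis (z \<bullet> (\<eta> - \<xi>)) * m \<eta>) \<partial>lborel) \<partial>lborel)"
      proof (intro Bochner_Integration.integral_cong refl)
        fix z :: 'a
        have "cis (z \<bullet> (\<eta> - \<xi>)) * m \<eta> = cis (- (z \<bullet> \<xi>)) * (cis (z \<bullet> \<eta>) * m \<eta>)" for \<eta>
          by (simp add: mult.assoc[symmetric] cis_mult inner_diff_right)
        then have "(\<integral>\<eta>. complex_of_real (gauss (e n *\<^sub>R z)) * (cis (z \<bullet> (\<eta> - \<xi>)) * m \<eta>) \<partial>lborel) =
          complex_of_real (gauss (e n *\<^sub>R z)) * (cis (- (z \<bullet> \<xi>)) * (\<integral>\<eta>. cis (z \<bullet> \<eta>) * m \<eta> \<partial>lborel))"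
          by (simp only: integral_mult_right_zero)
        then show "complex_of_real (gauss (e n *\<^sub>R z)) * (cis (- (z \<bullet> \<xi>)) * inverse_fourier m z) =
          ?c * (\<integral>\<eta>. complex_of_real (gauss (e n *\<^sub>R z)) * (cis (z \<bullet> (\<eta> - \<xi>)) * m \<eta>) \<partial>lborel)"
          by (simp only: inverse_fourier_def mult.left_commute)
      qed
      also have "\<dots> = ?c * (\<integral>z. (\<integral>\<eta>. ?h (z, \<eta>) \<partial>lborel) \<partial>lborel)" by simp
      also have "(\<integral>z. (\<integral>\<eta>. ?h (z, \<eta>) \<partial>lborel) \<partial>lborel) = (\<integral>\<eta>. (\<integral>z. ?h (z, \<eta>) \<partial>lborel) \<partial>lborel)"
        using lborel_pair.Fubini_integral[of "\<lambda>z \<eta>. ?h (z, \<eta>)"] int2 by (simp add: split_beta')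
      also have "\<dots> = (\<integral>\<eta>. m \<eta> * (\<integral>z. complex_of_real (gauss (e n *\<^sub>R z)) * cis (z \<bullet> (\<eta> - \<xi>)) \<partial>lborel) \<partial>lborel)"
        by (simp add: mult_ac)
      also have "(\<lambda>\<eta>. \<integral>z. complex_of_real (gauss (e n *\<^sub>R z)) * cis (z \<bullet> (\<eta> - \<xi>)) \<partial>lborel) =
        (\<lambda>\<eta>. complex_of_real ((1 / e n) ^ DIM('a)) * (?s * complex_of_real (gauss ((1 / e n) *\<^sub>R (\<eta> - \<xi>)))))"
      proof
        fix \<eta>
        have "(\<integral>z. complex_of_real (gauss (e n *\<^sub>R z)) * cis (z \<bullet> (\<eta> - \<xi>)) \<partial>lborel) =
          (1 / e n) ^ DIM('a) *\<^sub>R (\<integral>z. complex_of_real (gauss (e n *\<^sub>R (0 + (1 / e n) *\<^sub>R z))) * cis ((0 + (1 / e n) *\<^sub>R z) \<bullet> (\<eta> - \<xi>)) \<partial>lborel)"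
          using e[of n] by (intro lborel_integral_affine) auto
        also have "(\<integral>z. complex_of_real (gauss (e n *\<^sub>R (0 + (1 / e n) *\<^sub>R z))) * cis ((0 + (1 / e n) *\<^sub>R z) \<bullet> (\<eta> - \<xi>)) \<partial>lborel) =
          (\<integral>z. complex_of_real (gauss z) * cis (z \<bullet> ((1 / e n) *\<^sub>R (\<eta> - \<xi>))) \<partial>lborel)"
          using e[of n] by simp
        finally show "(\<integral>z. complex_of_real (gauss (e n *\<^sub>R z)) * cis (z \<bullet> (\<eta> - \<xi>)) \<partial>lborel) =
          complex_of_real ((1 / e n) ^ DIM('a)) * (?s * complex_of_real (gauss ((1 / e n) *\<^sub>R (\<eta> - \<xi>))))"
          unfolding fourier_gauss by (simp add: scaleR_conv_of_real)
      qed
      \<comment> \<open>Substituting \<open>\<eta> = \<xi> + e n *\<^sub>R y\<close>: the Jacobian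
        cancels the power of \<open>1 / e n\<close> in front of the Gaussian.\<close>
      also have "(\<integral>\<eta>. m \<eta> * (complex_of_real ((1 / e n) ^ DIM('a)) * (?s * complex_of_real (gauss ((1 / e n) *\<^sub>R (\<eta> - \<xi>))))) \<partial>lborel) =
        e n ^ DIM('a) *\<^sub>R (\<integral>y. m (\<xi> + e n *\<^sub>R y) * (complex_of_real ((1 / e n) ^ DIM('a)) * (?s * complex_of_real (gauss ((1 / e n) *\<^sub>R (\<xi> + e n *\<^sub>R y - \<xi>))))) \<partial>lborel)"
        using e[of n] by (intro lborel_integral_affine) auto
      also have "\<dots> = (\<integral>y. ?s * (complex_of_real (gauss y) * m (\<xi> + e n *\<^sub>R y)) \<partial>lborel)"
        unfolding integral_scaleR_right[symmetric] using e[of n]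
        by (intro Bochner_Integration.integral_cong refl) (simp add: scaleR_conv_of_real power_one_over mult_ac)
      finally show ?thesis by (simp add: mult.assoc)
    qed
    have "(\<lambda>n. \<integral>y. complex_of_real (gauss y) * m (\<xi> + e n *\<^sub>R y) \<partial>lborel) \<longlonglongrightarrow> (\<integral>y. complex_of_real (gauss (y :: 'a)) * m \<xi> \<partial>lborel)"
    proof (rule integral_dominated_convergence[where w = "\<lambda>y. gauss y * B"])
      show "integrable lborel (\<lambda>y::'a. gauss y * B)" by (intro integrable_mult_left integrable_gauss)
      show "AE y in lborel. (\<lambda>n. complex_of_real (gauss y) * m (\<xi> + e n *\<^sub>R y)) \<longlonglongrightarrow> complex_of_real (gauss y) * m \<xi>"
      proof (intro AE_I2 tendsto_mult tendsto_const)
        fix y :: 'a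
        have "(\<lambda>n. \<xi> + e n *\<^sub>R y) \<longlonglongrightarrow> \<xi>"
          using tendsto_add[OF tendsto_const[of \<xi>] tendsto_scaleR[OF e0 tendsto_const[of y]]] by simp
        moreover have "isCont m \<xi>" using cont by (simp add: continuous_on_eq_continuous_at)
        ultimately show "(\<lambda>n. m (\<xi> + e n *\<^sub>R y)) \<longlonglongrightarrow> m \<xi>"
          using isCont_tendsto_compose by blast
      qed
      show "AE y in lborel. norm (complex_of_real (gauss y) * m (\<xi> + e n *\<^sub>R y)) \<le> gauss y * B" for n
      proof (rule AE_I2)
        fix y :: 'a
        have "norm (complex_of_real (gauss y) * m (\<xi> + e n *\<^sub>R y)) = gauss y * norm (m (\<xi> + e n *\<^sub>R y))"
          unfolding norm_mult norm_of_real abs_of_nonneg[OF gauss_bounds(1)] ..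
        also have "\<dots> \<le> gauss y * B" by (rule mult_left_mono[OF bdd gauss_bounds(1)])
        finally show "norm (complex_of_real (gauss y) * m (\<xi> + e n *\<^sub>R y)) \<le> gauss y * B" .
      qed
    qed measurable
    from tendsto_mult[OF tendsto_const[of "?c * ?s"] this] show ?thesis unfolding I .
  qed
  ultimately have "(\<integral>z. cis (- (z \<bullet> \<xi>)) * inverse_fourier m z \<partial>lborel) = ?c * ?s * (\<integral>y. complex_of_real (gauss (y :: 'a)) * m \<xi> \<partial>lborel)"
    by (rule LIMSEQ_unique)
  also have "(\<integral>y. complex_of_real (gauss (y :: 'a)) * m \<xi> \<partial>lborel) = ?s * m \<xi>"
  proof -
    have "gauss (0::'a) = 1" by (simp add: gauss_def)
    with fourier_gauss[of "0::'a"] have "(\<integral>z. complex_of_real (gauss (z :: 'a)) \<partial>lborel) = ?s"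
      by (simp only: inner_zero_right cis_zero mult_1_right)
    then show ?thesis by (simp only: integral_mult_left_zero)
  qed
  \<comment> \<open>One factor \<open>?s\<close> stems from the Fourier transform of the Gaussian
    and one from its total mass; together they cancel the normalisation of
    \<open>inverse_fourier\<close>.\<close>
  also have "?c * ?s * (?s * m \<xi>) = m \<xi>"
  proof -
    have "sqrt (2 * pi) ^ DIM('a) * sqrt (2 * pi) ^ DIM('a) = (2 * pi) ^ DIM('a)"
      by (subst power_mult_distrib[symmetric]) simp
    then have "1 / (2 * pi) ^ DIM('a) * (sqrt (2 * pi) ^ DIM('a) * sqrt (2 * pi) ^ DIM('a)) = 1" by simp
    then have "?c * (?s * ?s) = 1" by (simp only: of_real_mult[symmetric] of_real_1)
    then show ?thesis by (simp only: mult.assoc[symmetric] mult_1_left)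
  qed
  finally show ?thesis .
qed

text \<open>Writing out the transform of m1 leaves a forward transform of
  \<open>inverse_fourier m2\<close>, which Fourier inversion evaluates. Hence the hypotheses fall
  mainly on m2.\<close>

lemma inverse_fourier_convolution:
  fixes m1 m2 :: "'a::euclidean_space \<Rightarrow> complex"
  assumes m1: "integrable lborel m1"
    and m2: "integrable lborel m2" "continuous_on UNIV m2" "\<And>x. norm (m2 x) \<le> B" "integrable lborel (inverse_fourier m2)"
  shows "(\<integral>z. inverse_fourier m1 (x - z) * inverse_fourier m2 z \<partial>lborel) = inverse_fourier (\<lambda>\<xi>. m1 \<xi> * m2 \<xi>) x"
proof -
  have [measurable]: "m1 \<in> borel_measurable borel" "inverse_fourier m2 \<in> borel_measurable borel"
    using m1 m2 by auto
  let ?c = "complex_of_real (1 / (2 * pi) ^ DIM('a))"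
  let ?h = "\<lambda>(z, \<xi>). cis ((x - z) \<bullet> \<xi>) * m1 \<xi> * inverse_fourier m2 z"
  have int: "integrable (lborel \<Otimes>\<^sub>M lborel) ?h"
    by (rule lborel_pair.integrable_product_bound[OF m2(4) m1]) (auto simp: norm_mult)
  have "(\<integral>z. inverse_fourier m1 (x - z) * inverse_fourier m2 z \<partial>lborel) =
    ?c * (\<integral>z. (\<integral>\<xi>. ?h (z, \<xi>) \<partial>lborel) \<partial>lborel)"
  proof -
    have "inverse_fourier m1 (x - z) * inverse_fourier m2 z = ?c * (\<integral>\<xi>. ?h (z, \<xi>) \<partial>lborel)" for z
      unfolding prod.case integral_mult_left_zero inverse_fourier_def[of m1] by (rule mult.assoc)
    then show ?thesis by (simp only: integral_mult_right_zero)
  qed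
  also have "(\<integral>z. (\<integral>\<xi>. ?h (z, \<xi>) \<partial>lborel) \<partial>lborel) = (\<integral>\<xi>. (\<integral>z. ?h (z, \<xi>) \<partial>lborel) \<partial>lborel)"
    using lborel_pair.Fubini_integral[of "\<lambda>z \<xi>. ?h (z, \<xi>)"] int by (simp add: split_beta')
  also have "\<dots> = (\<integral>\<xi>. cis (x \<bullet> \<xi>) * m1 \<xi> * (\<integral>z. cis (- (z \<bullet> \<xi>)) * inverse_fourier m2 z \<partial>lborel) \<partial>lborel)"
  proof (intro Bochner_Integration.integral_cong refl)
    fix \<xi> :: 'a
    have "?h (z, \<xi>) = cis (x \<bullet> \<xi>) * m1 \<xi> * (cis (- (z \<bullet> \<xi>)) * inverse_fourier m2 z)" for z
    proof -
      have "cis ((x - z) \<bullet> \<xi>) = cis (x \<bullet> \<xi>) * cis (- (z \<bullet> \<xi>))" by (simp add: cis_mult inner_diff_left)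
      then show ?thesis by simp
    qed
    then show "(\<integral>z. ?h (z, \<xi>) \<partial>lborel) = cis (x \<bullet> \<xi>) * m1 \<xi> * (\<integral>z. cis (- (z \<bullet> \<xi>)) * inverse_fourier m2 z \<partial>lborel)"
      by (simp only: integral_mult_right_zero)
  qed
  also have "\<dots> = (\<integral>\<xi>. cis (x \<bullet> \<xi>) * (m1 \<xi> * m2 \<xi>) \<partial>lborel)"
    using fourier_inversion[OF m2] by (simp add: mult.assoc)
  finally show ?thesis by (simp add: inverse_fourier_def)
qed

section \<open>Littlewood-Paley blocks and translations\<close>

text \<open>A Besov norm sees a distribution only through its blocks. Formulated on arbitrary
  sequences of functions, it can be applied to Riemann sums and to their pointwise limits without
  mentioning distributions.\<close>

definition profile_norm :: "real \<Rightarrow> ennreal \<Rightarrow> ennreal \<Rightarrow> (nat \<Rightarrow> 'a::euclidean_space \<Rightarrow> complex) \<Rightarrow> ennreal" where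
  "profile_norm s p q U = Lp_norm (count_space UNIV) q
     (\<lambda>j. ennreal (2 powr (s * real j)) * Lp_norm lborel p (\<lambda>x. ennreal (norm (U j x))))"

lemma besov_norm_eq_profile_norm: "besov_norm \<phi> s p q u = profile_norm s p q (\<lambda>j. LP_block \<phi> j u)"
  by (simp add: besov_norm_def profile_norm_def)

text \<open>Blocks are convolutions, so translating a measure by h translates each of its blocks by
  h.\<close>

definition translate :: "'a::euclidean_space \<Rightarrow> (nat \<Rightarrow> 'a \<Rightarrow> complex) \<Rightarrow> nat \<Rightarrow> 'a \<Rightarrow> complex" where
  "translate h U j x = U j (x - h)"

lemma translate_diff: "translate h (U - V) = translate h U - translate h V"
  by (simp add: translate_def fun_eq_iff)

lemma translate_add: "translate h (translate k U) = translate (h + k) U"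
  by (simp add: translate_def fun_eq_iff algebra_simps)

section \<open>The norm on sequences of blocks\<close>

lemma Lp_norm_zero: "1 \<le> p \<Longrightarrow> p < \<infinity> \<Longrightarrow> Lp_norm M p (\<lambda>x. 0) = 0"
  by (simp add: Lp_norm_finite_exponent)

lemma profile_norm_zero:
  assumes "1 \<le> p" "p < \<infinity>" "1 \<le> q" shows "profile_norm s p q 0 = 0"
  using seq_norm_cmult[OF assms(3), of 0 "\<lambda>_. 0"] by (simp add: profile_norm_def Lp_norm_zero[OF assms(1,2)])

lemma profile_norm_uminus: "profile_norm s p q (- U) = profile_norm s p q U"
  by (simp add: profile_norm_def)

lemma profile_norm_triangle:
  assumes "1 \<le> p" "p < \<infinity>" "1 \<le> q"
    and [measurable]: "\<And>j. U j \<in> borel_measurable borel" "\<And>j. V j \<in> borel_measurable borel"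
  shows "profile_norm s p q (U + V) \<le> profile_norm s p q U + profile_norm s p q V"
proof -
  have *: "Lp_norm lborel p (\<lambda>x. ennreal (norm (U j x + V j x))) \<le>
    Lp_norm lborel p (\<lambda>x. ennreal (norm (U j x))) + Lp_norm lborel p (\<lambda>x. ennreal (norm (V j x)))" for j
  proof -
    have "Lp_norm lborel p (\<lambda>x. ennreal (norm (U j x + V j x))) \<le>
      Lp_norm lborel p (\<lambda>x. ennreal (norm (U j x)) + ennreal (norm (V j x)))"
      using assms by (intro Lp_norm_mono) (auto simp: ennreal_plus[symmetric] norm_triangle_ineq simp del: ennreal_plus intro!: ennreal_leI)
    also have "\<dots> \<le> Lp_norm lborel p (\<lambda>x. ennreal (norm (U j x))) + Lp_norm lborel p (\<lambda>x. ennreal (norm (V j x)))"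
      using assms by (intro Lp_norm_triangle) auto
    finally show ?thesis .
  qed
  have "profile_norm s p q (U + V) \<le> Lp_norm (count_space UNIV) q
     (\<lambda>j. ennreal (2 powr (s * real j)) * Lp_norm lborel p (\<lambda>x. ennreal (norm (U j x))) +
       ennreal (2 powr (s * real j)) * Lp_norm lborel p (\<lambda>x. ennreal (norm (V j x))))"
    unfolding profile_norm_def distrib_left[symmetric] plus_fun_apply
    by (intro seq_norm_mono assms mult_left_mono *) auto
  also have "\<dots> \<le> profile_norm s p q U + profile_norm s p q V"
    unfolding profile_norm_def by (intro seq_norm_triangle assms)
  finally show ?thesis .
qed

lemma profile_norm_translate:
  assumes "p < \<infinity>" "\<And>j. U j \<in> borel_measurable borel"
  shows "profile_norm s p q (translate h U) = profile_norm s p q U"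
  unfolding profile_norm_def translate_def
  using assms by (subst Lp_norm_translate) auto

text \<open>The Besov scale is inhomogeneous: the frequency index starts at 0, so all weights
  increase with the regularity.\<close>

lemma profile_norm_mono_exponent:
  assumes "1 \<le> q" "s \<le> s'" shows "profile_norm s p q U \<le> profile_norm s' p q U"
  unfolding profile_norm_def using assms
  by (intro seq_norm_mono mult_right_mono ennreal_leI powr_mono) auto

text \<open>Lower semicontinuity under mere pointwise convergence of the blocks. It transfers
  uniform bounds on Riemann sums to the occupation measure itself.\<close>

lemma profile_norm_Fatou:
  assumes pq: "1 \<le> p" "p < \<infinity>" "1 \<le> q"
    and meas: "\<And>n j. U n j \<in> borel_measurable borel"
    and lim: "\<And>j x. (\<lambda>n. U n j x) \<longlonglongrightarrow> V j x"
    and le: "\<And>n. profile_norm s p q (U n) \<le> c"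
  shows "profile_norm s p q V \<le> c"
proof -
  let ?w = "\<lambda>j. ennreal (2 powr (s * real j))"
  have "?w j * Lp_norm lborel p (\<lambda>x. ennreal (norm (V j x))) \<le>
    liminf (\<lambda>n. ?w j * Lp_norm lborel p (\<lambda>x. ennreal (norm (U n j x))))" for j
  proof -
    have "ennreal (norm (V j x)) = liminf (\<lambda>n. ennreal (norm (U n j x)))" for x
      using lim[of j x] by (intro lim_imp_Liminf[symmetric]) (auto intro!: tendsto_intros)
    then have "?w j * Lp_norm lborel p (\<lambda>x. ennreal (norm (V j x))) = Lp_norm lborel p (\<lambda>x. ?w j * liminf (\<lambda>n. ennreal (norm (U n j x))))"
      using pq meas by (subst Lp_norm_cmult) auto
    also have "\<dots> = Lp_norm lborel p (\<lambda>x. liminf (\<lambda>n. ?w j * ennreal (norm (U n j x))))"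
    proof -
      have "?w j * liminf (\<lambda>n. ennreal (norm (U n j x))) = liminf (\<lambda>n. ?w j * ennreal (norm (U n j x)))" for x
      proof -
        have L: "(\<lambda>n. ennreal (norm (U n j x))) \<longlonglongrightarrow> ennreal (norm (V j x))"
          using lim[of j x] by (auto intro!: tendsto_intros)
        have "(\<lambda>n. ?w j * ennreal (norm (U n j x))) \<longlonglongrightarrow> ?w j * ennreal (norm (V j x))"
          by (intro ennreal_tendsto_cmult L) simp
        from lim_imp_Liminf[OF _ this] lim_imp_Liminf[OF _ L] show ?thesis by simp
      qed
      then show ?thesis by simp
    qed
    also have "\<dots> \<le> liminf (\<lambda>n. Lp_norm lborel p (\<lambda>x. ?w j * ennreal (norm (U n j x))))"
      using pq meas by (intro Lp_norm_Fatou) auto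
    also have "\<dots> = liminf (\<lambda>n. ?w j * Lp_norm lborel p (\<lambda>x. ennreal (norm (U n j x))))"
      using pq meas by (subst Lp_norm_cmult) auto
    finally show ?thesis .
  qed
  then have "profile_norm s p q V \<le> Lp_norm (count_space UNIV) q
      (\<lambda>j. liminf (\<lambda>n. ?w j * Lp_norm lborel p (\<lambda>x. ennreal (norm (U n j x)))))"
    unfolding profile_norm_def by (intro seq_norm_mono pq)
  also have "\<dots> \<le> liminf (\<lambda>n. profile_norm s p q (U n))"
    unfolding profile_norm_def by (intro seq_norm_Fatou pq)
  also have "\<dots> \<le> c"
  proof -
    have "liminf (\<lambda>n. profile_norm s p q (U n)) \<le> liminf (\<lambda>n. c)"
      by (intro Liminf_mono always_eventually allI le)
    then show ?thesis by (simp add: Liminf_const)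
  qed
  finally show ?thesis .
qed

lemma nn_integral_lborel_scale:
  fixes f :: "'a::euclidean_space \<Rightarrow> ennreal"
  assumes [measurable]: "f \<in> borel_measurable borel" and c: "0 < c"
  shows "(\<integral>\<^sup>+ x. f x \<partial>lborel) = ennreal (c ^ DIM('a)) * (\<integral>\<^sup>+ x. f (c *\<^sub>R x) \<partial>lborel)"
proof -
  have "(\<integral>\<^sup>+ x. f x \<partial>lborel) = (\<integral>\<^sup>+ x. f x \<partial>density (distr lborel borel (\<lambda>x. 0 + c *\<^sub>R x)) (\<lambda>_. ennreal (\<bar>c\<bar> ^ DIM('a))))"
    using c by (subst lborel_affine[of c "0::'a"]) auto
  also have "\<dots> = ennreal (c ^ DIM('a)) * (\<integral>\<^sup>+ x. f (c *\<^sub>R x) \<partial>lborel)"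
    using c by (simp add: nn_integral_density nn_integral_distr nn_integral_cmult)
  finally show ?thesis .
qed

lemma inverse_fourier_scale:
  fixes m :: "'a::euclidean_space \<Rightarrow> complex"
  assumes [measurable]: "m \<in> borel_measurable borel" and c: "0 < c"
  shows "inverse_fourier (\<lambda>\<xi>. m (\<xi> /\<^sub>R c)) x = complex_of_real (c ^ DIM('a)) * inverse_fourier m (c *\<^sub>R x)"
proof -
  have "(\<integral>\<xi>. cis (x \<bullet> \<xi>) * m (\<xi> /\<^sub>R c) \<partial>lborel) =
    c ^ DIM('a) *\<^sub>R (\<integral>\<xi>. cis (x \<bullet> (0 + c *\<^sub>R \<xi>)) * m ((0 + c *\<^sub>R \<xi>) /\<^sub>R c) \<partial>lborel)"
    using c by (intro lborel_integral_affine) auto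
  then show ?thesis using c by (simp add: inverse_fourier_def scaleR_conv_of_real)
qed

locale littlewood_paley =
  fixes \<phi> :: "'a::euclidean_space \<Rightarrow> complex"
  assumes generator: "dyadic_generator \<phi>"
begin

text \<open>The low-frequency cut-off at scale \<open>2 ^ j\<close>. Dyadic symbols are differences
  of consecutive cut-offs, so properties of the blocks reduce to scaled copies of one test
  function.\<close>

definition low :: "nat \<Rightarrow> 'a \<Rightarrow> complex" where
  "low j \<xi> = \<phi> (\<xi> /\<^sub>R 2 ^ j)"

definition kernel :: "nat \<Rightarrow> 'a \<Rightarrow> complex" where
  "kernel j = inverse_fourier (dyadic \<phi> j)"

text \<open>The conditional is needed because the natural-number predecessor of 0 is 0, which would
  count the lowest block twice.\<close>

definition neighbours :: "(nat \<Rightarrow> 'a \<Rightarrow> complex) \<Rightarrow> nat \<Rightarrow> 'a \<Rightarrow> complex" where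
  "neighbours U j x = (if j = 0 then 0 else U (j - 1) x) + U j x + U (Suc j) x"

section \<open>Littlewood-Paley kernels\<close>

lemma test_fun_generator: "test_fun \<phi>"
  using generator by (auto simp: dyadic_generator_def schwartz_def test_fun_def)

lemma low_one: "norm \<xi> \<le> 2 ^ j \<Longrightarrow> low j \<xi> = 1"
  using generator by (auto simp: dyadic_generator_def low_def divide_simps)

text \<open>The support radius \<open>3 / 2 * 2 ^ j\<close> is rounded up to
  \<open>2 ^ Suc j\<close>, where the next cut-off is still 1. So at each frequency
  \<open>low j\<close> vanishes or \<open>low (Suc j)\<close> is 1.\<close>

lemma low_zero: "2 ^ Suc j \<le> norm \<xi> \<Longrightarrow> low j \<xi> = 0"
proof -
  assume "2 ^ Suc j \<le> norm \<xi>"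
  moreover have "3 / 2 * 2 ^ j \<le> (2 :: real) ^ Suc j" by simp
  ultimately have "3 / 2 * 2 ^ j \<le> norm \<xi>" by (meson order_trans)
  then have "3 / 2 \<le> norm \<xi> / 2 ^ j" by (subst pos_le_divide_eq) auto
  also have "norm \<xi> / 2 ^ j = norm (\<xi> /\<^sub>R 2 ^ j)" by (simp add: divide_inverse)
  finally have "3 / 2 \<le> norm (\<xi> /\<^sub>R 2 ^ j)" .
  then show ?thesis using generator by (auto simp: dyadic_generator_def low_def)
qed

lemma low_integrable: "integrable lborel (low j)"
  unfolding low_def[abs_def] using integrable_lborel_scale[OF test_fun_integrable[OF test_fun_generator], of "inverse (2 ^ j)"] by simp

lemma low_continuous: "continuous_on UNIV (low j)"
  unfolding low_def[abs_def]
  by (intro continuous_on_compose2[OF test_fun_continuous[OF test_fun_generator]] continuous_intros) auto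

lemma low_bounded: obtains B where "\<And>j \<xi>. norm (low j \<xi>) \<le> B"
proof -
  obtain B where B: "0 \<le> B" "\<And>x. norm (\<phi> x) \<le> B * indicator (cball 0 2) x"
    by (rule test_fun_bound[OF test_fun_generator]) blast
  have "norm (low j \<xi>) \<le> B" for j \<xi>
  proof -
    have "norm (low j \<xi>) \<le> B * indicator (cball 0 2) (\<xi> /\<^sub>R 2 ^ j)" unfolding low_def by (rule B(2))
    also have "\<dots> \<le> B" using B(1) by (simp add: indicator_def)
    finally show ?thesis .
  qed
  then show ?thesis using that by blast
qed

lemma dyadic_low: "dyadic \<phi> 0 = low 0" "dyadic \<phi> (Suc j) = (\<lambda>\<xi>. low (Suc j) \<xi> + (-1) * low j \<xi>)"
  by (auto simp: low_def fun_eq_iff)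

lemma dyadic_integrable: "integrable lborel (dyadic \<phi> j)"
  by (cases j) (auto simp only: dyadic_low intro!: low_integrable Bochner_Integration.integrable_add integrable_mult_right)

lemma dyadic_continuous: "continuous_on UNIV (dyadic \<phi> j)"
  by (cases j) (auto simp only: dyadic_low intro!: low_continuous continuous_intros)

lemma dyadic_bounded: obtains B where "\<And>\<xi>. norm (dyadic \<phi> j \<xi>) \<le> B"
proof -
  obtain B where B: "\<And>j \<xi>. norm (low j \<xi>) \<le> B" by (rule low_bounded) blast
  have "0 \<le> B" using B[of 0 0] norm_ge_zero order_trans by blast
  have "norm (dyadic \<phi> j \<xi>) \<le> 2 * B" for \<xi>
  proof (cases j)
    case 0
    then show ?thesis unfolding 0 dyadic_low(1) using B[of 0 \<xi>] \<open>0 \<le> B\<close> by linarith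
  next
    case (Suc i)
    have "norm (low (Suc i) \<xi> + (-1) * low i \<xi>) \<le> norm (low (Suc i) \<xi>) + norm (low i \<xi>)"
      using norm_triangle_ineq4 by simp
    then show ?thesis unfolding Suc dyadic_low(2) using B[of "Suc i" \<xi>] B[of i \<xi>] by linarith
  qed
  then show ?thesis using that by blast
qed

lemma kernel_low: "kernel 0 x = inverse_fourier (low 0) x"
  "kernel (Suc j) x = inverse_fourier (low (Suc j)) x - inverse_fourier (low j) x"
  unfolding kernel_def dyadic_low by (simp_all only: inverse_fourier_add_cmult low_integrable) simp

lemma inverse_fourier_low:
  "inverse_fourier (low j) x = complex_of_real ((2 ^ j) ^ DIM('a)) * inverse_fourier \<phi> (2 ^ j *\<^sub>R x)"
  unfolding low_def[abs_def] using test_fun_measurable[OF test_fun_generator] by (intro inverse_fourier_scale) auto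

lemma kernel_continuous: "continuous_on UNIV (kernel j)"
  unfolding kernel_def by (intro continuous_inverse_fourier dyadic_integrable)

lemma kernel_measurable [measurable]: "kernel j \<in> borel_measurable borel"
  by (intro borel_measurable_continuous_onI kernel_continuous)

lemma inverse_fourier_low_integrable: "integrable lborel (inverse_fourier (low j))"
  unfolding inverse_fourier_low[abs_def]
  by (intro integrable_mult_right integrable_lborel_scale inverse_fourier_integrable test_fun_generator) simp

lemma kernel_integrable: "integrable lborel (kernel j)"
  by (cases j) (auto simp only: kernel_low[abs_def] intro!: inverse_fourier_low_integrable Bochner_Integration.integrable_diff)

lemma kernel_bounded: obtains B where "0 \<le> B" "\<And>x. norm (kernel j x) \<le> B"
  unfolding kernel_def using inverse_fourier_bound[OF dyadic_integrable, of j] by (metis norm_ge_zero order_trans)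

text \<open>Dilation preserves the integral norm of the kernel and turns a shift by h into one by
  \<open>2 ^ j *\<^sub>R h\<close>; hence the constant is uniform in j. The factor 2 accounts for
  the two cut-offs in a dyadic symbol.\<close>

lemma kernel_L1_increment:
  obtains C where "0 \<le> C"
    "\<And>j h. (\<integral>\<^sup>+ x. ennreal (norm (kernel j (x - h) - kernel j x)) \<partial>lborel) \<le> ennreal (C * min 1 (2 ^ j * norm h))"
proof -
  obtain C where C: "0 \<le> C"
    "\<And>h. (\<integral>\<^sup>+ x. ennreal (norm (inverse_fourier \<phi> (x - h) - inverse_fourier \<phi> x)) \<partial>lborel) \<le> ennreal (C * min 1 (norm h))"
    by (rule inverse_fourier_L1_increment[OF test_fun_generator]) blast
  have meas[measurable]: "inverse_fourier \<phi> \<in> borel_measurable borel" "inverse_fourier (low j) \<in> borel_measurable borel" for j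
    by (intro borel_measurable_continuous_onI continuous_inverse_fourier test_fun_integrable test_fun_generator low_integrable)+
  have low: "(\<integral>\<^sup>+ x. ennreal (norm (inverse_fourier (low j) (x - h) - inverse_fourier (low j) x)) \<partial>lborel) \<le> ennreal (C * min 1 (2 ^ j * norm h))" for j h
  proof -
    have "(\<integral>\<^sup>+ x. ennreal (norm (inverse_fourier (low j) (x - h) - inverse_fourier (low j) x)) \<partial>lborel) =
      (\<integral>\<^sup>+ x. ennreal ((2 ^ j) ^ DIM('a)) * ennreal (norm (inverse_fourier \<phi> (2 ^ j *\<^sub>R x - 2 ^ j *\<^sub>R h) - inverse_fourier \<phi> (2 ^ j *\<^sub>R x))) \<partial>lborel)"
      unfolding inverse_fourier_low scaleR_diff_right right_diff_distrib[symmetric]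
      by (simp add: norm_mult norm_power ennreal_mult)
    also have "\<dots> = (\<integral>\<^sup>+ x. ennreal (norm (inverse_fourier \<phi> (x - 2 ^ j *\<^sub>R h) - inverse_fourier \<phi> x)) \<partial>lborel)"
      using nn_integral_lborel_scale[of "\<lambda>x. ennreal (norm (inverse_fourier \<phi> (x - 2 ^ j *\<^sub>R h) - inverse_fourier \<phi> x))" "2 ^ j"]
      by (simp add: nn_integral_cmult)
    also have "\<dots> \<le> ennreal (C * min 1 (2 ^ j * norm h))" using C(2)[of "2 ^ j *\<^sub>R h"] by simp
    finally show ?thesis .
  qed
  have "(\<integral>\<^sup>+ x. ennreal (norm (kernel j (x - h) - kernel j x)) \<partial>lborel) \<le> ennreal ((2 * C) * min 1 (2 ^ j * norm h))" for j h
  proof (cases j)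
    case 0
    have "ennreal (C * min 1 (2 ^ 0 * norm h)) \<le> ennreal ((2 * C) * min 1 (2 ^ 0 * norm h))"
      using C(1) by (intro ennreal_leI mult_right_mono) auto
    from order_trans[OF low[of 0 h] this] show ?thesis unfolding 0 kernel_low .
  next
    case (Suc i)
    let ?D = "\<lambda>j x. ennreal (norm (inverse_fourier (low j) (x - h) - inverse_fourier (low j) x))"
    have "(\<integral>\<^sup>+ x. ennreal (norm (kernel j (x - h) - kernel j x)) \<partial>lborel) \<le> (\<integral>\<^sup>+ x. ?D (Suc i) x + ?D i x \<partial>lborel)"
    proof (rule nn_integral_mono)
      fix x
      have "norm (kernel j (x - h) - kernel j x) \<le>
        norm (inverse_fourier (low (Suc i)) (x - h) - inverse_fourier (low (Suc i)) x) + norm (inverse_fourier (low i) (x - h) - inverse_fourier (low i) x)"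
      proof -
        have "kernel j (x - h) - kernel j x = (inverse_fourier (low (Suc i)) (x - h) - inverse_fourier (low (Suc i)) x) -
            (inverse_fourier (low i) (x - h) - inverse_fourier (low i) x)"
          by (simp add: Suc kernel_low)
        then show ?thesis by (simp only: norm_triangle_ineq4)
      qed
      then show "ennreal (norm (kernel j (x - h) - kernel j x)) \<le> ?D (Suc i) x + ?D i x"
        by (simp add: ennreal_plus[symmetric] ennreal_leI del: ennreal_plus)
    qed
    also have "\<dots> = (\<integral>\<^sup>+ x. ?D (Suc i) x \<partial>lborel) + (\<integral>\<^sup>+ x. ?D i x \<partial>lborel)"
      by (rule nn_integral_add) auto
    also have "\<dots> \<le> ennreal (C * min 1 (2 ^ Suc i * norm h)) + ennreal (C * min 1 (2 ^ i * norm h))"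
      by (intro add_mono low)
    also have "\<dots> \<le> ennreal (C * min 1 (2 ^ Suc i * norm h)) + ennreal (C * min 1 (2 ^ Suc i * norm h))"
      using C(1) by (intro add_mono ennreal_leI mult_left_mono min.mono mult_right_mono) auto
    also have "\<dots> = ennreal ((2 * C) * min 1 (2 ^ j * norm h))"
      using C(1) by (simp add: Suc ennreal_plus[symmetric] del: ennreal_plus)
    finally show ?thesis .
  qed
  then show ?thesis using C(1) that[of "2 * C"] by auto
qed

text \<open>The three neighbouring symbols telescope to a difference of cut-offs at scales j + 1 and
  j - 2, the latter absent for small j. By the dichotomy for consecutive cut-offs this equals 1
  wherever the middle symbol is nonzero.\<close>

lemma neighbours_dyadic_mult: "neighbours (dyadic \<phi>) j \<xi> * dyadic \<phi> j \<xi> = dyadic \<phi> j \<xi>"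
proof (cases j)
  case 0
  have "low 0 \<xi> = 0 \<or> low (Suc 0) \<xi> = 1"
    using low_zero[of 0 \<xi>] low_one[of \<xi> "Suc 0"] by fastforce
  then show ?thesis unfolding neighbours_def 0 dyadic_low by auto
next
  case (Suc i)
  have z: "low i \<xi> = 0 \<or> low (Suc i) \<xi> = 1" for i
    using low_zero[of i \<xi>] low_one[of \<xi> "Suc i"] by fastforce
  show ?thesis
  proof (cases i)
    case 0
    show ?thesis using z[of 0] z[of 1] unfolding neighbours_def Suc 0 dyadic_low
      by (auto simp: dyadic_low algebra_simps simp del: dyadic.simps)
  next
    case (Suc k)
    show ?thesis using z[of k] z[of "Suc k"] z[of "Suc (Suc k)"] unfolding neighbours_def \<open>j = Suc i\<close> Suc
      by (auto simp: dyadic_low algebra_simps simp del: dyadic.simps)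
  qed
qed

lemma inverse_fourier_neighbours: "inverse_fourier (neighbours (dyadic \<phi>) j) x = neighbours kernel j x"
proof -
  have eq: "neighbours (dyadic \<phi>) j = (\<lambda>\<xi>. ((if j = 0 then 0 else 1) * dyadic \<phi> (j - 1) \<xi> + 1 * dyadic \<phi> j \<xi>) + 1 * dyadic \<phi> (Suc j) \<xi>)"
    by (auto simp: neighbours_def fun_eq_iff)
  have "inverse_fourier (\<lambda>\<xi>. ((if j = 0 then 0 else 1) * dyadic \<phi> (j - 1) \<xi> + 1 * dyadic \<phi> j \<xi>) + 1 * dyadic \<phi> (Suc j) \<xi>) x =
    inverse_fourier (\<lambda>\<xi>. 0 + (if j = 0 then 0 else 1) * dyadic \<phi> (j - 1) \<xi>) x + 1 * kernel j x + 1 * kernel (Suc j) x"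
    unfolding kernel_def
    by (subst inverse_fourier_add_cmult, (intro Bochner_Integration.integrable_add integrable_mult_right dyadic_integrable)+,
        subst inverse_fourier_add_cmult, (intro Bochner_Integration.integrable_add integrable_mult_right dyadic_integrable)+) simp
  also have "inverse_fourier (\<lambda>\<xi>. 0 + (if j = 0 then 0 else 1) * dyadic \<phi> (j - 1) \<xi>) x =
    inverse_fourier (\<lambda>\<xi>. 0) x + (if j = 0 then 0 else 1) * kernel (j - 1) x"
    unfolding kernel_def by (subst inverse_fourier_add_cmult) (auto intro!: dyadic_integrable)
  finally show ?thesis unfolding eq by (auto simp: neighbours_def inverse_fourier_def)
qed

lemma kernel_reproducing: "(\<integral>z. kernel j z * neighbours kernel j (x - z) \<partial>lborel) = kernel j x"
proof -
  have n: "integrable lborel (neighbours (dyadic \<phi>) j)"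
    unfolding neighbours_def[abs_def] by (cases j) (auto intro!: dyadic_integrable simp del: dyadic.simps)
  obtain B where B: "\<And>\<xi>. norm (dyadic \<phi> j \<xi>) \<le> B" by (rule dyadic_bounded) blast
  have "(\<integral>z. inverse_fourier (neighbours (dyadic \<phi>) j) (x - z) * inverse_fourier (dyadic \<phi> j) z \<partial>lborel) =
    inverse_fourier (\<lambda>\<xi>. neighbours (dyadic \<phi>) j \<xi> * dyadic \<phi> j \<xi>) x"
    using kernel_integrable[of j] unfolding kernel_def
    by (intro inverse_fourier_convolution[OF n dyadic_integrable dyadic_continuous B])
  then show ?thesis
    unfolding neighbours_dyadic_mult inverse_fourier_neighbours kernel_def[symmetric] by (simp add: mult.commute)
qed

text \<open>A profile stands for the sequence of Littlewood-Paley blocks of a distribution; the reproducing formula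
  is the only trace of the distribution that the estimates need.\<close>

definition profile :: "(nat \<Rightarrow> 'a \<Rightarrow> complex) \<Rightarrow> bool" where
  "profile U \<longleftrightarrow> (\<forall>j. U j \<in> borel_measurable borel) \<and> (\<forall>j. bounded (range (U j))) \<and>
     (\<forall>j x. U j x = (\<integral>z. kernel j z * neighbours U j (x - z) \<partial>lborel))"

section \<open>Linear structure and translations of profiles\<close>

lemma profile_measurable: "profile U \<Longrightarrow> U j \<in> borel_measurable borel"
  by (simp add: profile_def)

lemma neighbours_bounded:
  assumes "profile U" obtains B where "\<And>x. norm (neighbours U j x) \<le> B"
proof -
  have "\<exists>B. \<forall>x. norm (U i x) \<le> B" for i
    using assms by (auto simp: profile_def bounded_iff)
  then obtain B where B: "\<And>i x. norm (U i x) \<le> B i" by metis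
  have "norm (neighbours U j x) \<le> B (j - 1) + B j + B (Suc j)" for x
  proof -
    have "norm (if j = 0 then 0 else U (j - 1) x) \<le> B (j - 1)"
      using B[of "j - 1" x] order.trans[OF norm_ge_zero B[of "j - 1" x]] by auto
    then show ?thesis unfolding neighbours_def
      by (intro norm_triangle_mono norm_triangle_ineq B)
  qed
  then show ?thesis using that by blast
qed

lemma neighbours_measurable: "profile U \<Longrightarrow> neighbours U j \<in> borel_measurable borel"
proof -
  assume "profile U"
  note [measurable] = profile_measurable[OF this]
  show ?thesis unfolding neighbours_def[abs_def] by (cases j) simp_all
qed

lemma profile_integrable:
  assumes "profile U" shows "integrable lborel (\<lambda>z. kernel j z * neighbours U j (x - z))"
proof -
  note [measurable] = neighbours_measurable[OF assms]
  obtain B where B: "\<And>x. norm (neighbours U j x) \<le> B" by (rule neighbours_bounded[OF assms]) blast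
  have "integrable lborel (\<lambda>z. norm (kernel j z) * B)" by (intro integrable_mult_left integrable_norm kernel_integrable)
  then show ?thesis
    by (rule Bochner_Integration.integrable_bound)
      (use order.trans[OF norm_ge_zero B] B in \<open>auto simp: norm_mult mult_left_mono abs_mult\<close>)
qed

lemma profile_repr: "profile U \<Longrightarrow> U j x = (\<integral>z. kernel j z * neighbours U j (x - z) \<partial>lborel)"
  by (simp add: profile_def)

lemma neighbours_linear:
  "neighbours (U + V) j x = neighbours U j x + neighbours V j x"
  "neighbours (- U) j x = - neighbours U j x"
  by (auto simp: neighbours_def algebra_simps)

lemma profile_add:
  assumes "profile U" "profile V" shows "profile (U + V)"
  unfolding profile_def
proof (intro conjI allI)
  fix j x
  show "(U + V) j \<in> borel_measurable borel" using assms[THEN profile_measurable, of j] by (simp add: plus_fun_def)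
  have "bounded (range (U j))" "bounded (range (V j))" using assms by (auto simp: profile_def)
  then have "bounded ((\<lambda>(x, y). x + y) ` (range (U j) \<times> range (V j)))" by (intro bounded_plus)
  then show "bounded (range ((U + V) j))" by (rule bounded_subset) auto
  show "(U + V) j x = (\<integral>z. kernel j z * neighbours (U + V) j (x - z) \<partial>lborel)"
    unfolding neighbours_linear distrib_left using profile_integrable[OF assms(1)] profile_integrable[OF assms(2)]
    by (simp add: profile_repr[OF assms(1), symmetric] profile_repr[OF assms(2), symmetric])
qed

lemma profile_uminus:
  assumes "profile U" shows "profile (- U)"
  unfolding profile_def
proof (intro conjI allI)
  fix j x
  show "(- U) j \<in> borel_measurable borel" using profile_measurable[OF assms, of j] by (simp add: fun_Compl_def)
  have "bounded (range (U j))" using assms by (auto simp: profile_def)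
  then show "bounded (range ((- U) j))" by (simp add: bounded_iff)
  show "(- U) j x = (\<integral>z. kernel j z * neighbours (- U) j (x - z) \<partial>lborel)"
    unfolding neighbours_linear by (simp add: profile_repr[OF assms, symmetric])
qed

lemma profile_diff: "profile U \<Longrightarrow> profile V \<Longrightarrow> profile (U - V)"
  using profile_add[of U "- V"] profile_uminus[of V] by simp

lemma profile_zero: "profile 0"
  by (auto simp: profile_def neighbours_def zero_fun_def bounded_iff)

lemma neighbours_translate: "neighbours (translate h U) j x = neighbours U j (x - h)"
  by (simp add: neighbours_def translate_def)

lemma profile_translate:
  assumes "profile U" shows "profile (translate h U)"
  unfolding profile_def
proof (intro conjI allI)
  fix j x
  note [measurable] = profile_measurable[OF assms]
  show "translate h U j \<in> borel_measurable borel" unfolding translate_def[abs_def] by measurable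
  have "bounded (range (U j))" using assms by (auto simp: profile_def)
  then show "bounded (range (translate h U j))" by (rule bounded_subset) (auto simp: translate_def)
  show "translate h U j x = (\<integral>z. kernel j z * neighbours (translate h U) j (x - z) \<partial>lborel)"
    unfolding neighbours_translate translate_def by (subst profile_repr[OF assms]) (simp add: algebra_simps)
qed

text \<open>By the reproducing formula a translation of \<open>U j\<close> can be moved onto the kernel.\<close>

lemma profile_increment:
  obtains C where "0 \<le> C"
    "\<And>U j h p. profile U \<Longrightarrow> 1 \<le> p \<Longrightarrow> p < \<infinity> \<Longrightarrow>
      Lp_norm lborel p (\<lambda>x. ennreal (norm (U j (x - h) - U j x))) \<le>
      ennreal (C * min 1 (2 ^ j * norm h)) * Lp_norm lborel p (\<lambda>x. ennreal (norm (neighbours U j x)))"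
proof -
  obtain C where C: "0 \<le> C"
    "\<And>j h. (\<integral>\<^sup>+ x. ennreal (norm (kernel j (x - h) - kernel j x)) \<partial>lborel) \<le> ennreal (C * min 1 (2 ^ j * norm h))"
    by (rule kernel_L1_increment) blast
  have "Lp_norm lborel p (\<lambda>x. ennreal (norm (U j (x - h) - U j x))) \<le>
      ennreal (C * min 1 (2 ^ j * norm h)) * Lp_norm lborel p (\<lambda>x. ennreal (norm (neighbours U j x)))"
    if U: "profile U" and p: "1 \<le> p" "p < \<infinity>" for U j h p
  proof -
    note [measurable] = neighbours_measurable[OF U]
    let ?k = "\<lambda>z. kernel j (z - h) - kernel j z"
    have "ennreal (norm (U j (x - h) - U j x)) \<le> (\<integral>\<^sup>+ z. ennreal (norm (?k z)) * ennreal (norm (neighbours U j (x - z))) \<partial>lborel)" for x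
    proof -
      have shift: "(\<integral>z. kernel j (z - h) * neighbours U j (x - z) \<partial>lborel) = U j (x - h)"
      proof -
        have "x - h - (z + - h) = x - z" for z by simp
        with lborel_integral_translate[of "\<lambda>z. kernel j z * neighbours U j (x - h - z)" "- h"]
        have "(\<integral>z. kernel j (z - h) * neighbours U j (x - z) \<partial>lborel) = (\<integral>z. kernel j z * neighbours U j (x - h - z) \<partial>lborel)"
          by simp
        then show ?thesis by (simp only: profile_repr[OF U, of j "x - h"])
      qed
      have "integrable lborel (\<lambda>z. kernel j (z + - h) * neighbours U j (x - h - (z + - h)))"
        by (rule integrable_lborel_translate[OF profile_integrable[OF U]])
      then have i: "integrable lborel (\<lambda>z. kernel j (z - h) * neighbours U j (x - z))" by (simp add: algebra_simps)
      have "U j (x - h) - U j x = (\<integral>z. ?k z * neighbours U j (x - z) \<partial>lborel)"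
        unfolding shift[symmetric] profile_repr[OF U, of j x] left_diff_distrib
        by (rule Bochner_Integration.integral_diff[symmetric, OF i profile_integrable[OF U]])
      moreover have "integrable lborel (\<lambda>z. ?k z * neighbours U j (x - z))"
        unfolding left_diff_distrib by (intro Bochner_Integration.integrable_diff i profile_integrable U)
      ultimately have "ennreal (norm (U j (x - h) - U j x)) \<le> (\<integral>\<^sup>+ z. ennreal (norm (?k z * neighbours U j (x - z))) \<partial>lborel)"
        by (simp only:) (rule integral_norm_bound_ennreal)
      then show ?thesis by (simp add: norm_mult ennreal_mult)
    qed
    then have "Lp_norm lborel p (\<lambda>x. ennreal (norm (U j (x - h) - U j x))) \<le>
      Lp_norm lborel p (\<lambda>x. \<integral>\<^sup>+ z. ennreal (norm (?k z)) * ennreal (norm (neighbours U j (x - z))) \<partial>lborel)"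
      by (intro Lp_norm_mono p)
    also have "\<dots> \<le> (\<integral>\<^sup>+ x. ennreal (norm (?k x)) \<partial>lborel) * Lp_norm lborel p (\<lambda>x. ennreal (norm (neighbours U j x)))"
      by (intro Lp_norm_convolution_le p) (auto intro: le_less_trans[OF C(2)])
    also have "\<dots> \<le> ennreal (C * min 1 (2 ^ j * norm h)) * Lp_norm lborel p (\<lambda>x. ennreal (norm (neighbours U j x)))"
      by (intro mult_right_mono C) simp
    finally show ?thesis .
  qed
  then show ?thesis using C(1) that by blast
qed

lemma Lp_norm_neighbours:
  assumes p: "1 \<le> p" "p < \<infinity>" and U: "profile U"
  defines "L \<equiv> \<lambda>i. Lp_norm lborel p (\<lambda>x. ennreal (norm (U i x)))"
  shows "Lp_norm lborel p (\<lambda>x. ennreal (norm (neighbours U j x))) \<le> (if j = 0 then 0 else L (j - 1)) + L j + L (Suc j)"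
proof -
  note [measurable] = profile_measurable[OF U]
  let ?n = "\<lambda>i x. ennreal (norm (U i x))"
  let ?m = "\<lambda>x. if j = 0 then 0 else ?n (j - 1) x"
  have m[measurable]: "?m \<in> borel_measurable borel" by (cases j) auto
  have m_eq: "Lp_norm lborel p ?m = (if j = 0 then 0 else L (j - 1))"
    by (simp add: L_def Lp_norm_zero[OF p])
  have "Lp_norm lborel p (\<lambda>x. ennreal (norm (neighbours U j x))) \<le> Lp_norm lborel p (\<lambda>x. (?m x + ?n j x) + ?n (Suc j) x)"
  proof (intro Lp_norm_mono p)
    fix x
    have "norm (neighbours U j x) \<le> norm (if j = 0 then 0 else U (j - 1) x) + norm (U j x) + norm (U (Suc j) x)"
      unfolding neighbours_def by (intro norm_triangle_mono norm_triangle_ineq order_refl)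
    then have "ennreal (norm (neighbours U j x)) \<le> ennreal (norm (if j = 0 then 0 else U (j - 1) x) + norm (U j x) + norm (U (Suc j) x))"
      by (rule ennreal_leI)
    then show "ennreal (norm (neighbours U j x)) \<le> (?m x + ?n j x) + ?n (Suc j) x"
      by (cases j) auto
  qed
  also have "\<dots> \<le> (Lp_norm lborel p ?m + L j) + L (Suc j)"
    unfolding L_def
    by (intro order_trans[OF Lp_norm_triangle] add_mono Lp_norm_triangle p order_refl) measurable
  finally show ?thesis unfolding m_eq .
qed

text \<open>Block j of the increment is bounded by the power \<gamma> of
  \<open>2 ^ j * norm h\<close>, and the growth in j is absorbed by lowering the regularity by
  \<gamma>. The factors \<open>2 powr s\<close>, 1 and \<open>2 powr (- s)\<close> are the cost of
  evaluating the weight at the index of a neighbouring block.\<close>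

lemma profile_norm_increment:
  obtains C where "0 \<le> C"
    "\<And>U s \<gamma> h p q. profile U \<Longrightarrow> 1 \<le> p \<Longrightarrow> p < \<infinity> \<Longrightarrow> 1 \<le> q \<Longrightarrow> 0 \<le> \<gamma> \<Longrightarrow> \<gamma> \<le> 1 \<Longrightarrow>
      profile_norm (s - \<gamma>) p q (translate h U - U) \<le>
      ennreal (C * (2 powr s + 1 + 2 powr (- s)) * norm h powr \<gamma>) * profile_norm s p q U"
proof -
  obtain C where C: "0 \<le> C"
    "\<And>U j h p. profile U \<Longrightarrow> 1 \<le> p \<Longrightarrow> p < \<infinity> \<Longrightarrow>
      Lp_norm lborel p (\<lambda>x. ennreal (norm (U j (x - h) - U j x))) \<le>
      ennreal (C * min 1 (2 ^ j * norm h)) * Lp_norm lborel p (\<lambda>x. ennreal (norm (neighbours U j x)))"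
    by (rule profile_increment) blast
  have "profile_norm (s - \<gamma>) p q (translate h U - U) \<le>
      ennreal (C * (2 powr s + 1 + 2 powr (- s)) * norm h powr \<gamma>) * profile_norm s p q U"
    if U: "profile U" and p: "1 \<le> p" "p < \<infinity>" and q: "1 \<le> q" and \<gamma>: "0 \<le> \<gamma>" "\<gamma> \<le> 1" for U s \<gamma> h p q
  proof -
    define L where "L j = Lp_norm lborel p (\<lambda>x. ennreal (norm (U j x)))" for j
    define a where "a j = ennreal (2 powr (s * real j)) * L j" for j
    \<comment> \<open>The weighted left neighbour, zero at the lowest frequency, as in
      \<open>neighbours\<close>.\<close>
    define a' where "a' j = (if j = 0 then 0 else a (j - 1))" for j
    let ?c = "ennreal (C * norm h powr \<gamma>)"
    have "ennreal (2 powr ((s - \<gamma>) * real j)) * Lp_norm lborel p (\<lambda>x. ennreal (norm ((translate h U - U) j x))) \<le>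
      ?c * (ennreal (2 powr s) * a' j + a j + ennreal (2 powr (- s)) * a (Suc j))" for j
    proof -
      \<comment> \<open>Interpolation between the constant and the linear bound; here the range of
        \<gamma> between 0 and 1 enters.\<close>
      have minp: "min 1 t \<le> t powr \<gamma>" if "0 \<le> t" for t :: real
      proof (cases "t \<le> 1")
        case True
        then show ?thesis using powr_mono'[of \<gamma> 1 t] \<gamma> that by auto
      next
        case False
        then show ?thesis using \<gamma> by (simp add: ge_one_powr_ge_zero)
      qed
      have "Lp_norm lborel p (\<lambda>x. ennreal (norm ((translate h U - U) j x))) \<le>
        ennreal (C * min 1 (2 ^ j * norm h)) * Lp_norm lborel p (\<lambda>x. ennreal (norm (neighbours U j x)))"
        using C(2)[OF U p, of j h] by (simp add: translate_def)
      also have "\<dots> \<le> ennreal (C * (2 ^ j * norm h) powr \<gamma>) * ((if j = 0 then 0 else L (j - 1)) + L j + L (Suc j))"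
        using C(1) minp unfolding L_def
        by (intro mult_mono ennreal_leI mult_left_mono Lp_norm_neighbours p U) auto
      finally have "ennreal (2 powr ((s - \<gamma>) * real j)) * Lp_norm lborel p (\<lambda>x. ennreal (norm ((translate h U - U) j x))) \<le>
        ennreal (2 powr ((s - \<gamma>) * real j)) * (ennreal (C * (2 ^ j * norm h) powr \<gamma>) * ((if j = 0 then 0 else L (j - 1)) + L j + L (Suc j)))"
        by (intro mult_left_mono) auto
      also have "\<dots> = ennreal (2 powr ((s - \<gamma>) * real j) * (C * (2 ^ j * norm h) powr \<gamma>)) * ((if j = 0 then 0 else L (j - 1)) + L j + L (Suc j))"
        using C(1) by (simp add: mult.assoc[symmetric] ennreal_mult[symmetric])
      also have "2 powr ((s - \<gamma>) * real j) * (C * (2 ^ j * norm h) powr \<gamma>) = C * norm h powr \<gamma> * 2 powr (s * real j)"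
      proof -
        have "(2::real) ^ j = 2 powr real j" by (rule powr_realpow[symmetric]) simp
        then have "((2::real) ^ j) powr \<gamma> = 2 powr (real j * \<gamma>)" by (simp only: powr_powr)
        then have eq: "(2 ^ j * norm h) powr \<gamma> = 2 powr (real j * \<gamma>) * norm h powr \<gamma>"
          by (simp only: powr_mult)
        have "u * (C * (v * w)) = C * w * (u * v)" for u v w :: real by simp
        then have "2 powr ((s - \<gamma>) * real j) * (C * (2 ^ j * norm h) powr \<gamma>) =
          C * norm h powr \<gamma> * (2 powr ((s - \<gamma>) * real j) * 2 powr (real j * \<gamma>))"
          unfolding eq .
        also have "2 powr ((s - \<gamma>) * real j) * 2 powr (real j * \<gamma>) = 2 powr (s * real j)"
        proof -
          have "(s - \<gamma>) * real j + real j * \<gamma> = s * real j" by (simp add: algebra_simps)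
          then show ?thesis by (simp only: powr_add[symmetric])
        qed
        finally show ?thesis .
      qed
      also have "ennreal (C * norm h powr \<gamma> * 2 powr (s * real j)) * ((if j = 0 then 0 else L (j - 1)) + L j + L (Suc j)) =
        ?c * (ennreal (2 powr (s * real j)) * (if j = 0 then 0 else L (j - 1)) + ennreal (2 powr (s * real j)) * L j + ennreal (2 powr (s * real j)) * L (Suc j))"
        using C(1) by (simp add: ennreal_mult distrib_left mult.assoc)
      also have "ennreal (2 powr (s * real j)) * (if j = 0 then 0 else L (j - 1)) = ennreal (2 powr s) * a' j"
      proof (cases j)
        case (Suc i)
        have "s * real (Suc i) = s + s * real i" by (simp add: algebra_simps)
        then have "ennreal (2 powr (s * real (Suc i))) = ennreal (2 powr s) * ennreal (2 powr (s * real i))"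
          by (simp only: powr_add ennreal_mult powr_ge_zero)
        then show ?thesis using Suc by (simp add: a'_def a_def mult.assoc)
      qed (simp add: a'_def)
      also have "ennreal (2 powr (s * real j)) * L j = a j" by (simp add: a_def)
      also have "ennreal (2 powr (s * real j)) * L (Suc j) = ennreal (2 powr (- s)) * a (Suc j)"
      proof -
        have "s * real j = - s + s * real (Suc j)" by (simp add: algebra_simps)
        then have "ennreal (2 powr (s * real j)) = ennreal (2 powr (- s)) * ennreal (2 powr (s * real (Suc j)))"
          by (simp only: powr_add ennreal_mult powr_ge_zero)
        then show ?thesis unfolding a_def by (simp only: mult.assoc)
      qed
      finally show ?thesis .
    qed
    then have "profile_norm (s - \<gamma>) p q (translate h U - U) \<le> Lp_norm (count_space UNIV) q
        (\<lambda>j. ?c * (ennreal (2 powr s) * a' j + a j + ennreal (2 powr (- s)) * a (Suc j)))"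
      unfolding profile_norm_def by (intro seq_norm_mono q)
    also have "\<dots> = ?c * Lp_norm (count_space UNIV) q (\<lambda>j. ennreal (2 powr s) * a' j + a j + ennreal (2 powr (- s)) * a (Suc j))"
      by (rule seq_norm_cmult[OF q])
    also have "Lp_norm (count_space UNIV) q (\<lambda>j. ennreal (2 powr s) * a' j + a j + ennreal (2 powr (- s)) * a (Suc j)) \<le>
      Lp_norm (count_space UNIV) q (\<lambda>j. ennreal (2 powr s) * a' j) + Lp_norm (count_space UNIV) q a +
        Lp_norm (count_space UNIV) q (\<lambda>j. ennreal (2 powr (- s)) * a (Suc j))"
      by (intro order_trans[OF seq_norm_triangle] add_mono seq_norm_triangle q order_refl)
    also have "\<dots> \<le> ennreal (2 powr s) * Lp_norm (count_space UNIV) q a + Lp_norm (count_space UNIV) q a +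
        ennreal (2 powr (- s)) * Lp_norm (count_space UNIV) q a"
      unfolding seq_norm_cmult[OF q] a'_def
      by (intro add_mono mult_left_mono seq_norm_pred_le seq_norm_Suc_le q order_refl) auto
    also have "\<dots> = ennreal (2 powr s + 1 + 2 powr (- s)) * profile_norm s p q U"
      by (simp add: a_def[abs_def] L_def profile_norm_def distrib_right)
    also have "?c * (ennreal (2 powr s + 1 + 2 powr (- s)) * profile_norm s p q U) =
      ennreal (C * (2 powr s + 1 + 2 powr (- s)) * norm h powr \<gamma>) * profile_norm s p q U"
    proof -
      have "C * (2 powr s + 1 + 2 powr (- s)) * norm h powr \<gamma> = (C * norm h powr \<gamma>) * (2 powr s + 1 + 2 powr (- s))"
        by (simp only: mult_ac)
      then have "ennreal (C * (2 powr s + 1 + 2 powr (- s)) * norm h powr \<gamma>) = ?c * ennreal (2 powr s + 1 + 2 powr (- s))"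
        using C(1) by (simp only: ennreal_mult mult_nonneg_nonneg add_nonneg_nonneg powr_ge_zero zero_le_one)
      then show ?thesis by (simp only: mult.assoc)
    qed
    finally show ?thesis by (simp only: mult_left_mono zero_le)
  qed
  then show ?thesis using C(1) that by blast
qed

lemma extended_seminorm_profile:
  assumes "1 \<le> p" "p < \<infinity>" "1 \<le> q"
  shows "extended_seminorm (Collect profile) (profile_norm s p q)"
  using assms
  by unfold_locales (auto intro: profile_add profile_uminus profile_zero profile_norm_triangle profile_measurable
      simp: profile_norm_uminus profile_norm_zero)

end

section \<open>Occupation measures\<close>

lemma finite_lebesgue_on_Icc: "finite_measure (lebesgue_on {s..t::real})"
  by (rule finite_measure_lebesgue_on) simp

lemma measurable_lebesgue_on_Icc_subset:
  fixes f :: "real \<Rightarrow> 'b::topological_space"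
  shows "f \<in> borel_measurable (lebesgue_on {a..b}) \<Longrightarrow> a \<le> s \<Longrightarrow> t \<le> b \<Longrightarrow> f \<in> borel_measurable (lebesgue_on {s..t})"
  by (rule measurable_restrict_mono) auto

lemma indicator_measurable_lebesgue_on [measurable]:
  "(indicator {u..<v::real} :: real \<Rightarrow> real) \<in> borel_measurable (lebesgue_on S)"
  by (intro measurable_restrict_space1 measurable_completion) simp

text \<open>Half-open cells are disjoint and can be summed inside one integral, whereas occupation
  measures are taken over closed intervals. The difference is the single point v.\<close>

lemma integral_lebesgue_on_subinterval:
  fixes h :: "real \<Rightarrow> complex"
  assumes uv: "s \<le> u" "v \<le> t" and h: "h \<in> borel_measurable (lebesgue_on {s..t})"
  shows "(\<integral>x. indicator {u..<v} x *\<^sub>R h x \<partial>lebesgue_on {s..t}) = (\<integral>x. h x \<partial>lebesgue_on {u..v})"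
proof -
  have "{v} \<in> null_sets lebesgue" by (simp flip: negligible_iff_null_sets)
  from AE_not_in[OF this]
  have AE: "AE x in lebesgue. indicator {s..t} x *\<^sub>R (indicator {u..<v} x *\<^sub>R h x) = indicator {u..v} x *\<^sub>R h x"
    by eventually_elim (use uv in \<open>auto simp: indicator_def\<close>)
  have "(\<lambda>x. indicator {u..<v} x *\<^sub>R h x) \<in> borel_measurable (lebesgue_on {s..t})"
    using h by measurable
  then have 1: "(\<lambda>x. indicator {s..t} x *\<^sub>R (indicator {u..<v} x *\<^sub>R h x)) \<in> borel_measurable lebesgue"
    by (subst (asm) borel_measurable_restrict_space_iff) auto
  have "h \<in> borel_measurable (lebesgue_on {u..v})" using h uv by (rule measurable_lebesgue_on_Icc_subset)
  then have 2: "(\<lambda>x. indicator {u..v} x *\<^sub>R h x) \<in> borel_measurable lebesgue"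
    by (subst (asm) borel_measurable_restrict_space_iff) auto
  show ?thesis
    using integral_cong_AE[OF 1 2 AE] by (simp add: integral_restrict_space)
qed

lemma partition_cell:
  assumes \<pi>: "(n, \<pi>) \<in> partitions s t" and \<tau>: "s \<le> \<tau>" "\<tau> < t"
  obtains k where "k < n" "\<pi> k \<le> \<tau>" "\<tau> < \<pi> (Suc k)"
proof -
  have "\<exists>k<n. \<pi> k \<le> \<tau> \<and> \<tau> < \<pi> (Suc k)"
  proof (rule ccontr)
    assume *: "\<not> ?thesis"
    have "i \<le> n \<Longrightarrow> \<pi> i \<le> \<tau>" for i
    proof (induction i)
      case 0
      then show ?case using \<pi> \<tau> by (simp add: partitions_def)
    next
      case (Suc i)
      then show ?case using * by (meson Suc_le_eq less_imp_le not_le)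
    qed
    then have "\<pi> n \<le> \<tau>" by simp
    then show False using \<pi> \<tau> by (simp add: partitions_def)
  qed
  then show ?thesis using that by blast
qed

lemma sum_indicator_cells:
  fixes g :: "nat \<Rightarrow> 'b::real_vector"
  assumes \<pi>: "(n, \<pi>) \<in> partitions s t" and k: "k < n" "\<pi> k \<le> \<tau>" "\<tau> < \<pi> (Suc k)"
  shows "(\<Sum>i<n. indicator {\<pi> i..<\<pi> (Suc i)} \<tau> *\<^sub>R g i) = g k"
proof -
  have "indicator {\<pi> i..<\<pi> (Suc i)} \<tau> *\<^sub>R g i = (if i = k then g k else 0)" if "i < n" for i
  proof -
    consider "i < k" | "i = k" | "k < i" by linarith
    then show ?thesis
    proof cases
      case 1
      then have "\<pi> (Suc i) \<le> \<tau>" using partitions_mono[OF \<pi>, of "Suc i" k] k by auto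
      then show ?thesis using 1 by (simp add: indicator_def)
    next
      case 3
      then have "\<tau> < \<pi> i" using partitions_mono[OF \<pi>, of "Suc k" i] k that by auto
      then show ?thesis using 3 by (simp add: indicator_def)
    qed (use k in simp)
  qed
  then have "(\<Sum>i<n. indicator {\<pi> i..<\<pi> (Suc i)} \<tau> *\<^sub>R g i) = (\<Sum>i<n. if i = k then g k else 0)"
    by (intro sum.cong) auto
  then show ?thesis using k by simp
qed

lemma sum_fun_apply: "(\<Sum>i\<in>I. g i) x = (\<Sum>i\<in>I. g i x)"
  by (induction I rule: infinite_finite_induct) auto

text \<open>Select a point of D in each cell of a uniform grid of step \<open>\<delta>\<close>;
  consecutive choices are less than two steps apart. The right end t is a partition point whether or
  not it lies in D.\<close>

lemma exists_partition_in_dense: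
  fixes D :: "real set"
  assumes D: "\<And>u v. s \<le> u \<Longrightarrow> u < v \<Longrightarrow> v \<le> t \<Longrightarrow> \<exists>x\<in>D. u < x \<and> x < v" and s: "s \<in> D" and st: "s < t"
  obtains \<pi> where "(Suc n, \<pi>) \<in> partitions s t" "\<And>i. i \<le> n \<Longrightarrow> \<pi> i \<in> D"
    "\<And>i. i \<le> n \<Longrightarrow> \<pi> (Suc i) - \<pi> i \<le> 2 * (t - s) / real (Suc n)"
proof -
  define \<delta> where "\<delta> = (t - s) / real (Suc n)"
  have \<delta>: "0 < \<delta>" using st by (simp add: \<delta>_def)
  have t: "t = s + real (Suc n) * \<delta>" by (simp add: \<delta>_def)
  have "\<exists>x\<in>D. s + real i * \<delta> < x \<and> x < s + real (Suc i) * \<delta>" if "i \<le> n" for i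
  proof (rule D)
    show "s + real i * \<delta> < s + real (Suc i) * \<delta>" using \<delta> by simp
    show "s + real (Suc i) * \<delta> \<le> t" unfolding t using \<delta> that by simp
  qed (use \<delta> in simp)
  then obtain x where x: "\<And>i. i \<le> n \<Longrightarrow> x i \<in> D" "\<And>i. i \<le> n \<Longrightarrow> s + real i * \<delta> < x i"
    "\<And>i. i \<le> n \<Longrightarrow> x i < s + real (Suc i) * \<delta>" by metis
  \<comment> \<open>The index is shifted by one because \<open>x (i - 1)\<close> lies in the cell
    that ends at \<open>s + real i * \<delta>\<close>.\<close>
  define \<pi> where "\<pi> i = (if i = 0 then s else if i \<le> n then x (i - 1) else t)" for i
  have bounds: "s + (real i - 1) * \<delta> \<le> \<pi> i" "\<pi> i \<le> s + real i * \<delta>" if "i \<le> Suc n" for i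
  proof -
    have "s + (real i - 1) * \<delta> \<le> \<pi> i \<and> \<pi> i \<le> s + real i * \<delta>"
    proof (cases i)
      case 0
      then show ?thesis using \<delta> by (simp add: \<pi>_def)
    next
      case (Suc m)
      show ?thesis
      proof (cases "i \<le> n")
        case True
        then show ?thesis using x(2)[of m] x(3)[of m] Suc by (simp add: \<pi>_def)
      next
        case False
        then have "i = Suc n" using that by simp
        then show ?thesis using \<delta> by (simp add: \<pi>_def t algebra_simps)
      qed
    qed
    then show "s + (real i - 1) * \<delta> \<le> \<pi> i" "\<pi> i \<le> s + real i * \<delta>" by auto
  qed
  have less: "\<pi> i < \<pi> (Suc i)" if i: "i \<le> n" for i
  proof (cases "Suc i \<le> n")
    case True
    then have "s + real i * \<delta> < \<pi> (Suc i)" using x(2)[of i] by (simp add: \<pi>_def)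
    then show ?thesis using bounds(2)[of i] i by linarith
  next
    case False
    then have i: "i = n" using i by simp
    show ?thesis
    proof (cases n)
      case (Suc m)
      then show ?thesis using x(3)[of m] \<delta> unfolding i by (simp add: \<pi>_def t algebra_simps)
    qed (use i st in \<open>simp add: \<pi>_def\<close>)
  qed
  have "(Suc n, \<pi>) \<in> partitions s t" using less by (auto simp: partitions_def \<pi>_def)
  moreover have "\<pi> i \<in> D" if "i \<le> n" for i using that x(1)[of "i - 1"] s by (auto simp: \<pi>_def)
  moreover have "\<pi> (Suc i) - \<pi> i \<le> 2 * (t - s) / real (Suc n)" if "i \<le> n" for i
  proof -
    have "\<pi> (Suc i) - \<pi> i \<le> 2 * \<delta>"
      using bounds(2)[of "Suc i"] bounds(1)[of i] that by (simp add: algebra_simps)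
    then show ?thesis by (simp add: \<delta>_def)
  qed
  ultimately show ?thesis using that by blast
qed

context littlewood_paley
begin

definition occ :: "(real \<Rightarrow> 'a) \<Rightarrow> real \<Rightarrow> real \<Rightarrow> nat \<Rightarrow> 'a \<Rightarrow> complex" where
  "occ \<omega> s t j x = (\<integral>\<tau>. kernel j (x - \<omega> \<tau>) \<partial>lebesgue_on {s..t})"

section \<open>Blocks of the occupation measure\<close>

lemma occ_integrable:
  fixes \<omega> :: "real \<Rightarrow> 'a"
  assumes "\<omega> \<in> borel_measurable (lebesgue_on {s..t})"
  shows "integrable (lebesgue_on {s..t}) (\<lambda>\<tau>. kernel j (x - \<omega> \<tau>))"
proof -
  interpret finite_measure "lebesgue_on {s..t}" by (rule finite_lebesgue_on_Icc)
  obtain B where B: "0 \<le> B" "\<And>x. norm (kernel j x) \<le> B" by (rule kernel_bounded) blast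
  note [measurable] = assms
  show ?thesis by (rule integrable_const_bound[of _ B]) (use B in auto)
qed

lemma LP_block_occupation_flow:
  fixes \<omega> :: "real \<Rightarrow> 'a"
  assumes [measurable]: "\<omega> \<in> borel_measurable (lebesgue_on {a..t})"
  shows "LP_block \<phi> j (occupation_flow \<omega> a t) = occ \<omega> a t j"
proof
  fix x
  show "LP_block \<phi> j (occupation_flow \<omega> a t) x = occ \<omega> a t j x"
    unfolding LP_block_def occupation_flow_def distribution_of_def occupation_measure_def occ_def kernel_def[symmetric]
    by (rule integral_distr) auto
qed

lemma occ_add:
  fixes \<omega> :: "real \<Rightarrow> 'a"
  assumes "s \<le> u" "u \<le> t" and \<omega>: "\<omega> \<in> borel_measurable (lebesgue_on {s..t})"
  shows "occ \<omega> s t = occ \<omega> s u + occ \<omega> u t"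
proof (intro ext)
  fix j x
  let ?h = "\<lambda>\<tau>. kernel j (x - \<omega> \<tau>)"
  have i: "integrable (lebesgue_on {s..t}) (\<lambda>\<tau>. indicator {p..<q} \<tau> *\<^sub>R ?h \<tau>)" for p q
  proof (rule Bochner_Integration.integrable_bound[OF occ_integrable[OF \<omega>, of j x]])
    show "(\<lambda>\<tau>. indicator {p..<q} \<tau> *\<^sub>R ?h \<tau>) \<in> borel_measurable (lebesgue_on {s..t})"
      using borel_measurable_integrable[OF occ_integrable[OF \<omega>, of j x]] by measurable
  qed (auto simp: indicator_def)
  note h = borel_measurable_integrable[OF occ_integrable[OF \<omega>, of j x]]
  have "occ \<omega> s t j x = (\<integral>\<tau>. indicator {s..<t} \<tau> *\<^sub>R ?h \<tau> \<partial>lebesgue_on {s..t})"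
    unfolding occ_def by (subst integral_lebesgue_on_subinterval) (auto intro: h)
  also have "\<dots> = (\<integral>\<tau>. indicator {s..<u} \<tau> *\<^sub>R ?h \<tau> + indicator {u..<t} \<tau> *\<^sub>R ?h \<tau> \<partial>lebesgue_on {s..t})"
    using assms(1,2) by (intro Bochner_Integration.integral_cong refl) (auto simp: indicator_def)
  also have "\<dots> = (\<integral>\<tau>. indicator {s..<u} \<tau> *\<^sub>R ?h \<tau> \<partial>lebesgue_on {s..t}) + (\<integral>\<tau>. indicator {u..<t} \<tau> *\<^sub>R ?h \<tau> \<partial>lebesgue_on {s..t})"
    by (intro Bochner_Integration.integral_add i)
  also have "\<dots> = (occ \<omega> s u + occ \<omega> u t) j x"
    using assms(1,2) by (simp add: occ_def integral_lebesgue_on_subinterval h)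
  finally show "occ \<omega> s t j x = (occ \<omega> s u + occ \<omega> u t) j x" .
qed

lemma occ_bound:
  fixes \<omega> :: "real \<Rightarrow> 'a"
  assumes \<omega>: "\<omega> \<in> borel_measurable (lebesgue_on {s..t})" and "s \<le> t" and B: "\<And>x. norm (kernel j x) \<le> B"
  shows "norm (occ \<omega> s t j x) \<le> (t - s) * B"
proof -
  interpret finite_measure "lebesgue_on {s..t}" by (rule finite_lebesgue_on_Icc)
  have "norm (occ \<omega> s t j x) \<le> (\<integral>\<tau>. B \<partial>lebesgue_on {s..t})"
    unfolding occ_def by (intro Bochner_Integration.integral_norm_bound_integral occ_integrable \<omega> B) auto
  then show ?thesis using assms(2) by (simp add: measure_restrict_space)
qed

text \<open>The reproducing formula of the kernel, integrated along the path. Fubini applies because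
  the kernel is integrable, its neighbours are bounded, and the time interval has finite
  length.\<close>

lemma profile_occ:
  fixes \<omega> :: "real \<Rightarrow> 'a"
  assumes [measurable]: "\<omega> \<in> borel_measurable (lebesgue_on {s..t})" and st: "s \<le> t"
  shows "profile (occ \<omega> s t)"
  unfolding profile_def
proof (intro conjI allI)
  let ?M = "lebesgue_on {s..t}"
  interpret finite_measure ?M by (rule finite_lebesgue_on_Icc)
  interpret P: pair_sigma_finite "lborel :: 'a measure" ?M ..
  fix j x
  show "occ \<omega> s t j \<in> borel_measurable borel"
    unfolding occ_def[abs_def] by measurable
  obtain B where B: "0 \<le> B" "\<And>x. norm (kernel j x) \<le> B" by (rule kernel_bounded) blast
  have "norm (occ \<omega> s t j x) \<le> (t - s) * B" for x by (intro occ_bound assms B)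
  then show "bounded (range (occ \<omega> s t j))" by (auto simp: bounded_iff)
  have neigh: "neighbours (occ \<omega> s t) j y = (\<integral>\<tau>. neighbours kernel j (y - \<omega> \<tau>) \<partial>?M)" for y
    unfolding neighbours_def occ_def using occ_integrable[OF assms(1)] by (cases j) simp_all
  have "\<exists>B\<ge>0. \<forall>x. norm (kernel i x) \<le> B" for i by (rule kernel_bounded) blast
  then obtain B' where B': "\<And>i. 0 \<le> B' i" "\<And>i x. norm (kernel i x) \<le> B' i" by metis
  define D where "D = B' (j - 1) + B' j + B' (Suc j)"
  have D: "0 \<le> D" unfolding D_def by (intro add_nonneg_nonneg B')
  have nD: "norm (neighbours kernel j y) \<le> D" for y
  proof -
    have "norm (if j = 0 then 0 else kernel (j - 1) y) \<le> B' (j - 1)" using B' by auto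
    then show ?thesis unfolding neighbours_def D_def by (intro norm_triangle_mono norm_triangle_ineq B')
  qed
  let ?h = "\<lambda>(z, \<tau>). kernel j z * neighbours kernel j (x - \<omega> \<tau> - z)"
  have [measurable]: "neighbours kernel j \<in> borel_measurable borel"
    unfolding neighbours_def[abs_def] by (cases j) simp_all
  have int: "integrable (lborel \<Otimes>\<^sub>M ?M) ?h"
    by (rule P.integrable_product_bound[OF kernel_integrable[of j], of "\<lambda>_. complex_of_real D"])
      (use D nD in \<open>auto simp: norm_mult mult_left_mono\<close>)
  have "(\<integral>z. kernel j z * neighbours (occ \<omega> s t) j (x - z) \<partial>lborel) = (\<integral>z. (\<integral>\<tau>. ?h (z, \<tau>) \<partial>?M) \<partial>lborel)"
    unfolding neigh by (simp add: algebra_simps)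
  also have "\<dots> = (\<integral>\<tau>. (\<integral>z. ?h (z, \<tau>) \<partial>lborel) \<partial>?M)"
    using P.Fubini_integral[of "\<lambda>z \<tau>. ?h (z, \<tau>)"] int by (simp add: split_beta')
  also have "\<dots> = occ \<omega> s t j x"
    unfolding occ_def by (simp add: kernel_reproducing)
  finally show "occ \<omega> s t j x = (\<integral>z. kernel j z * neighbours (occ \<omega> s t) j (x - z) \<partial>lborel)" ..
qed

lemma LP_block_diff: "(\<lambda>j. LP_block \<phi> j (u - v)) = (\<lambda>j. LP_block \<phi> j u) - (\<lambda>j. LP_block \<phi> j v)"
  by (simp add: fun_eq_iff LP_block_def)

lemma LP_block_occupation_increment:
  fixes \<omega> :: "real \<Rightarrow> 'a"
  assumes \<omega>: "\<omega> \<in> borel_measurable (lebesgue_on {a..t})" and st: "a \<le> s" "s \<le> t"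
  shows "(\<lambda>j. LP_block \<phi> j (occupation_flow \<omega> a t - occupation_flow \<omega> a s)) = occ \<omega> s t"
proof -
  have \<omega>': "\<omega> \<in> borel_measurable (lebesgue_on {a..s})" by (rule measurable_lebesgue_on_Icc_subset[OF \<omega>]) (use st in auto)
  have "(\<lambda>j. LP_block \<phi> j (occupation_flow \<omega> a t - occupation_flow \<omega> a s)) = occ \<omega> a t - occ \<omega> a s"
    unfolding LP_block_diff by (simp add: LP_block_occupation_flow[OF \<omega>] LP_block_occupation_flow[OF \<omega>'] fun_eq_iff)
  also have "\<dots> = occ \<omega> s t" using occ_add[OF st \<omega>] by simp
  finally show ?thesis .
qed

text \<open>A Riemann sum of germs is one integral in which the shift is frozen at the left end of
  each cell. The integrand converges at every continuity point of the shift and is dominated by a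
  bound on the kernel.\<close>

lemma germ_sum_tendsto:
  fixes \<omega> f :: "real \<Rightarrow> 'a"
  assumes \<omega>: "\<omega> \<in> borel_measurable (lebesgue_on {s..t})" and f: "f \<in> borel_measurable (lebesgue_on {s..t})"
    and cont: "countable {\<tau> \<in> {s..t}. \<not> continuous (at \<tau> within {s..t}) f}"
    and \<pi>: "\<And>n. (N n, \<pi> n) \<in> partitions s t" and mesh: "\<And>n i. i < N n \<Longrightarrow> \<pi> n (Suc i) - \<pi> n i \<le> e n" and e: "e \<longlonglongrightarrow> 0"
  shows "(\<lambda>n. (\<Sum>i<N n. translate (f (\<pi> n i)) (occ \<omega> (\<pi> n i) (\<pi> n (Suc i)))) j x) \<longlonglongrightarrow> occ (\<lambda>\<tau>. \<omega> \<tau> + f \<tau>) s t j x"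
proof -
  let ?M = "lebesgue_on {s..t}"
  interpret finite_measure ?M by (rule finite_lebesgue_on_Icc)
  note [measurable] = \<omega> f
  obtain B where B: "0 \<le> B" "\<And>x. norm (kernel j x) \<le> B" by (rule kernel_bounded) blast
  define F where "F n \<tau> = (\<Sum>i<N n. indicator {\<pi> n i..<\<pi> n (Suc i)} \<tau> *\<^sub>R kernel j (x - f (\<pi> n i) - \<omega> \<tau>))" for n \<tau>
  have Fm[measurable]: "F n \<in> borel_measurable ?M" for n unfolding F_def[abs_def] by measurable
  have cell: "\<exists>k<N n. \<pi> n k \<le> \<tau> \<and> \<tau> < \<pi> n (Suc k) \<and> F n \<tau> = kernel j (x - f (\<pi> n k) - \<omega> \<tau>)" if "s \<le> \<tau>" "\<tau> < t" for n \<tau>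
    by (rule partition_cell[OF \<pi>[of n] that])
      (use sum_indicator_cells[OF \<pi>[of n], where g = "\<lambda>i. kernel j (x - f (\<pi> n i) - \<omega> \<tau>)"] in \<open>auto simp: F_def\<close>)
  have sum_eq: "(\<Sum>i<N n. translate (f (\<pi> n i)) (occ \<omega> (\<pi> n i) (\<pi> n (Suc i)))) j x = (\<integral>\<tau>. F n \<tau> \<partial>?M)" for n
  proof -
    have i: "integrable ?M (\<lambda>\<tau>. indicator {\<pi> n i..<\<pi> n (Suc i)} \<tau> *\<^sub>R kernel j (x - f (\<pi> n i) - \<omega> \<tau>))" for i
      by (rule Bochner_Integration.integrable_bound[OF occ_integrable[OF \<omega>, of j "x - f (\<pi> n i)"]])
         (measurable, auto simp: indicator_def)
    have "(\<integral>\<tau>. F n \<tau> \<partial>?M) = (\<Sum>i<N n. \<integral>\<tau>. indicator {\<pi> n i..<\<pi> n (Suc i)} \<tau> *\<^sub>R kernel j (x - f (\<pi> n i) - \<omega> \<tau>) \<partial>?M)"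
      unfolding F_def by (intro Bochner_Integration.integral_sum i)
    also have "\<dots> = (\<Sum>i<N n. translate (f (\<pi> n i)) (occ \<omega> (\<pi> n i) (\<pi> n (Suc i))) j x)"
    proof (intro sum.cong refl)
      fix i assume "i \<in> {..<N n}"
      then have "s \<le> \<pi> n i" "\<pi> n (Suc i) \<le> t" using partitions_bounds[OF \<pi>[of n]] by auto
      then show "(\<integral>\<tau>. indicator {\<pi> n i..<\<pi> n (Suc i)} \<tau> *\<^sub>R kernel j (x - f (\<pi> n i) - \<omega> \<tau>) \<partial>?M) =
        translate (f (\<pi> n i)) (occ \<omega> (\<pi> n i) (\<pi> n (Suc i))) j x"
        unfolding translate_def occ_def by (rule integral_lebesgue_on_subinterval) measurable
    qed
    finally show ?thesis by (simp add: sum_fun_apply)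
  qed
  have "(\<lambda>n. \<integral>\<tau>. F n \<tau> \<partial>?M) \<longlonglongrightarrow> (\<integral>\<tau>. kernel j (x - (\<omega> \<tau> + f \<tau>)) \<partial>?M)"
  proof (rule integral_dominated_convergence[where w = "\<lambda>_. B"])
    \<comment> \<open>The end t joins the exceptional set because it belongs to no half-open
      cell.\<close>
    have "{\<tau> \<in> {s..t}. \<not> continuous (at \<tau> within {s..t}) f} \<union> {t} \<in> null_sets lebesgue"
      using cont by (intro null_sets_completionI countable_imp_null_set_lborel) auto
    from AE_not_in[OF this]
    have "AE \<tau> in lebesgue. \<tau> \<in> {s..t} \<longrightarrow> \<tau> \<in> {s..t} \<and> \<tau> \<noteq> t \<and> continuous (at \<tau> within {s..t}) f"
      by eventually_elim blast
    then have AE: "AE \<tau> in ?M. \<tau> \<in> {s..t} \<and> \<tau> \<noteq> t \<and> continuous (at \<tau> within {s..t}) f"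
      by (subst AE_restrict_space_iff) auto
    then show "AE \<tau> in ?M. (\<lambda>n. F n \<tau>) \<longlonglongrightarrow> kernel j (x - (\<omega> \<tau> + f \<tau>))"
    proof eventually_elim
      case (elim \<tau>)
      then have "s \<le> \<tau>" "\<tau> < t" by auto
      \<comment> \<open>The cell of the n-th partition that contains \<open>\<tau>\<close>; its left
        end is within \<open>e n\<close> of \<open>\<tau>\<close>.\<close>
      from cell[OF this] obtain k where k: "\<And>n. k n < N n" "\<And>n. \<pi> n (k n) \<le> \<tau>" "\<And>n. \<tau> < \<pi> n (Suc (k n))"
        "\<And>n. F n \<tau> = kernel j (x - f (\<pi> n (k n)) - \<omega> \<tau>)" by metis
      have "(\<lambda>n. \<pi> n (k n)) \<longlonglongrightarrow> \<tau>"
      proof (rule tendsto_sandwich[OF always_eventually always_eventually])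
        show "\<forall>n. \<tau> - e n \<le> \<pi> n (k n)" using mesh[OF k(1)] k(3) by (smt (verit))
        show "\<forall>n. \<pi> n (k n) \<le> \<tau>" using k by blast
        show "(\<lambda>n. \<tau> - e n) \<longlonglongrightarrow> \<tau>" using tendsto_diff[OF tendsto_const e, of \<tau>] by simp
      qed simp
      moreover have "\<forall>n. \<pi> n (k n) \<in> {s..t}"
        using partitions_bounds[OF \<pi>] k(1) less_imp_le by (metis atLeastAtMost_iff)
      ultimately have "(\<lambda>n. f (\<pi> n (k n))) \<longlonglongrightarrow> f \<tau>"
        using elim[THEN conjunct2, THEN conjunct2, unfolded continuous_within_sequentially comp_def, rule_format, of "\<lambda>n. \<pi> n (k n)"]
        by simp
      then have "(\<lambda>n. x - f (\<pi> n (k n)) - \<omega> \<tau>) \<longlonglongrightarrow> x - f \<tau> - \<omega> \<tau>" by (intro tendsto_intros)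
      moreover have "isCont (kernel j) (x - f \<tau> - \<omega> \<tau>)"
        using kernel_continuous[of j] by (simp add: continuous_on_eq_continuous_at)
      ultimately have "(\<lambda>n. kernel j (x - f (\<pi> n (k n)) - \<omega> \<tau>)) \<longlonglongrightarrow> kernel j (x - f \<tau> - \<omega> \<tau>)"
        by (rule isCont_tendsto_compose[rotated])
      moreover have "x - f \<tau> - \<omega> \<tau> = x - (\<omega> \<tau> + f \<tau>)" by (simp add: algebra_simps)
      ultimately show ?case unfolding k(4) by simp
    qed
    have nF: "norm (F n \<tau>) \<le> B" if "\<tau> \<in> {s..t}" "\<tau> \<noteq> t" for n \<tau>
      using cell[of \<tau> n] that B(2) by fastforce
    show "AE \<tau> in ?M. norm (F n \<tau>) \<le> B" for n
      using AE by eventually_elim (auto intro: nF)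
  qed auto
  then show ?thesis unfolding sum_eq by (simp add: occ_def)
qed

end

section \<open>The shifted occupation measure\<close>

text \<open>The p-th power of the variation norm over the interval from s to t, as a real number.
  The conversion is faithful inside any interval on which the path has finite variation.\<close>

definition variation_control :: "('e::minus \<Rightarrow> ennreal) \<Rightarrow> real \<Rightarrow> (real \<Rightarrow> 'e) \<Rightarrow> real \<Rightarrow> real \<Rightarrow> real" where
  "variation_control N p f s t = enn2real (var_sup (\<lambda>s t. ennreal_powr (N (f t - f s)) p) s t)"

lemma variation_control:
  assumes f: "f \<in> variation_space E N p a b" and p: "0 < p"
  shows control_on_variation_control: "control_on a b (variation_control N p f)"
    and variation_control_powr: "a \<le> s \<Longrightarrow> s \<le> t \<Longrightarrow> t \<le> b \<Longrightarrow>
      ennreal (variation_control N p f s t powr (1 / p)) =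
      ennreal_powr (var_sup (\<lambda>s t. ennreal_powr (N (f t - f s)) p) s t) (1 / p)"
    and variation_control_upper: "a \<le> s \<Longrightarrow> s < t \<Longrightarrow> t \<le> b \<Longrightarrow>
      N (f t - f s) \<le> ennreal (variation_control N p f s t powr (1 / p))"
proof -
  let ?M = "\<lambda>s t. ennreal_powr (N (f t - f s)) p"
  have fin: "var_sup ?M a b < \<top>"
    using f by (simp add: variation_space_def variation_norm_eq_var_sup)
  show "control_on a b (variation_control N p f)"
    unfolding variation_control_def[abs_def] by (rule control_on_var_sup[OF fin])
  show powr: "ennreal (variation_control N p f s t powr (1 / p)) = ennreal_powr (var_sup ?M s t) (1 / p)"
    if "a \<le> s" "s \<le> t" "t \<le> b" for s t
  proof -
    have "var_sup ?M s t < \<top>" using var_sup_mono[OF that, of ?M] fin by (rule order.strict_trans1)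
    then show ?thesis by (simp add: variation_control_def ennreal_powr_def)
  qed
  show "N (f t - f s) \<le> ennreal (variation_control N p f s t powr (1 / p))" if "a \<le> s" "s < t" "t \<le> b"
  proof -
    have "?M s t \<le> var_sup ?M s t" using that by (intro var_sup_ge)
    then show ?thesis using p that by (simp add: powr ennreal_powr_le_iff)
  qed
qed

lemma variation_control_norm_upper:
  fixes f :: "real \<Rightarrow> 'b::real_normed_vector"
  assumes f: "f \<in> variation_space UNIV vec_norm p a b" and p: "0 < p" and st: "a \<le> s" "s \<le> t" "t \<le> b"
  shows "norm (f t - f s) \<le> variation_control vec_norm p f s t powr (1 / p)"
  using variation_control_upper[OF f p, of s t] st by (cases "s = t") auto

text \<open>The sum of the two p-th power increments dominates each of them, so each path moves by
  at most the power \<open>1 / p\<close> of one common control; the factor 2 counts the two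
  paths.\<close>

lemma finite_variation_diff:
  fixes f g :: "real \<Rightarrow> 'b::real_normed_vector"
  assumes f: "f \<in> variation_space UNIV vec_norm p a b" and g: "g \<in> variation_space UNIV vec_norm p a b" and p: "0 < p"
  shows "(\<lambda>t. f t - g t) \<in> variation_space UNIV vec_norm p a b"
proof -
  let ?f = "\<lambda>s t. ennreal_powr (vec_norm (f t - f s)) p" and ?g = "\<lambda>s t. ennreal_powr (vec_norm (g t - g s)) p"
  let ?M = "\<lambda>s t. ?f s t + ?g s t"
  have "variation_norm vec_norm p a b (\<lambda>t. f t - g t) \<le> 2 * ennreal_powr (var_sup ?M a b) (1 / p)"
  proof (rule variation_norm_le_of_control[OF p])
    fix s t assume st: "a \<le> s" "s < t" "t \<le> b"
    have "vec_norm (f t - f s) \<le> ennreal_powr (var_sup ?M s t) (1 / p)"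
      unfolding ennreal_powr_le_iff[OF p, symmetric] using var_sup_ge[OF st(2), of ?M] by (rule order_trans[rotated]) simp
    moreover have "vec_norm (g t - g s) \<le> ennreal_powr (var_sup ?M s t) (1 / p)"
      unfolding ennreal_powr_le_iff[OF p, symmetric] using var_sup_ge[OF st(2), of ?M] by (rule order_trans[rotated]) simp
    moreover have "vec_norm ((f t - g t) - (f s - g s)) \<le> vec_norm (f t - f s) + vec_norm (g t - g s)"
      using norm_triangle_ineq4[of "f t - f s" "g t - g s"]
      by (simp add: ennreal_plus[symmetric] ennreal_leI algebra_simps del: ennreal_plus)
    ultimately show "vec_norm ((f t - g t) - (f s - g s)) \<le> 2 * ennreal_powr (var_sup ?M s t) (1 / p)"
      unfolding mult_2 by (meson add_mono order_trans)
  qed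
  also have "\<dots> < \<top>"
  proof -
    have "var_sup ?M a b \<le> var_sup ?f a b + var_sup ?g a b"
    proof (rule var_sup_least)
      fix n \<tau> assume \<tau>: "(n, \<tau>) \<in> partitions a b"
      show "(\<Sum>i<n. ?M (\<tau> i) (\<tau> (Suc i))) \<le> var_sup ?f a b + var_sup ?g a b"
        unfolding sum.distrib by (intro add_mono var_sup_upper[OF \<tau>])
    qed
    also have "\<dots> < \<top>" using f g by (simp add: variation_space_def variation_norm_eq_var_sup)
    finally show ?thesis by (simp add: ennreal_mult_less_top)
  qed
  finally show ?thesis by (simp add: variation_space_def)
qed

text \<open>Finite variation bounds the path by its initial value plus its variation. Finiteness
  lets the uniform norm of \<open>f - g\<close> be handled as a real number later.\<close>

lemma finite_variation_esssup:
  fixes f :: "real \<Rightarrow> 'b::euclidean_space"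
  assumes f: "f \<in> variation_space UNIV vec_norm p a b" and p: "0 < p"
  shows "Lp_norm (lebesgue_on {a..b}) \<infinity> (\<lambda>t. vec_norm (f t)) < \<top>"
proof -
  let ?v = "variation_control vec_norm p f"
  note [measurable] = finite_variation_measurable[OF f p]
  have "norm (f t) \<le> norm (f a) + ?v a b powr (1 / p)" if "t \<in> {a..b}" for t
  proof -
    have "?v a t \<le> ?v a b"
      using that by (intro control_on_mono[OF control_on_variation_control[OF f p]]) auto
    then have "?v a t powr (1 / p) \<le> ?v a b powr (1 / p)"
      using p by (intro powr_mono2) (auto simp: variation_control_def)
    moreover have "norm (f t - f a) \<le> ?v a t powr (1 / p)"
      using that by (intro variation_control_norm_upper[OF f p]) auto
    moreover have "norm (f t) \<le> norm (f a) + norm (f t - f a)"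
      using norm_triangle_ineq[of "f a" "f t - f a"] by simp
    ultimately show ?thesis by linarith
  qed
  then have "AE t in lebesgue_on {a..b}. vec_norm (f t) \<le> ennreal (norm (f a) + ?v a b powr (1 / p))"
    by (intro AE_I2 ennreal_leI) auto
  then have "esssup (lebesgue_on {a..b}) (\<lambda>t. vec_norm (f t)) \<le> ennreal (norm (f a) + ?v a b powr (1 / p))"
    by (intro esssup_I) auto
  then show ?thesis by (simp add: Lp_norm_def order.strict_trans1)
qed

section \<open>Temperedness of occupation measures\<close>

lemma schwartz_bound: "ennreal (norm (\<psi> x)) \<le> schwartz_norm 0 \<psi>"
  unfolding schwartz_norm_def by (rule SUP_upper2[where i = "[]"]) (auto intro: SUP_upper2[where i = x])

lemma schwartz_measurable: "schwartz \<psi> \<Longrightarrow> \<psi> \<in> borel_measurable borel"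
  unfolding schwartz_def
  by (intro borel_measurable_continuous_onI continuous_at_imp_continuous_on ballI
      differentiable_imp_continuous_within smooth_differentiable) auto

lemma tempered_distribution_of:
  fixes M :: "'a::euclidean_space measure"
  assumes "finite_measure M" and sets: "sets M = sets borel"
  shows "tempered (distribution_of M)"
proof -
  interpret finite_measure M by fact
  have int: "integrable M \<psi>" and bound: "ennreal (norm (distribution_of M \<psi>)) \<le> ennreal (measure M (space M)) * schwartz_norm 0 \<psi>"
    if \<psi>: "schwartz \<psi>" for \<psi>
  proof -
    obtain B where B: "schwartz_norm 0 \<psi> = ennreal B" "0 \<le> B"
      using \<psi> by (cases "schwartz_norm 0 \<psi>") (auto simp: schwartz_def less_top[symmetric])
    have le: "norm (\<psi> x) \<le> B" for x using schwartz_bound[of \<psi> x] B by simp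
    have "\<psi> \<in> borel_measurable M" using schwartz_measurable[OF \<psi>] sets measurable_cong_sets by blast
    then show int: "integrable M \<psi>" using le by (intro integrable_const_bound[of _ B]) auto
    have "norm (distribution_of M \<psi>) \<le> (\<integral>x. B \<partial>M)"
      unfolding distribution_of_def using le by (intro Bochner_Integration.integral_norm_bound_integral int) auto
    then show "ennreal (norm (distribution_of M \<psi>)) \<le> ennreal (measure M (space M)) * schwartz_norm 0 \<psi>"
      using B by (simp add: ennreal_mult[symmetric] ennreal_leI)
  qed
  show ?thesis
    unfolding tempered_def
  proof (intro conjI allI impI exI)
    fix \<psi> :: "'a \<Rightarrow> complex" assume "schwartz \<psi>"
    then show "ennreal (norm (distribution_of M \<psi>)) \<le> ennreal (measure M (space M)) * schwartz_norm 0 \<psi>" by (rule bound)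
  qed (use int in \<open>auto simp: distribution_of_def\<close>)
qed

lemma tempered_occupation_flow:
  fixes \<omega> :: "real \<Rightarrow> 'a::euclidean_space"
  assumes "\<omega> \<in> borel_measurable (lebesgue_on {a..t})"
  shows "tempered (occupation_flow \<omega> a t)"
  unfolding occupation_flow_def occupation_measure_def
  using finite_measure.finite_measure_distr[OF finite_lebesgue_on_Icc assms] by (intro tempered_distribution_of) auto

context littlewood_paley
begin

text \<open>Dropping a short initial piece changes a block by at most its length times a bound of
  the kernel.\<close>

lemma occ_tendsto_left:
  fixes \<omega> :: "real \<Rightarrow> 'a"
  assumes \<omega>: "\<omega> \<in> borel_measurable (lebesgue_on {a..b})"
    and s: "a \<le> s" "t \<le> b" "\<And>n. s \<le> u n" "\<And>n. u n \<le> t" "u \<longlonglongrightarrow> s"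
  shows "(\<lambda>n. occ \<omega> (u n) t j x) \<longlonglongrightarrow> occ \<omega> s t j x"
proof -
  obtain B where B: "0 \<le> B" "\<And>x. norm (kernel j x) \<le> B" by (rule kernel_bounded) blast
  have le: "norm (occ \<omega> (u n) t j x - occ \<omega> s t j x) \<le> (u n - s) * B" for n
  proof -
    have "occ \<omega> s t = occ \<omega> s (u n) + occ \<omega> (u n) t"
      by (rule occ_add[OF s(3,4) measurable_lebesgue_on_Icc_subset[OF \<omega> s(1,2)]])
    moreover have "norm (occ \<omega> s (u n) j x) \<le> (u n - s) * B"
      by (rule occ_bound[OF measurable_lebesgue_on_Icc_subset[OF \<omega> s(1) order_trans[OF s(4) s(2)]] s(3) B(2)])
    ultimately show ?thesis by simp
  qed
  have "(\<lambda>n. (u n - s) * B) \<longlonglongrightarrow> (s - s) * B"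
    by (intro tendsto_intros s)
  then have "(\<lambda>n. (u n - s) * B) \<longlonglongrightarrow> 0" by simp
  from Lim_null_comparison[OF always_eventually[OF allI[OF le]] this]
  have "(\<lambda>n. occ \<omega> (u n) t j x - occ \<omega> s t j x) \<longlonglongrightarrow> 0" .
  then show ?thesis by (rule LIM_zero_cancel)
qed

text \<open>The discrete bound is combined with Fatou's lemma twice: along refining partitions with
  points in D when s is in D, and along start points in D decreasing to s in general. Bounding w1 by
  its total W leaves a power of w2 alone, the form required for a bound in the r-variation
  norm.\<close>

lemma sewing_profile:
  fixes A F :: "real \<Rightarrow> real \<Rightarrow> nat \<Rightarrow> 'a \<Rightarrow> complex"
  assumes pq: "1 \<le> p" "p < \<infinity>" "1 \<le> q"
    and D: "\<And>u v. a \<le> u \<Longrightarrow> u < v \<Longrightarrow> v \<le> b \<Longrightarrow> \<exists>x\<in>D. u < x \<and> x < v"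
    and w: "control_on a b w1" "control_on a b w2" and \<beta>: "0 < \<beta>1" "0 < \<beta>2" "1 < \<beta>1 + \<beta>2" and W: "w1 a b \<le> W"
    and A: "\<And>s t. a \<le> s \<Longrightarrow> s < t \<Longrightarrow> t \<le> b \<Longrightarrow> profile (A s t)"
    and F: "\<And>s t. a \<le> s \<Longrightarrow> s < t \<Longrightarrow> t \<le> b \<Longrightarrow> profile (F s t)"
    and \<delta>: "\<And>s u t. a \<le> s \<Longrightarrow> s < u \<Longrightarrow> u < t \<Longrightarrow> t \<le> b \<Longrightarrow> s \<in> D \<Longrightarrow> u \<in> D \<Longrightarrow>
      profile_norm \<sigma> p q (A s t - A s u - A u t) \<le> c * ennreal (w1 s u powr \<beta>1 * w2 u t powr \<beta>2)"
    and germ: "\<And>s t. a \<le> s \<Longrightarrow> s < t \<Longrightarrow> t \<le> b \<Longrightarrow> s \<in> D \<Longrightarrow> profile_norm \<sigma> p q (A s t) \<le> d * ennreal (w2 s t powr \<beta>2)"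
    and lim: "\<And>N \<pi> e s t j x. a \<le> s \<Longrightarrow> t \<le> b \<Longrightarrow> (\<And>n. (N n, \<pi> n) \<in> partitions s t) \<Longrightarrow>
      (\<And>n i. i < N n \<Longrightarrow> \<pi> n (Suc i) - \<pi> n i \<le> e n) \<Longrightarrow> e \<longlonglongrightarrow> 0 \<Longrightarrow>
      (\<lambda>n. (\<Sum>i<N n. A (\<pi> n i) (\<pi> n (Suc i))) j x) \<longlonglongrightarrow> F s t j x"
    and cont: "\<And>s t u j x. a \<le> s \<Longrightarrow> t \<le> b \<Longrightarrow> (\<And>n. s \<le> u n) \<Longrightarrow> (\<And>n. u n \<le> t) \<Longrightarrow> u \<longlonglongrightarrow> s \<Longrightarrow>
      (\<lambda>n. F (u n) t j x) \<longlonglongrightarrow> F s t j x"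
    and st: "a \<le> s" "s < t" "t \<le> b"
  shows "profile_norm \<sigma> p q (F s t) \<le>
    (d + c * ennreal ((\<Sum>k. (2 / real (Suc k)) powr (\<beta>1 + \<beta>2)) * W powr \<beta>1)) * ennreal (w2 s t powr \<beta>2)"
proof -
  interpret extended_seminorm "Collect profile" "profile_norm \<sigma> p q"
    by (rule extended_seminorm_profile[OF pq])
  let ?N = "profile_norm \<sigma> p q"
  define Z where "Z = (\<Sum>k. (2 / real (Suc k)) powr (\<beta>1 + \<beta>2))"
  have sumZ: "(\<Sum>k<n. (2 / real (Suc k)) powr (\<beta>1 + \<beta>2)) \<le> Z" for n
    unfolding Z_def by (intro sum_le_suminf summable_sewing_constant \<beta>) auto
  have Z: "0 \<le> Z" using sumZ[of 0] by simp
  let ?K = "d + c * ennreal (Z * W powr \<beta>1)"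
  have in_D: "?N (F s t) \<le> ?K * ennreal (w2 s t powr \<beta>2)" if s: "s \<in> D" "a \<le> s" "s < t" "t \<le> b" for s t
  proof -
    have "\<forall>n. \<exists>\<pi>. (Suc n, \<pi>) \<in> partitions s t \<and> (\<forall>i\<le>n. \<pi> i \<in> D) \<and> (\<forall>i\<le>n. \<pi> (Suc i) - \<pi> i \<le> 2 * (t - s) / real (Suc n))"
    proof
      fix n
      have D': "\<exists>x\<in>D. u < x \<and> x < v" if "s \<le> u" "u < v" "v \<le> t" for u v
        using that s by (intro D) auto
      show "\<exists>\<pi>. (Suc n, \<pi>) \<in> partitions s t \<and> (\<forall>i\<le>n. \<pi> i \<in> D) \<and> (\<forall>i\<le>n. \<pi> (Suc i) - \<pi> i \<le> 2 * (t - s) / real (Suc n))"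
        by (rule exists_partition_in_dense[OF D' s(1) s(3), of n]) auto
    qed
    then obtain \<pi> where \<pi>: "\<And>n. (Suc n, \<pi> n) \<in> partitions s t" "\<And>n i. i \<le> n \<Longrightarrow> \<pi> n i \<in> D"
      "\<And>n i. i \<le> n \<Longrightarrow> \<pi> n (Suc i) - \<pi> n i \<le> 2 * (t - s) / real (Suc n)" by metis
    define U where "U n = (\<Sum>i<Suc n. A (\<pi> n i) (\<pi> n (Suc i)))" for n
    have U: "profile (U n)" for n
    proof -
      have "profile (A (\<pi> n i) (\<pi> n (Suc i)))" if "i < Suc n" for i
        using partitions_bounds[OF \<pi>(1)[of n], of i] partitions_bounds[OF \<pi>(1)[of n], of "Suc i"]
          partitions_step[OF \<pi>(1)[of n], of i] that s by (intro A) auto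
      then show ?thesis
        unfolding U_def using sum_mem[of "{..<Suc n}" "\<lambda>i. A (\<pi> n i) (\<pi> n (Suc i))"] by (simp del: sum.lessThan_Suc)
    qed
    have bound: "?N (U n) \<le> ?K * ennreal (w2 s t powr \<beta>2)" for n
    proof -
      have "?N (U n) = ?N ((U n - A s t) + A s t)" by simp
      also have "\<dots> \<le> ?N (U n - A s t) + ?N (A s t)"
        using U A[OF s(2-4)] by (intro triangle) (auto intro: profile_diff)
      also have "\<dots> \<le> c * ennreal (Z * W powr \<beta>1) * ennreal (w2 s t powr \<beta>2) + d * ennreal (w2 s t powr \<beta>2)"
      proof (intro add_mono germ s)
        have "?N (U n - A s t) \<le>
          c * ennreal ((\<Sum>k<n. (2 / real (Suc k)) powr (\<beta>1 + \<beta>2)) * (w1 s t powr \<beta>1 * w2 s t powr \<beta>2))"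
          unfolding U_def
          by (rule sewing_discrete[OF w \<beta>(1,2) _ \<delta> \<pi>(1) s(2,4) \<pi>(2)]) (auto intro: A)
        \<comment> \<open>The partial sum is replaced by the whole series, so the bound no longer
          depends on the partition.\<close>
        also have "\<dots> \<le> c * ennreal (Z * (W powr \<beta>1 * w2 s t powr \<beta>2))"
        proof (intro mult_left_mono ennreal_leI mult_mono sumZ powr_mono2)
          show "0 \<le> w1 s t" using s by (intro control_onD(1)[OF w(1)]) auto
          show "0 \<le> w2 s t" using s by (intro control_onD(1)[OF w(2)]) auto
          show "w1 s t \<le> W" using s control_on_mono[OF w(1), of a s t b] W by auto
        qed (use Z \<beta> in auto)
        also have "\<dots> = c * ennreal (Z * W powr \<beta>1) * ennreal (w2 s t powr \<beta>2)"
          using Z by (simp add: ennreal_mult mult.assoc)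
        finally show "?N (U n - A s t) \<le> c * ennreal (Z * W powr \<beta>1) * ennreal (w2 s t powr \<beta>2)" .
      qed
      finally show ?thesis by (simp add: distrib_right add.commute)
    qed
    have lim_U: "(\<lambda>n. U n j x) \<longlonglongrightarrow> F s t j x" for j x
      unfolding U_def
    proof (rule lim)
      have "(\<lambda>n. 2 * (t - s) * (1 / real (Suc n))) \<longlonglongrightarrow> 2 * (t - s) * 0"
        using LIMSEQ_inverse_real_of_nat by (intro tendsto_mult tendsto_const) (simp add: inverse_eq_divide)
      then show "(\<lambda>n. 2 * (t - s) / real (Suc n)) \<longlonglongrightarrow> 0" by simp
    qed (use s \<pi> in auto)
    show ?thesis by (rule profile_norm_Fatou[OF pq profile_measurable[OF U] lim_U bound])
  qed
  \<comment> \<open>A start outside D is approached from the right, where monotonicity of w2 keeps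
    the bound for the smaller intervals.\<close>
  have "\<exists>x\<in>D. s < x \<and> x < s + (t - s) / real (Suc n)" for n
  proof (rule D)
    have "(t - s) / real (Suc n) \<le> t - s" using st by (simp add: divide_le_eq mult_le_cancel_left1)
    then show "s + (t - s) / real (Suc n) \<le> b" using st by linarith
  qed (use st in auto)
  then obtain u where u: "\<And>n. u n \<in> D" "\<And>n. s < u n" "\<And>n. u n < s + (t - s) / real (Suc n)" by metis
  have ut: "u n < t" for n
  proof -
    have "(t - s) / real (Suc n) \<le> t - s" using st by (simp add: divide_le_eq mult_le_cancel_left1)
    then show ?thesis using u(3)[of n] by linarith
  qed
  have "u \<longlonglongrightarrow> s"
  proof (rule tendsto_sandwich[OF always_eventually always_eventually tendsto_const])
    show "\<forall>n. s \<le> u n" "\<forall>n. u n \<le> s + (t - s) * (1 / real (Suc n))" using u by (auto simp: less_imp_le)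
    have "(\<lambda>n. s + (t - s) * (1 / real (Suc n))) \<longlonglongrightarrow> s + (t - s) * 0"
      using LIMSEQ_inverse_real_of_nat by (intro tendsto_intros) (simp add: inverse_eq_divide)
    then show "(\<lambda>n. s + (t - s) * (1 / real (Suc n))) \<longlonglongrightarrow> s" by simp
  qed
  then have lim_F: "(\<lambda>n. F (u n) t j x) \<longlonglongrightarrow> F s t j x" for j x
    by (rule cont[OF st(1,3) less_imp_le[OF u(2)] less_imp_le[OF ut]])
  have bound: "?N (F (u n) t) \<le> ?K * ennreal (w2 s t powr \<beta>2)" for n
  proof -
    have "a \<le> u n" using u(2)[of n] st by linarith
    then have "?N (F (u n) t) \<le> ?K * ennreal (w2 (u n) t powr \<beta>2)" using u ut st by (intro in_D) auto
    also have "\<dots> \<le> ?K * ennreal (w2 s t powr \<beta>2)"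
      using u(2)[of n] ut[of n] st \<beta> \<open>a \<le> u n\<close>
      by (intro mult_left_mono ennreal_leI powr_mono2 control_on_mono[OF w(2)] control_onD(1)[OF w(2)]) (auto simp: less_imp_le)
    finally show ?thesis .
  qed
  have "profile (F (u n) t)" for n
    using u(2)[of n] ut[of n] st by (intro F) auto
  from profile_norm_Fatou[OF pq profile_measurable[OF this] lim_F bound]
  have "?N (F s t) \<le> ?K * ennreal (w2 s t powr \<beta>2)" .
  then show ?thesis unfolding Z_def .
qed

text \<open>One of the two translations is an isometry and can be factored out. The constant is a
  function of the regularity because the second-order estimate uses it at two regularities.\<close>

lemma translate_increment:
  obtains C where "\<And>s. 0 \<le> C s"
    "\<And>U s \<gamma> h k p q. profile U \<Longrightarrow> 1 \<le> p \<Longrightarrow> p < \<infinity> \<Longrightarrow> 1 \<le> q \<Longrightarrow> 0 \<le> \<gamma> \<Longrightarrow> \<gamma> \<le> 1 \<Longrightarrow>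
      profile_norm (s - \<gamma>) p q (translate h U - translate k U) \<le> ennreal (C s * norm (h - k) powr \<gamma>) * profile_norm s p q U"
proof -
  obtain C where C: "0 \<le> C"
    "\<And>U s \<gamma> h p q. profile U \<Longrightarrow> 1 \<le> p \<Longrightarrow> p < \<infinity> \<Longrightarrow> 1 \<le> q \<Longrightarrow> 0 \<le> \<gamma> \<Longrightarrow> \<gamma> \<le> 1 \<Longrightarrow>
      profile_norm (s - \<gamma>) p q (translate h U - U) \<le>
      ennreal (C * (2 powr s + 1 + 2 powr (- s)) * norm h powr \<gamma>) * profile_norm s p q U"
    by (rule profile_norm_increment) blast
  have "profile_norm (s - \<gamma>) p q (translate h U - translate k U) \<le>
      ennreal (C * (2 powr s + 1 + 2 powr (- s)) * norm (h - k) powr \<gamma>) * profile_norm s p q U"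
    if "profile U" "1 \<le> p" "p < \<infinity>" "1 \<le> q" "0 \<le> \<gamma>" "\<gamma> \<le> 1" for U s \<gamma> h k p q
  proof -
    have "translate h U - translate k U = translate k (translate (h - k) U - U)"
      by (simp add: translate_diff translate_add)
    moreover have "profile (translate (h - k) U - U)"
      using that(1) by (intro profile_diff profile_translate)
    ultimately have "profile_norm (s - \<gamma>) p q (translate h U - translate k U) = profile_norm (s - \<gamma>) p q (translate (h - k) U - U)"
      using that(3) profile_measurable by (simp only: profile_norm_translate)
    also have "\<dots> \<le> ennreal (C * (2 powr s + 1 + 2 powr (- s)) * norm (h - k) powr \<gamma>) * profile_norm s p q U"
      by (rule C(2)[OF that])
    finally show ?thesis .
  qed
  moreover have "0 \<le> C * (2 powr s + 1 + 2 powr (- s))" for s :: real using C(1) by simp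
  ultimately show ?thesis by (rule that[rotated])
qed

text \<open>Moving the perturbation from d' to d costs one derivative and is linear in
  \<open>d - d'\<close>. In the other term the increment in g costs \<gamma> derivatives and
  translating it by d' costs one more, which yields the product.\<close>

lemma translate_second_increment:
  assumes pq: "1 \<le> p" "p < \<infinity>" "1 \<le> q" and \<gamma>: "0 \<le> \<gamma>" "\<gamma> \<le> 1"
  obtains C where "0 \<le> C"
    "\<And>X d d' g g'. profile X \<Longrightarrow>
      profile_norm (\<alpha> - \<gamma> - 1) p q (translate (g + d) X - translate g X - (translate (g' + d') X - translate g' X)) \<le>
      ennreal (C * (norm (d - d') + norm d' * norm (g - g') powr \<gamma>)) * profile_norm \<alpha> p q X"
proof -
  obtain C where C: "\<And>s. 0 \<le> C s"
    "\<And>U s \<gamma> h k p q. profile U \<Longrightarrow> 1 \<le> p \<Longrightarrow> p < \<infinity> \<Longrightarrow> 1 \<le> q \<Longrightarrow> 0 \<le> \<gamma> \<Longrightarrow> \<gamma> \<le> 1 \<Longrightarrow>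
      profile_norm (s - \<gamma>) p q (translate h U - translate k U) \<le> ennreal (C s * norm (h - k) powr \<gamma>) * profile_norm s p q U"
    by (rule translate_increment) blast
  \<comment> \<open>One summand for each of the two terms; the second composes the increment bound
    at regularity \<open>\<alpha>\<close> with that at \<open>\<alpha> - \<gamma>\<close>.\<close>
  define K where "K = C \<alpha> + C (\<alpha> - \<gamma>) * C \<alpha>"
  have K: "0 \<le> K" "C \<alpha> \<le> K" "C (\<alpha> - \<gamma>) * C \<alpha> \<le> K" using C(1) by (auto simp: K_def)
  have "profile_norm (\<alpha> - \<gamma> - 1) p q (translate (g + d) X - translate g X - (translate (g' + d') X - translate g' X)) \<le>
      ennreal (K * (norm (d - d') + norm d' * norm (g - g') powr \<gamma>)) * profile_norm \<alpha> p q X"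
    if X: "profile X" for X d d' g g'
  proof -
    define Y where "Y = translate g X - translate g' X"
    have Y: "profile Y" unfolding Y_def using X by (intro profile_diff profile_translate)
    have "translate d' Y = translate (g + d') X - translate (g' + d') X"
      unfolding Y_def by (simp add: translate_diff translate_add add.commute)
    then have eq: "translate (g + d) X - translate g X - (translate (g' + d') X - translate g' X) =
      (translate (g + d) X - translate (g + d') X) + (translate d' Y - translate 0 Y)"
      by (simp add: Y_def translate_def fun_eq_iff)
    have "profile_norm (\<alpha> - \<gamma> - 1) p q (translate (g + d) X - translate g X - (translate (g' + d') X - translate g' X)) \<le>
      profile_norm (\<alpha> - \<gamma> - 1) p q (translate (g + d) X - translate (g + d') X) +
      profile_norm (\<alpha> - \<gamma> - 1) p q (translate d' Y - translate 0 Y)"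
      unfolding eq using X Y by (intro profile_norm_triangle pq profile_measurable profile_diff profile_translate)
    also have "\<dots> \<le> ennreal (K * norm (d - d')) * profile_norm \<alpha> p q X + ennreal (K * (norm d' * norm (g - g') powr \<gamma>)) * profile_norm \<alpha> p q X"
    proof (intro add_mono)
      have "profile_norm (\<alpha> - \<gamma> - 1) p q (translate (g + d) X - translate (g + d') X) \<le>
        profile_norm (\<alpha> - 1) p q (translate (g + d) X - translate (g + d') X)"
        using \<gamma> pq by (intro profile_norm_mono_exponent) auto
      also have "\<dots> \<le> ennreal (C \<alpha> * norm ((g + d) - (g + d')) powr 1) * profile_norm \<alpha> p q X"
        by (rule C(2)[OF X pq]) auto
      also have "\<dots> \<le> ennreal (K * norm (d - d')) * profile_norm \<alpha> p q X"
        using K(2) by (intro mult_right_mono ennreal_leI) (auto intro: mult_right_mono)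
      finally show "profile_norm (\<alpha> - \<gamma> - 1) p q (translate (g + d) X - translate (g + d') X) \<le> ennreal (K * norm (d - d')) * profile_norm \<alpha> p q X" .
      have "profile_norm (\<alpha> - \<gamma> - 1) p q (translate d' Y - translate 0 Y) \<le>
        ennreal (C (\<alpha> - \<gamma>) * norm (d' - 0) powr 1) * profile_norm (\<alpha> - \<gamma>) p q Y"
        by (rule C(2)[OF Y pq]) auto
      also have "\<dots> \<le> ennreal (C (\<alpha> - \<gamma>) * norm (d' - 0) powr 1) * (ennreal (C \<alpha> * norm (g - g') powr \<gamma>) * profile_norm \<alpha> p q X)"
        unfolding Y_def by (intro mult_left_mono C(2)[OF X pq \<gamma>]) auto
      also have "\<dots> = ennreal ((C (\<alpha> - \<gamma>) * norm d') * (C \<alpha> * norm (g - g') powr \<gamma>)) * profile_norm \<alpha> p q X"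
        using C(1) by (subst ennreal_mult) (auto simp: mult.assoc)
      also have "\<dots> \<le> ennreal (K * (norm d' * norm (g - g') powr \<gamma>)) * profile_norm \<alpha> p q X"
      proof (intro mult_right_mono ennreal_leI)
        have "(C (\<alpha> - \<gamma>) * norm d') * (C \<alpha> * norm (g - g') powr \<gamma>) = (C (\<alpha> - \<gamma>) * C \<alpha>) * (norm d' * norm (g - g') powr \<gamma>)"
          by (simp only: mult_ac)
        also have "\<dots> \<le> K * (norm d' * norm (g - g') powr \<gamma>)" using K(3) by (intro mult_right_mono) auto
        finally show "(C (\<alpha> - \<gamma>) * norm d') * (C \<alpha> * norm (g - g') powr \<gamma>) \<le> K * (norm d' * norm (g - g') powr \<gamma>)" .
      qed simp
      finally show "profile_norm (\<alpha> - \<gamma> - 1) p q (translate d' Y - translate 0 Y) \<le> ennreal (K * (norm d' * norm (g - g') powr \<gamma>)) * profile_norm \<alpha> p q X" .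
    qed
    also have "\<dots> = ennreal (K * (norm (d - d') + norm d' * norm (g - g') powr \<gamma>)) * profile_norm \<alpha> p q X"
      unfolding distrib_right[symmetric] using K(1) by (subst ennreal_plus[symmetric]) (auto simp: distrib_left)
    finally show ?thesis .
  qed
  then show ?thesis using K(1) that by blast
qed

lemma variation_norm_flow_le:
  fixes \<omega> :: "real \<Rightarrow> 'a"
  assumes r: "0 < r" and flow: "occupation_flow \<omega> a \<in> variation_space (besov_space \<phi> \<alpha> p q) (besov_norm \<phi> \<alpha> p q) r a b"
    and G: "\<And>s t. a \<le> s \<Longrightarrow> s < t \<Longrightarrow> t \<le> b \<Longrightarrow> (\<lambda>j. LP_block \<phi> j (v t - v s)) = G s t"
    and le: "\<And>s t. a \<le> s \<Longrightarrow> s < t \<Longrightarrow> t \<le> b \<Longrightarrow> profile_norm \<sigma> p q (G s t) \<le>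
      K * ennreal (variation_control (besov_norm \<phi> \<alpha> p q) r (occupation_flow \<omega> a) s t powr (1 / r))"
  shows "variation_norm (besov_norm \<phi> \<sigma> p q) r a b v \<le> K * variation_norm (besov_norm \<phi> \<alpha> p q) r a b (occupation_flow \<omega> a)"
  unfolding variation_norm_eq_var_sup[of "besov_norm \<phi> \<alpha> p q"]
proof (rule variation_norm_le_of_control[OF r])
  fix s t assume st: "a \<le> s" "s < t" "t \<le> b"
  show "besov_norm \<phi> \<sigma> p q (v t - v s) \<le> K * ennreal_powr (var_sup (\<lambda>s t. ennreal_powr (besov_norm \<phi> \<alpha> p q (occupation_flow \<omega> a t - occupation_flow \<omega> a s)) r) s t) (1 / r)"
    using le[OF st] variation_control_powr[OF flow r, of s t] st
    by (simp add: besov_norm_eq_profile_norm G)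
qed

lemma occ_norm_le:
  fixes \<omega> :: "real \<Rightarrow> 'a"
  assumes \<omega>: "\<omega> \<in> borel_measurable (lebesgue_on {a..b})" and r: "0 < r"
    and flow: "occupation_flow \<omega> a \<in> variation_space (besov_space \<phi> \<alpha> p q) (besov_norm \<phi> \<alpha> p q) r a b"
    and st: "a \<le> s" "s < t" "t \<le> b"
  shows "profile_norm \<alpha> p q (occ \<omega> s t) \<le>
    ennreal (variation_control (besov_norm \<phi> \<alpha> p q) r (occupation_flow \<omega> a) s t powr (1 / r))"
proof -
  have "\<omega> \<in> borel_measurable (lebesgue_on {a..t})" using st by (intro measurable_lebesgue_on_Icc_subset[OF \<omega>]) auto
  then have "profile_norm \<alpha> p q (occ \<omega> s t) = besov_norm \<phi> \<alpha> p q (occupation_flow \<omega> a t - occupation_flow \<omega> a s)"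
    using st by (simp add: besov_norm_eq_profile_norm LP_block_occupation_increment)
  also have "\<dots> \<le> ennreal (variation_control (besov_norm \<phi> \<alpha> p q) r (occupation_flow \<omega> a) s t powr (1 / r))"
    by (rule variation_control_upper[OF flow r st])
  finally show ?thesis .
qed

lemma path_facts:
  fixes \<omega> f :: "real \<Rightarrow> 'a"
  assumes \<omega>: "\<omega> \<in> borel_measurable (lebesgue_on {a..b})" and f: "f \<in> variation_space UNIV vec_norm r1 a b" and r1: "0 < r1"
  shows shifted_path_measurable: "(\<lambda>s. \<omega> s + f s) \<in> borel_measurable (lebesgue_on {a..b})"
    and germ_sum_tendsto_variation: "a \<le> s \<Longrightarrow> t \<le> b \<Longrightarrow> (\<And>n. (N n, \<pi> n) \<in> partitions s t) \<Longrightarrow>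
      (\<And>n i. i < N n \<Longrightarrow> \<pi> n (Suc i) - \<pi> n i \<le> e n) \<Longrightarrow> e \<longlonglongrightarrow> 0 \<Longrightarrow>
      (\<lambda>n. (\<Sum>i<N n. translate (f (\<pi> n i)) (occ \<omega> (\<pi> n i) (\<pi> n (Suc i)))) j x) \<longlonglongrightarrow> occ (\<lambda>\<tau>. \<omega> \<tau> + f \<tau>) s t j x"
proof -
  note fm = finite_variation_measurable[OF f r1]
  show "(\<lambda>s. \<omega> s + f s) \<in> borel_measurable (lebesgue_on {a..b})" using \<omega> fm by measurable
  show "(\<lambda>n. (\<Sum>i<N n. translate (f (\<pi> n i)) (occ \<omega> (\<pi> n i) (\<pi> n (Suc i)))) j x) \<longlonglongrightarrow> occ (\<lambda>\<tau>. \<omega> \<tau> + f \<tau>) s t j x"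
    if st: "a \<le> s" "t \<le> b" and \<pi>: "\<And>n. (N n, \<pi> n) \<in> partitions s t"
      "\<And>n i. i < N n \<Longrightarrow> \<pi> n (Suc i) - \<pi> n i \<le> e n" "e \<longlonglongrightarrow> 0"
  proof (rule germ_sum_tendsto[OF measurable_lebesgue_on_Icc_subset[OF \<omega> st] measurable_lebesgue_on_Icc_subset[OF fm st] _ \<pi>])
    have "{s..t} \<subseteq> {a..b}" using st by auto
    then have "{\<tau> \<in> {s..t}. \<not> continuous (at \<tau> within {s..t}) f} \<subseteq> {\<tau> \<in> {a..b}. \<not> continuous (at \<tau> within {a..b}) f}"
      using continuous_within_subset[of _ "{a..b}" f "{s..t}"] by blast
    then show "countable {\<tau> \<in> {s..t}. \<not> continuous (at \<tau> within {s..t}) f}"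
      by (rule countable_subset[OF _ finite_variation_countable_discontinuities[OF f r1]])
  qed
qed

text \<open>Sewing with exponents \<open>\<gamma> / r1\<close> and \<open>1 / r\<close>. The germ
  needs no bound on f, since translations are isometries, so every time is admissible and D is the
  whole line.\<close>

lemma occupation_flow_shift:
  fixes \<omega> f :: "real \<Rightarrow> 'a"
  assumes pq: "1 \<le> p" "p < \<infinity>" "1 \<le> q" and r: "0 < r" "0 < r1" and \<gamma>: "0 < \<gamma>" "\<gamma> \<le> 1" "1 < \<gamma> / r1 + 1 / r"
    and \<omega>: "\<omega> \<in> borel_measurable (lebesgue_on {a..b})"
    and flow: "occupation_flow \<omega> a \<in> variation_space (besov_space \<phi> \<alpha> p q) (besov_norm \<phi> \<alpha> p q) r a b"
    and f: "f \<in> variation_space UNIV vec_norm r1 a b"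
  shows "occupation_flow (\<lambda>s. \<omega> s + f s) a \<in>
    variation_space (besov_space \<phi> (\<alpha> - \<gamma>) p q) (besov_norm \<phi> (\<alpha> - \<gamma>) p q) r a b"
proof -
  let ?w = "variation_control (besov_norm \<phi> \<alpha> p q) r (occupation_flow \<omega> a)"
  let ?v = "variation_control vec_norm r1 f"
  let ?\<omega>f = "\<lambda>s. \<omega> s + f s"
  obtain C where C: "\<And>s. 0 \<le> C s"
    "\<And>U s \<gamma> h k p q. profile U \<Longrightarrow> 1 \<le> p \<Longrightarrow> p < \<infinity> \<Longrightarrow> 1 \<le> q \<Longrightarrow> 0 \<le> \<gamma> \<Longrightarrow> \<gamma> \<le> 1 \<Longrightarrow>
      profile_norm (s - \<gamma>) p q (translate h U - translate k U) \<le> ennreal (C s * norm (h - k) powr \<gamma>) * profile_norm s p q U"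
    by (rule translate_increment) blast
  note \<omega>fm = shifted_path_measurable[OF \<omega> f r(2)]
  have sub: "\<omega> \<in> borel_measurable (lebesgue_on {s..t})" "?\<omega>f \<in> borel_measurable (lebesgue_on {s..t})" if "a \<le> s" "t \<le> b" for s t
    using measurable_lebesgue_on_Icc_subset[OF \<omega> that] measurable_lebesgue_on_Icc_subset[OF \<omega>fm that] by auto
  \<comment> \<open>The 1 comes from the germ, the other summand from the defects and the total
    variation of f.\<close>
  define K where "K = 1 + ennreal (C \<alpha>) * ennreal ((\<Sum>k. (2 / real (Suc k)) powr (\<gamma> / r1 + 1 / r)) * ?v a b powr (\<gamma> / r1))"
  have K: "K < \<top>" by (simp add: K_def ennreal_mult_less_top)
  have le: "profile_norm (\<alpha> - \<gamma>) p q (occ ?\<omega>f s t) \<le> K * ennreal (?w s t powr (1 / r))"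
    if st: "a \<le> s" "s < t" "t \<le> b" for s t
    unfolding K_def
  proof (rule sewing_profile[where A = "\<lambda>s t. translate (f s) (occ \<omega> s t)" and F = "occ ?\<omega>f" and D = UNIV
        and a = a and b = b and p = p and q = q and ?w1.0 = ?v and ?w2.0 = ?w])
    show "control_on a b ?v" by (rule control_on_variation_control[OF f r(2)])
    show "control_on a b ?w" by (rule control_on_variation_control[OF flow r(1)])
    show "profile (translate (f s) (occ \<omega> s t))" "profile (occ ?\<omega>f s t)" if "a \<le> s" "s < t" "t \<le> b" for s t
      using that sub by (auto intro!: profile_translate profile_occ)
    show "profile_norm (\<alpha> - \<gamma>) p q (translate (f s) (occ \<omega> s t)) \<le> 1 * ennreal (?w s t powr (1 / r))"
      if st: "a \<le> s" "s < t" "t \<le> b" for s t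
    proof -
      have "profile (occ \<omega> s t)" using st sub by (auto intro!: profile_occ)
      then have "profile_norm (\<alpha> - \<gamma>) p q (translate (f s) (occ \<omega> s t)) = profile_norm (\<alpha> - \<gamma>) p q (occ \<omega> s t)"
        using pq by (intro profile_norm_translate profile_measurable)
      also have "\<dots> \<le> profile_norm \<alpha> p q (occ \<omega> s t)" using \<gamma> pq by (intro profile_norm_mono_exponent) auto
      finally show ?thesis using occ_norm_le[OF \<omega> r(1) flow st] by simp
    qed
    show "profile_norm (\<alpha> - \<gamma>) p q (translate (f s) (occ \<omega> s t) - translate (f s) (occ \<omega> s u) - translate (f u) (occ \<omega> u t)) \<le>
      ennreal (C \<alpha>) * ennreal (?v s u powr (\<gamma> / r1) * ?w u t powr (1 / r))"
      if stu: "a \<le> s" "s < u" "u < t" "t \<le> b" for s u t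
    proof -
      have add: "occ \<omega> s t = occ \<omega> s u + occ \<omega> u t" using stu sub by (intro occ_add) auto
      \<comment> \<open>By additivity of the occupation measure only the piece from u to t is
        shifted by two different vectors.\<close>
      have "translate (f s) (occ \<omega> s t) - translate (f s) (occ \<omega> s u) = translate (f s) (occ \<omega> u t)"
        by (simp add: translate_diff[symmetric] add)
      moreover have "profile (occ \<omega> u t)" using stu sub by (auto intro!: profile_occ)
      ultimately have "profile_norm (\<alpha> - \<gamma>) p q (translate (f s) (occ \<omega> s t) - translate (f s) (occ \<omega> s u) - translate (f u) (occ \<omega> u t)) \<le>
        ennreal (C \<alpha> * norm (f s - f u) powr \<gamma>) * profile_norm \<alpha> p q (occ \<omega> u t)"
        using \<gamma> by (simp only:) (intro C(2) pq, auto)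
      also have "\<dots> \<le> ennreal (C \<alpha> * ?v s u powr (\<gamma> / r1)) * ennreal (?w u t powr (1 / r))"
      proof (intro mult_mono ennreal_leI mult_left_mono C)
        have "norm (f s - f u) powr \<gamma> \<le> (?v s u powr (1 / r1)) powr \<gamma>"
          using variation_control_norm_upper[OF f r(2), of s u] stu \<gamma> by (intro powr_mono2) (auto simp: norm_minus_commute)
        then show "norm (f s - f u) powr \<gamma> \<le> ?v s u powr (\<gamma> / r1)" by (simp add: powr_powr)
        show "profile_norm \<alpha> p q (occ \<omega> u t) \<le> ennreal (?w u t powr (1 / r))"
          using stu by (intro occ_norm_le[OF \<omega> r(1) flow]) auto
      qed auto
      finally show ?thesis using C(1) by (simp add: ennreal_mult mult.assoc)
    qed
    show "(\<lambda>n. (\<Sum>i<N n. translate (f (\<pi> n i)) (occ \<omega> (\<pi> n i) (\<pi> n (Suc i)))) j x) \<longlonglongrightarrow> occ ?\<omega>f s t j x"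
      if "a \<le> s" "t \<le> b" "\<And>n. (N n, \<pi> n) \<in> partitions s t" "\<And>n i. i < N n \<Longrightarrow> \<pi> n (Suc i) - \<pi> n i \<le> e n" "e \<longlonglongrightarrow> 0"
      for N \<pi> e s t j x
      using that by (rule germ_sum_tendsto_variation[OF \<omega> f r(2)])
    show "(\<lambda>n. occ ?\<omega>f (u n) t j x) \<longlonglongrightarrow> occ ?\<omega>f s t j x"
      if "a \<le> s" "t \<le> b" "\<And>n. s \<le> u n" "\<And>n. u n \<le> t" "u \<longlonglongrightarrow> s" for s t u j x
      using that by (rule occ_tendsto_left[OF \<omega>fm])
    show "\<exists>x\<in>UNIV. u < x \<and> x < v" if "u < v" for u v :: real using dense[OF that] by simp
  qed (use pq r \<gamma> st in auto)
  have incr: "(\<lambda>j. LP_block \<phi> j (occupation_flow ?\<omega>f a t - occupation_flow ?\<omega>f a s)) = occ ?\<omega>f s t"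
    if "a \<le> s" "s < t" "t \<le> b" for s t
    using that sub by (intro LP_block_occupation_increment) auto
  have "variation_norm (besov_norm \<phi> (\<alpha> - \<gamma>) p q) r a b (occupation_flow ?\<omega>f a) \<le> K * variation_norm (besov_norm \<phi> \<alpha> p q) r a b (occupation_flow \<omega> a)"
    by (rule variation_norm_flow_le[OF r(1) flow incr le])
  also have "\<dots> < \<top>" using K flow by (simp add: variation_space_def ennreal_mult_less_top)
  finally have fin: "variation_norm (besov_norm \<phi> (\<alpha> - \<gamma>) p q) r a b (occupation_flow ?\<omega>f a) < \<top>" .
  moreover have "occupation_flow ?\<omega>f a t \<in> besov_space \<phi> (\<alpha> - \<gamma>) p q" if t: "t \<in> {a..b}" for t
  proof -
    have "besov_norm \<phi> (\<alpha> - \<gamma>) p q (occupation_flow ?\<omega>f a t) = profile_norm (\<alpha> - \<gamma>) p q (occ ?\<omega>f a t)"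
      using t sub by (simp add: besov_norm_eq_profile_norm LP_block_occupation_flow)
    also have "\<dots> < \<top>"
    proof (cases "t = a")
      case True
      \<comment> \<open>The sewing bound covers nondegenerate intervals only; at t = a additivity
        gives a quantity equal to its double.\<close>
      have "occ ?\<omega>f a a = 0"
        using occ_add[of a a a ?\<omega>f] sub[of a a] t by simp
      then show ?thesis using True by (simp add: profile_norm_zero[OF pq])
    next
      case False
      then have "profile_norm (\<alpha> - \<gamma>) p q (occ ?\<omega>f a t) \<le> K * ennreal (?w a t powr (1 / r))" using t by (intro le) auto
      also have "\<dots> < \<top>" using K by (simp add: ennreal_mult_less_top)
      finally show ?thesis .
    qed
    finally show ?thesis
      using t sub by (auto simp: besov_space_def intro!: tempered_occupation_flow)
  qed
  ultimately show ?thesis by (auto simp: variation_space_def)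
qed

text \<open>The germ is the difference of two translates at the same time. All dependence on the
  paths is carried by the factors in front of a normalised control, so the constant involves only
  the exponents, the regularity and the generator.\<close>

lemma occupation_flow_shift_difference:
  fixes a b :: real
  assumes ab: "a < b" and pq: "1 \<le> p" "p < \<infinity>" "1 \<le> q" and r: "0 < r" "0 < r1" and \<gamma>: "0 < \<gamma>" "\<gamma> \<le> 1" "1 < \<gamma> / r1 + 1 / r"
  obtains C where "0 \<le> C"
    "\<And>\<omega> f g :: real \<Rightarrow> 'a. \<omega> \<in> borel_measurable (lebesgue_on {a..b}) \<Longrightarrow>
      occupation_flow \<omega> a \<in> variation_space (besov_space \<phi> \<alpha> p q) (besov_norm \<phi> \<alpha> p q) r a b \<Longrightarrow>
      f \<in> variation_space UNIV vec_norm r1 a b \<Longrightarrow> g \<in> variation_space UNIV vec_norm r1 a b \<Longrightarrow>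
      variation_norm (besov_norm \<phi> (\<alpha> - \<gamma> - 1) p q) r a b
        (\<lambda>t. occupation_flow (\<lambda>s. \<omega> s + f s) a t - occupation_flow (\<lambda>s. \<omega> s + g s) a t)
      \<le> ennreal C * variation_norm (besov_norm \<phi> \<alpha> p q) r a b (occupation_flow \<omega> a) *
          (variation_norm vec_norm r1 a b (\<lambda>t. f t - g t)
            + (1 + variation_norm vec_norm r1 a b g)
              * Lp_norm (lebesgue_on {a..b}) \<infinity> (\<lambda>t. vec_norm (f t - g t)))"
proof -
  obtain C1 where C1: "\<And>s. 0 \<le> C1 s"
    "\<And>U s \<gamma> h k p q. profile U \<Longrightarrow> 1 \<le> p \<Longrightarrow> p < \<infinity> \<Longrightarrow> 1 \<le> q \<Longrightarrow> 0 \<le> \<gamma> \<Longrightarrow> \<gamma> \<le> 1 \<Longrightarrow>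
      profile_norm (s - \<gamma>) p q (translate h U - translate k U) \<le> ennreal (C1 s * norm (h - k) powr \<gamma>) * profile_norm s p q U"
    by (rule translate_increment) blast
  obtain C2 where C2: "0 \<le> C2"
    "\<And>X d d' g g'. profile X \<Longrightarrow>
      profile_norm (\<alpha> - \<gamma> - 1) p q (translate (g + d) X - translate g X - (translate (g' + d') X - translate g' X)) \<le>
      ennreal (C2 * (norm (d - d') + norm d' * norm (g - g') powr \<gamma>)) * profile_norm \<alpha> p q X"
    by (rule translate_second_increment[OF pq less_imp_le[OF \<gamma>(1)] \<gamma>(2)]) blast
  \<comment> \<open>The sewing constant with total 2 for the normalised control, one unit for each
    of its two summands.\<close>
  define Z where "Z = (\<Sum>k. (2 / real (Suc k)) powr (\<gamma> / r1 + 1 / r)) * 2 powr (\<gamma> / r1)"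
  have Z: "0 \<le> Z" unfolding Z_def by (intro mult_nonneg_nonneg suminf_nonneg summable_sewing_constant \<gamma>) auto
  define C where "C = C1 \<alpha> + C2 * Z"
  have C: "0 \<le> C" "C1 \<alpha> \<le> C" "C2 * Z \<le> C" using C1(1) C2(1) Z by (auto simp: C_def)
  have "variation_norm (besov_norm \<phi> (\<alpha> - \<gamma> - 1) p q) r a b
        (\<lambda>t. occupation_flow (\<lambda>s. \<omega> s + f s) a t - occupation_flow (\<lambda>s. \<omega> s + g s) a t)
      \<le> ennreal C * variation_norm (besov_norm \<phi> \<alpha> p q) r a b (occupation_flow \<omega> a) *
          (variation_norm vec_norm r1 a b (\<lambda>t. f t - g t)
            + (1 + variation_norm vec_norm r1 a b g)
              * Lp_norm (lebesgue_on {a..b}) \<infinity> (\<lambda>t. vec_norm (f t - g t)))"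
    if \<omega>: "\<omega> \<in> borel_measurable (lebesgue_on {a..b})"
      and flow: "occupation_flow \<omega> a \<in> variation_space (besov_space \<phi> \<alpha> p q) (besov_norm \<phi> \<alpha> p q) r a b"
      and f: "f \<in> variation_space UNIV vec_norm r1 a b" and g: "g \<in> variation_space UNIV vec_norm r1 a b"
    for \<omega> f g :: "real \<Rightarrow> 'a"
  proof -
    define d where "d t = f t - g t" for t
    have d: "d \<in> variation_space UNIV vec_norm r1 a b"
      unfolding d_def[abs_def] by (rule finite_variation_diff[OF f g r(2)])
    define L where "L = enn2real (Lp_norm (lebesgue_on {a..b}) \<infinity> (\<lambda>t. vec_norm (d t)))"
    have L: "Lp_norm (lebesgue_on {a..b}) \<infinity> (\<lambda>t. vec_norm (d t)) = ennreal L" "0 \<le> L"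
      using finite_variation_esssup[OF d r(2)] by (auto simp: L_def)
    let ?w = "variation_control (besov_norm \<phi> \<alpha> p q) r (occupation_flow \<omega> a)"
    let ?vd = "variation_control vec_norm r1 d" and ?vg = "variation_control vec_norm r1 g"
    let ?\<omega>f = "\<lambda>s. \<omega> s + f s" and ?\<omega>g = "\<lambda>s. \<omega> s + g s"
    note cd = control_on_variation_control[OF d r(2)] and cg = control_on_variation_control[OF g r(2)]
    define Vd Vg where "Vd = ?vd a b powr (1 / r1)" and "Vg = ?vg a b powr (1 / r1)"
    have V: "variation_norm vec_norm r1 a b d = ennreal Vd" "variation_norm vec_norm r1 a b g = ennreal Vg"
      using variation_control_powr[OF d r(2), of a b] variation_control_powr[OF g r(2), of a b] ab
      by (auto simp: variation_norm_eq_var_sup Vd_def Vg_def)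
    have V0: "0 \<le> Vd" "0 \<le> Vg" by (auto simp: Vd_def Vg_def)
    \<comment> \<open>Each control is divided by its total. A vanishing total gives a zero summand,
      which is consistent because that path then has no increments.\<close>
    define w1 where "w1 s t = (1 / ?vd a b) * ?vd s t + (1 / ?vg a b) * ?vg s t" for s t
    have nonneg: "0 \<le> ?vd s t" "0 \<le> ?vg s t" for s t by (auto simp: variation_control_def)
    have w1: "control_on a b w1"
      unfolding w1_def[abs_def] using nonneg by (intro control_on_add control_on_cmult cd cg) auto
    have w1_2: "w1 a b \<le> 2" by (simp add: w1_def)
    have part: "v s t powr (1 / r1) \<le> v a b powr (1 / r1) * (1 / v a b * v s t) powr (1 / r1)"
      if "control_on a b v" "a \<le> s" "s \<le> t" "t \<le> b" for v :: "real \<Rightarrow> real \<Rightarrow> real" and s t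
    proof (cases "v a b = 0")
      case True
      then have "v s t = 0"
        using control_on_mono[OF that(1), of a s t b] control_onD(1)[OF that(1), of s t] that by auto
      then show ?thesis by simp
    next
      case False
      have "0 \<le> v a b" "0 \<le> v s t" using control_onD(1)[OF that(1)] that ab by auto
      then show ?thesis using False by (subst powr_mult[symmetric]) auto
    qed
    have d_incr: "norm (d s - d u) \<le> Vd * w1 s u powr (\<gamma> / r1)" if su: "a \<le> s" "s \<le> u" "u \<le> b" for s u
    proof -
      have n: "0 \<le> 1 / ?vd a b * ?vd s u" "0 \<le> 1 / ?vg a b * ?vg s u" using nonneg by auto
      have le1: "1 / ?vd a b * ?vd s u \<le> 1"
        using control_on_mono[OF cd, of a s u b] su nonneg[of a b] by (auto simp: divide_le_eq_1)
      have "norm (d s - d u) \<le> ?vd s u powr (1 / r1)"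
        using variation_control_norm_upper[OF d r(2) su] by (simp add: norm_minus_commute)
      also have "\<dots> \<le> Vd * (1 / ?vd a b * ?vd s u) powr (1 / r1)"
        unfolding Vd_def by (rule part[OF cd su])
      also have "\<dots> \<le> Vd * (1 / ?vd a b * ?vd s u) powr (\<gamma> / r1)"
        \<comment> \<open>The normalised ratio is at most 1, so its exponent may be lowered from
          \<open>1 / r1\<close> to \<open>\<gamma> / r1\<close>, while the factor Vd keeps the first
          power. This gives linearity in the variation of \<open>f - g\<close>.\<close>
        using n le1 \<gamma> r V0 by (intro mult_left_mono powr_mono') (auto simp: divide_right_mono)
      also have "\<dots> \<le> Vd * w1 s u powr (\<gamma> / r1)"
        using n \<gamma> r V0 by (intro mult_left_mono powr_mono2) (auto simp: w1_def)
      finally show ?thesis .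
    qed
    have g_incr: "norm (g s - g u) powr \<gamma> \<le> (1 + Vg) * w1 s u powr (\<gamma> / r1)" if su: "a \<le> s" "s \<le> u" "u \<le> b" for s u
    proof -
      have n: "0 \<le> 1 / ?vd a b * ?vd s u" "0 \<le> 1 / ?vg a b * ?vg s u" using nonneg by auto
      have "norm (g s - g u) \<le> ?vg s u powr (1 / r1)"
        using variation_control_norm_upper[OF g r(2) su] by (simp add: norm_minus_commute)
      also have "\<dots> \<le> Vg * (1 / ?vg a b * ?vg s u) powr (1 / r1)"
        unfolding Vg_def by (rule part[OF cg su])
      finally have "norm (g s - g u) powr \<gamma> \<le> (Vg * (1 / ?vg a b * ?vg s u) powr (1 / r1)) powr \<gamma>"
        using \<gamma> by (intro powr_mono2) auto
      also have "\<dots> = Vg powr \<gamma> * (1 / ?vg a b * ?vg s u) powr (\<gamma> / r1)"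
        by (simp only: powr_mult powr_powr) simp
      also have "\<dots> \<le> (1 + Vg) * w1 s u powr (\<gamma> / r1)"
      proof (intro mult_mono powr_mono2)
        \<comment> \<open>The origin of the summand 1 next to the variation of g in the final
          estimate.\<close>
        show "Vg powr \<gamma> \<le> 1 + Vg"
        proof (cases "Vg \<le> 1")
          case True
          then have "Vg powr \<gamma> \<le> 1" using V0 \<gamma> by (intro powr_le1) auto
          then show ?thesis using V0 by simp
        next
          case False
          then have "Vg powr \<gamma> \<le> Vg powr 1" using \<gamma> by (intro powr_mono) auto
          then show ?thesis using False by simp
        qed
      qed (use n \<gamma> r V0 in \<open>auto simp: w1_def\<close>)
      finally show ?thesis .
    qed
    \<comment> \<open>The essential supremum does not bound \<open>d\<close> everywhere, so the germ is only evaluated at times in \<open>D\<close>.\<close>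
    define D where "D = {t \<in> {a..b}. norm (d t) \<le> L}"
    have D_dense: "\<exists>x\<in>D. u < x \<and> x < v" if uv: "a \<le> u" "u < v" "v \<le> b" for u v
    proof (rule ccontr)
      assume no: "\<not> ?thesis"
      have "AE t in lebesgue_on {a..b}. vec_norm (d t) \<le> ennreal L"
        using esssup_AE[of "\<lambda>t. vec_norm (d t)" "lebesgue_on {a..b}"] L(1) by (simp add: Lp_norm_def)
      then have "AE t in lebesgue. t \<in> {a..b} \<longrightarrow> norm (d t) \<le> L"
        using L(2) by (simp add: AE_restrict_space_iff)
      then have "AE t in lebesgue. t \<notin> {u<..<v}"
        by eventually_elim (use no uv in \<open>auto simp: D_def\<close>)
      then have "{u<..<v} \<in> null_sets lebesgue"
        by (subst AE_iff_null_sets) auto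
      then show False using uv by (auto simp: null_sets_def)
    qed
    note \<omega>fm = shifted_path_measurable[OF \<omega> f r(2)] and \<omega>gm = shifted_path_measurable[OF \<omega> g r(2)]
    have sub: "\<omega> \<in> borel_measurable (lebesgue_on {s..t})" "?\<omega>f \<in> borel_measurable (lebesgue_on {s..t})"
      "?\<omega>g \<in> borel_measurable (lebesgue_on {s..t})" if "a \<le> s" "t \<le> b" for s t
      using measurable_lebesgue_on_Icc_subset[OF \<omega> that] measurable_lebesgue_on_Icc_subset[OF \<omega>fm that]
        measurable_lebesgue_on_Icc_subset[OF \<omega>gm that] by auto
    define A where "A s t = translate (f s) (occ \<omega> s t) - translate (g s) (occ \<omega> s t)" for s t
    define F where "F s t = occ ?\<omega>f s t - occ ?\<omega>g s t" for s t
    let ?c = "ennreal (C2 * (Vd + L * (1 + Vg)))"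
    \<comment> \<open>The germ contributes a multiple of the uniform norm L; the defects contribute
      Vd from moving \<open>f - g\<close>, and L times \<open>1 + Vg\<close> from moving g.\<close>
    define K where "K = ennreal (C1 \<alpha> * L) + ?c * ennreal ((\<Sum>k. (2 / real (Suc k)) powr (\<gamma> / r1 + 1 / r)) * 2 powr (\<gamma> / r1))"
    have le: "profile_norm (\<alpha> - \<gamma> - 1) p q (F s t) \<le> K * ennreal (?w s t powr (1 / r))"
      if st: "a \<le> s" "s < t" "t \<le> b" for s t
      unfolding K_def
    proof (rule sewing_profile[where A = A and F = F and D = D and a = a and b = b and p = p and q = q
          and ?w1.0 = w1 and ?w2.0 = ?w])
      show "control_on a b ?w" by (rule control_on_variation_control[OF flow r(1)])
      show "profile (A s t)" "profile (F s t)" if "a \<le> s" "s < t" "t \<le> b" for s t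
        unfolding A_def F_def using that sub by (auto intro!: profile_diff profile_translate profile_occ)
      show "profile_norm (\<alpha> - \<gamma> - 1) p q (A s t) \<le> ennreal (C1 \<alpha> * L) * ennreal (?w s t powr (1 / r))"
        if st: "a \<le> s" "s < t" "t \<le> b" and s: "s \<in> D" for s t
      proof -
        have pr: "profile (occ \<omega> s t)" using st sub by (auto intro!: profile_occ)
        have "profile_norm (\<alpha> - \<gamma> - 1) p q (A s t) \<le> profile_norm (\<alpha> - 1) p q (A s t)"
          using \<gamma> pq by (intro profile_norm_mono_exponent) auto
        also have "\<dots> \<le> ennreal (C1 \<alpha> * norm (f s - g s) powr 1) * profile_norm \<alpha> p q (occ \<omega> s t)"
          unfolding A_def by (rule C1(2)[OF pr pq]) auto
        also have "\<dots> \<le> ennreal (C1 \<alpha> * L) * ennreal (?w s t powr (1 / r))"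
          using s C1(1) by (intro mult_mono ennreal_leI mult_left_mono occ_norm_le[OF \<omega> r(1) flow st]) (auto simp: D_def d_def)
        finally show ?thesis .
      qed
      show "profile_norm (\<alpha> - \<gamma> - 1) p q (A s t - A s u - A u t) \<le> ?c * ennreal (w1 s u powr (\<gamma> / r1) * ?w u t powr (1 / r))"
        if stu: "a \<le> s" "s < u" "u < t" "t \<le> b" and su: "s \<in> D" "u \<in> D" for s u t
      proof -
        define X where "X = occ \<omega> u t"
        have X: "profile X" unfolding X_def using stu sub by (auto intro!: profile_occ)
        have "occ \<omega> s t = occ \<omega> s u + X" unfolding X_def using stu sub by (intro occ_add) auto
        then have "A s t - A s u - A u t =
          translate (g s + d s) X - translate (g s) X - (translate (g u + d u) X - translate (g u) X)"
          by (simp add: A_def d_def X_def translate_def fun_eq_iff)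
        then have "profile_norm (\<alpha> - \<gamma> - 1) p q (A s t - A s u - A u t) \<le>
          ennreal (C2 * (norm (d s - d u) + norm (d u) * norm (g s - g u) powr \<gamma>)) * profile_norm \<alpha> p q X"
          using C2(2)[OF X] by (simp only:)
        also have "\<dots> \<le> ennreal (C2 * ((Vd + L * (1 + Vg)) * w1 s u powr (\<gamma> / r1))) * ennreal (?w u t powr (1 / r))"
        proof (intro mult_mono ennreal_leI mult_left_mono C2(1))
          have "norm (d u) * norm (g s - g u) powr \<gamma> \<le> L * ((1 + Vg) * w1 s u powr (\<gamma> / r1))"
            using su stu g_incr[of s u] L(2) by (intro mult_mono) (auto simp: D_def)
          then show "norm (d s - d u) + norm (d u) * norm (g s - g u) powr \<gamma> \<le> (Vd + L * (1 + Vg)) * w1 s u powr (\<gamma> / r1)"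
            using d_incr[of s u] stu by (simp add: distrib_right mult.assoc)
          show "profile_norm \<alpha> p q X \<le> ennreal (?w u t powr (1 / r))"
            unfolding X_def using stu by (intro occ_norm_le[OF \<omega> r(1) flow]) auto
        qed auto
        also have "\<dots> = ?c * ennreal (w1 s u powr (\<gamma> / r1) * ?w u t powr (1 / r))"
          using C2(1) V0 L(2) by (simp add: ennreal_mult mult.assoc)
        finally show ?thesis .
      qed
      show "(\<lambda>n. (\<Sum>i<N n. A (\<pi> n i) (\<pi> n (Suc i))) j x) \<longlonglongrightarrow> F s t j x"
        if "a \<le> s" "t \<le> b" "\<And>n. (N n, \<pi> n) \<in> partitions s t" "\<And>n i. i < N n \<Longrightarrow> \<pi> n (Suc i) - \<pi> n i \<le> e n" "e \<longlonglongrightarrow> 0"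
        for N \<pi> e s t j x
        using tendsto_diff[OF germ_sum_tendsto_variation[OF \<omega> f r(2) that, of j x] germ_sum_tendsto_variation[OF \<omega> g r(2) that, of j x]]
        by (simp add: A_def F_def sum_subtractf)
      show "(\<lambda>n. F (u n) t j x) \<longlonglongrightarrow> F s t j x"
        if "a \<le> s" "t \<le> b" "\<And>n. s \<le> u n" "\<And>n. u n \<le> t" "u \<longlonglongrightarrow> s" for s t u j x
        using tendsto_diff[OF occ_tendsto_left[OF \<omega>fm that, of j x] occ_tendsto_left[OF \<omega>gm that, of j x]]
        by (simp add: F_def)
      show "\<exists>x\<in>D. u < x \<and> x < v" if "a \<le> u" "u < v" "v \<le> b" for u v
        using that by (rule D_dense)
    qed (use pq r \<gamma> st w1 w1_2 in auto)
    have incr: "(\<lambda>j. LP_block \<phi> j ((occupation_flow ?\<omega>f a t - occupation_flow ?\<omega>g a t) - (occupation_flow ?\<omega>f a s - occupation_flow ?\<omega>g a s))) = F s t"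
      if "a \<le> s" "s < t" "t \<le> b" for s t
    proof -
      have "(occupation_flow ?\<omega>f a t - occupation_flow ?\<omega>g a t) - (occupation_flow ?\<omega>f a s - occupation_flow ?\<omega>g a s) =
        (occupation_flow ?\<omega>f a t - occupation_flow ?\<omega>f a s) - (occupation_flow ?\<omega>g a t - occupation_flow ?\<omega>g a s)"
        by simp
      then show ?thesis
        using that sub by (simp only: LP_block_diff[of "occupation_flow ?\<omega>f a t - occupation_flow ?\<omega>f a s"] F_def)
          (simp add: LP_block_occupation_increment)
    qed
    have "variation_norm (besov_norm \<phi> (\<alpha> - \<gamma> - 1) p q) r a b (\<lambda>t. occupation_flow ?\<omega>f a t - occupation_flow ?\<omega>g a t) \<le>
      K * variation_norm (besov_norm \<phi> \<alpha> p q) r a b (occupation_flow \<omega> a)"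
      by (rule variation_norm_flow_le[OF r(1) flow incr le])
    also have "\<dots> \<le> ennreal (C * (Vd + (1 + Vg) * L)) * variation_norm (besov_norm \<phi> \<alpha> p q) r a b (occupation_flow \<omega> a)"
    proof (rule mult_right_mono)
      have "C1 \<alpha> * L \<le> C1 \<alpha> * (Vd + (1 + Vg) * L)"
        using V0 L(2) C1(1) by (intro mult_left_mono) (auto simp: distrib_right)
      \<comment> \<open>C is the sum of a germ constant and a defect constant; the germ term, which
        carries L alone, is enlarged to the full bracket.\<close>
      moreover have "C * (Vd + (1 + Vg) * L) = C1 \<alpha> * (Vd + (1 + Vg) * L) + C2 * (Vd + L * (1 + Vg)) * Z"
        by (simp add: C_def algebra_simps)
      ultimately have "C1 \<alpha> * L + C2 * (Vd + L * (1 + Vg)) * Z \<le> C * (Vd + (1 + Vg) * L)" by simp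
      moreover have "K = ennreal (C1 \<alpha> * L + C2 * (Vd + L * (1 + Vg)) * Z)"
        unfolding K_def Z_def[symmetric] using C1(1) C2(1) Z V0 L(2) by (simp add: ennreal_mult ennreal_plus)
      ultimately show "K \<le> ennreal (C * (Vd + (1 + Vg) * L))" by (simp add: ennreal_leI)
    qed simp
    also have "ennreal (C * (Vd + (1 + Vg) * L)) = ennreal C * (ennreal Vd + (1 + ennreal Vg) * ennreal L)"
      using C(1) V0 L(2) by (simp add: ennreal_mult)
    finally show ?thesis
      unfolding V[unfolded d_def[abs_def]] L(1)[unfolded d_def[abs_def]] by (simp only: mult_ac)
  qed
  then show ?thesis by (rule that[OF C(1)])
qed

end

theorem proposition3p3:
  fixes a b r r' r1 \<alpha> \<gamma> :: real
    and p q :: ennreal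
    and \<phi> :: "'a::euclidean_space \<Rightarrow> complex"
  assumes "a < b"
    and "dyadic_generator \<phi>"
    and "1 < r" and "1 / r + 1 / r' = 1"
    and "1 < p" and "p < \<infinity>"
    and "1 \<le> q"
    and "1 \<le> r1"
    and "r1 / r' < \<gamma>" and "\<gamma> \<le> 1"
  shows
    "(\<forall>\<omega> f :: real \<Rightarrow> 'a.
        \<omega> \<in> borel_measurable (lebesgue_on {a..b}) \<longrightarrow>
        occupation_flow \<omega> a \<in>
          variation_space (besov_space \<phi> \<alpha> p q) (besov_norm \<phi> \<alpha> p q) r a b \<longrightarrow>
        f \<in> variation_space UNIV vec_norm r1 a b \<longrightarrow>
        occupation_flow (\<lambda>s. \<omega> s + f s) a \<in>
          variation_space (besov_space \<phi> (\<alpha> - \<gamma>) p q) (besov_norm \<phi> (\<alpha> - \<gamma>) p q) r a b)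
     \<and>
     (\<exists>C \<ge> 0. \<forall>\<omega> f g :: real \<Rightarrow> 'a.
        \<omega> \<in> borel_measurable (lebesgue_on {a..b}) \<longrightarrow>
        occupation_flow \<omega> a \<in>
          variation_space (besov_space \<phi> \<alpha> p q) (besov_norm \<phi> \<alpha> p q) r a b \<longrightarrow>
        f \<in> variation_space UNIV vec_norm r1 a b \<longrightarrow>
        g \<in> variation_space UNIV vec_norm r1 a b \<longrightarrow>
        variation_norm (besov_norm \<phi> (\<alpha> - \<gamma> - 1) p q) r a b
          (\<lambda>t. occupation_flow (\<lambda>s. \<omega> s + f s) a t - occupation_flow (\<lambda>s. \<omega> s + g s) a t)
        \<le> ennreal C * variation_norm (besov_norm \<phi> \<alpha> p q) r a b (occupation_flow \<omega> a) *
            (variation_norm vec_norm r1 a b (\<lambda>t. f t - g t)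
              + (1 + variation_norm vec_norm r1 a b g)
                * Lp_norm (lebesgue_on {a..b}) \<infinity> (\<lambda>t. vec_norm (f t - g t))))"
proof -
  interpret littlewood_paley \<phi> by unfold_locales (rule assms)
  have r': "1 / r' = 1 - 1 / r" using assms by simp
  have r: "0 < r" "0 < r1" using assms by auto
  have "0 < 1 / r'" unfolding r' using assms by simp
  then have "0 < r1 / r'" using r by (simp add: zero_less_divide_iff)
  then have \<gamma>: "0 < \<gamma>" using assms by linarith
  \<comment> \<open>Divided by r1, the lower bound on \<gamma> says exactly that the sewing
    exponents \<open>\<gamma> / r1\<close> and \<open>1 / r\<close> exceed 1 in sum.\<close>
  have "1 / r' < \<gamma> / r1" using assms r by (simp add: field_simps)
  then have \<theta>: "1 < \<gamma> / r1 + 1 / r" unfolding r' by simp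
  have p: "1 \<le> p" using assms by simp
  obtain C where C: "0 \<le> C"
    "\<And>\<omega> f g :: real \<Rightarrow> 'a. \<omega> \<in> borel_measurable (lebesgue_on {a..b}) \<Longrightarrow>
      occupation_flow \<omega> a \<in> variation_space (besov_space \<phi> \<alpha> p q) (besov_norm \<phi> \<alpha> p q) r a b \<Longrightarrow>
      f \<in> variation_space UNIV vec_norm r1 a b \<Longrightarrow> g \<in> variation_space UNIV vec_norm r1 a b \<Longrightarrow>
      variation_norm (besov_norm \<phi> (\<alpha> - \<gamma> - 1) p q) r a b
        (\<lambda>t. occupation_flow (\<lambda>s. \<omega> s + f s) a t - occupation_flow (\<lambda>s. \<omega> s + g s) a t)
      \<le> ennreal C * variation_norm (besov_norm \<phi> \<alpha> p q) r a b (occupation_flow \<omega> a) *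
          (variation_norm vec_norm r1 a b (\<lambda>t. f t - g t)
            + (1 + variation_norm vec_norm r1 a b g)
              * Lp_norm (lebesgue_on {a..b}) \<infinity> (\<lambda>t. vec_norm (f t - g t)))"
    by (rule occupation_flow_shift_difference[OF assms(1) p assms(6,7) r \<gamma> assms(10) \<theta>]) blast
  show ?thesis
  proof (intro conjI allI impI exI[of _ C])
    fix \<omega> f :: "real \<Rightarrow> 'a"
    assume "\<omega> \<in> borel_measurable (lebesgue_on {a..b})"
      "occupation_flow \<omega> a \<in> variation_space (besov_space \<phi> \<alpha> p q) (besov_norm \<phi> \<alpha> p q) r a b"
      "f \<in> variation_space UNIV vec_norm r1 a b"
    then show "occupation_flow (\<lambda>s. \<omega> s + f s) a \<in>
      variation_space (besov_space \<phi> (\<alpha> - \<gamma>) p q) (besov_norm \<phi> (\<alpha> - \<gamma>) p q) r a b"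
      by (rule occupation_flow_shift[OF p assms(6,7) r \<gamma> assms(10) \<theta>])
  qed (fact C)+
qed

end
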